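(* Let $J$ be the Jacobi matrix of Example 5.1 (described in the context) and $\rho$ its spectral measure. Then $\sigma(J)=[-2,2]$ and $\rho$ is regular (i.e. $(a_1\cdots a_n)^{1/n}\to1$); on $[-2,2]\setminus[-1,1]$ the spectrum of $J$ is purely singular and for Lebesgue almost every $x_0\in[-2,2]\setminus[-1,1]$ the Nevai condition fails at $x_0$; on $(-1,1)$ the spectrum of $J$ is purely absolutely continuous, and for every compact $K\subset(-1,1)$, $\sup_{x_0\in K}p_n(x_0)^2/K_n(x_0,x_0)\to0$, so in particular the Nevai condition holds at every $x_0\in(-1,1)$, uniformly on compact subsets.
   Context: Example 5.1: partition $\{1,2,\dots\}$ into successive consecutive blocks $A_1,B_1,C_1,D_1,A_2,B_2,C_2,D_2,\dots$ with $\#A_j=3^{j^2}$, $\#C_j=2^{j^2}$, $\#B_j=\#D_j=j^6-1$. Let $b_n=0$ for all $n$; $a_n=1$ for $n\in A_j$ and $a_n=\tfrac12$ for $n\in C_j$; on $B_j$ and $D_j$, $\log(a_n^2)$ interpolates linearly: if $s$ is the last index of $A_j$, then $a_{s+i}=2^{-i/j^6}$ for $1\le i\le j^6-1$ (these are the indices of $B_j$), and if $t$ is the last index of $C_j$, then $a_{t+i}=2^{-1+i/j^6}$ for $1\le i\le j^6-1$ (the indices of $D_j$). $J$ is the operator on $\ell^2(\{1,2,\dots\})$ with $J_{nn}=b_n$, $J_{n,n+1}=J_{n+1,n}=a_n$; $\rho$ is the spectral measure of $J$ and $\delta_1$; $p_n$ ($n\ge0$) are its orthonormal polynomials ($p_{-1}=0$,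 $p_0=1$, $xp_n=a_{n+1}p_{n+1}+b_{n+1}p_n+a_np_{n-1}$); $K_n(x,y)=\sum_{j=0}^np_j(x)p_j(y)$. The Nevai condition at $x_0$ means $K_n(x,x_0)^2\,d\rho(x)/K_n(x_0,x_0)\to\delta_{x_0}$ weakly. *)

theory Defs
  imports "HOL-Analysis.Analysis"
begin

text \<open>Indices start at 1; the value at index 0 is a dummy (set to 0) and never used.
Group j (j \<ge> 1) consists of the consecutive blocks A_j, B_j, C_j, D_j.\<close>

definition grp_len :: "nat \<Rightarrow> nat" where
  "grp_len j = 3^(j^2) + (j^6 - 1) + 2^(j^2) + (j^6 - 1)"

definition grp_start :: "nat \<Rightarrow> nat" where
  "grp_start j = (\<Sum>i\<in>{1..<j}. grp_len i)"

definition grp_of :: "nat \<Rightarrow> nat" where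
  "grp_of n = (LEAST j. n \<le> grp_start (Suc j))"

definition ex_a :: "nat \<Rightarrow> real" where
  "ex_a n = (if n = 0 then 0 else
     (let j = grp_of n; m = n - grp_start j;
          sA = 3^(j^2); sB = j^6 - 1; sC = 2^(j^2) in
      if m \<le> sA then 1
      else if m \<le> sA + sB then 2 powr (- real (m - sA) / real (j^6))
      else if m \<le> sA + sB + sC then 1/2
      else 2 powr (-1 + real (m - (sA + sB + sC)) / real (j^6))))"

definition ex_b :: "nat \<Rightarrow> real" where
  "ex_b n = 0"

text \<open>Complex \<ell>^2 over the index set {1,2,...}, realised as sequences vanishing at 0.\<close>
definition l2 :: "(nat \<Rightarrow> complex) set" where
  "l2 = {x. x 0 = 0 \<and> summable (\<lambda>n. (cmod (x n))^2)}"

definition jacobi_op :: "(nat \<Rightarrow> real) \<Rightarrow> (nat \<Rightarrow> real) \<Rightarrow> (nat \<Rightarrow> complex) \<Rightarrow> nat \<Rightarrow> complex" where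
  "jacobi_op a b x n = (if n = 0 then 0 else
     (if n \<ge> 2 then complex_of_real (a (n - 1)) * x (n - 1) else 0)
     + complex_of_real (b n) * x n + complex_of_real (a n) * x (Suc n))"

text \<open>Spectrum: z \<in> \<sigma>(J) iff J - z is not a bijection of \<ell>^2 onto itself
(bounded inverse is then automatic by the open mapping theorem).\<close>
definition jacobi_spectrum :: "(nat \<Rightarrow> real) \<Rightarrow> (nat \<Rightarrow> real) \<Rightarrow> complex set" where
  "jacobi_spectrum a b =
     {z. \<not> bij_betw (\<lambda>x n. jacobi_op a b x n - z * x n) l2 l2}"

definition delta1 :: "nat \<Rightarrow> complex" where
  "delta1 n = (if n = 1 then 1 else 0)"

text \<open>rho is the spectral measure of J and delta_1: the (finite, Borel) measure on the
reals with moments  int x^k d rho = <delta_1, J^k delta_1>  for all k (J bounded, so this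
determines rho uniquely).\<close>
definition is_spectral_measure :: "(nat \<Rightarrow> real) \<Rightarrow> (nat \<Rightarrow> real) \<Rightarrow> real measure \<Rightarrow> bool" where
  "is_spectral_measure a b \<rho> \<longleftrightarrow>
     sets \<rho> = sets borel \<and> finite_measure \<rho> \<and>
     (\<forall>k::nat. integrable \<rho> (\<lambda>x. x ^ k) \<and>
        complex_of_real (\<integral>x. x ^ k \<partial>\<rho>) = ((jacobi_op a b ^^ k) delta1) 1)"

text \<open>p_{-1} = 0, p_0 = 1, x p_n = a_{n+1} p_{n+1} + b_{n+1} p_n + a_n p_{n-1}.\<close>
fun opoly :: "(nat \<Rightarrow> real) \<Rightarrow> (nat \<Rightarrow> real) \<Rightarrow> nat \<Rightarrow> real \<Rightarrow> real" where
  "opoly a b 0 x = 1"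
| "opoly a b (Suc 0) x = (x - b 1) / a 1"
| "opoly a b (Suc (Suc n)) x =
     ((x - b (n + 2)) * opoly a b (Suc n) x - a (n + 1) * opoly a b n x) / a (n + 2)"

definition CD_kernel :: "(nat \<Rightarrow> real) \<Rightarrow> (nat \<Rightarrow> real) \<Rightarrow> nat \<Rightarrow> real \<Rightarrow> real \<Rightarrow> real" where
  "CD_kernel a b n x y = (\<Sum>j\<le>n. opoly a b j x * opoly a b j y)"

text \<open>Nevai condition at x0: K_n(x,x0)^2 d rho(x) / K_n(x0,x0) \<rightarrow> delta_{x0} weakly,
i.e. tested against all bounded continuous functions.\<close>
definition nevai_at :: "(nat \<Rightarrow> real) \<Rightarrow> (nat \<Rightarrow> real) \<Rightarrow> real measure \<Rightarrow> real \<Rightarrow> bool" where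
  "nevai_at a b \<rho> x0 \<longleftrightarrow>
     (\<forall>f::real \<Rightarrow> real. continuous_on UNIV f \<and> bounded (range f) \<longrightarrow>
        (\<lambda>n. (\<integral>x. f x * (CD_kernel a b n x x0)^2 \<partial>\<rho>) / CD_kernel a b n x0 x0)
          \<longlonglongrightarrow> f x0)"

end

theory Submission
  imports Defs
begin

text \<open>
Write $a_n = 2^{-e_n}$, so that the exponents $e_n$ are constant apart from ramps of slope $j^{-6}$.

Spectrum. The numerical range of $J$ lies in $[-2,2]$, which bounds finite sections of $(J - z)^{-1}$
off $[-2,2]$; for $x = 2\cos t$ the vector $n^{-3/4} e^{itn}$ is not in the range of $J - x$, because its
pairing with $e^{-itn}$ telescopes on the long blocks $A_j$.

Energies $|x| < 1$ are elliptic for all entries. The quantities $\delta_n = a_{n+1}^2 - a_n^2$ satisfy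
$\sum_n (\delta_n^2 + |\delta_{n+1} - \delta_n|) < \infty$, and a discrete WKB argument with an adiabatic
invariant shows that all solutions of the eigenvalue equation stay comparable to their initial size.
Hence $K_n(x,x)$ is of order $n$ and $p_n$ is bounded, which gives the Nevai condition by
Chebyshev's inequality; as $K_n(y,x)$ stays comparable to $K_n(x,x)$ for $|y - x| \le c/n$,
also $\rho(I) \le C |I|$ for intervals $I$.

Energies $1 < |x| < 2$ are elliptic on $A_j$ and hyperbolic on $C_j$, whose length $2^{j^2}$ exceeds by far
the total length of all preceding blocks other than $A_i$. On $C_j$ solutions grow
like $\lambda(x)^{2^{j^2}}$ unless the initial data are almost exactly in the contracting direction; the
expansion property $(p_{n+1}/p_n)' \ge 1$ (confluent Christoffel-Darboux formula) and counting
the zeros of $p_n$ show that the exceptional $x$ have measure $O(3^{-j^2})$. By Borel-Cantelli, for almost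
every $x$ the numbers $p_n(x)$ are not polynomially bounded, whereas they are $\rho$-almost everywhere, so
$\rho$ is singular there. Moreover $K_n$ grows exponentially along $C_j$, while the Nevai condition
forces $K_{n+1}/K_n \to 1$.
\<close>


section \<open>Orthonormal polynomials of a bounded Jacobi matrix with zero diagonal\<close>

text \<open>The weights have infinite total variation: every group takes a_n^2 from 1 to 1/4 and
  back. A Gronwall estimate with |delta_n| therefore diverges, and the first order has to be
  cancelled exactly. The second order is summable: a ramp has about j^6 steps, with delta^2 and
  inner second differences of order j^(-12), and two kinks of order j^(-6). At hyperbolic energies
  three scales are balanced. The polynomial entering C_j has degree of order 3^(j^2), hence at most
  that many zeros, so a tolerance 9^(-j^2) around the contracting direction leaves measure of order
  3^(-j^2); the price 9^(j^2) is negligible against the growth on C_j. The amplitude may have shrunk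
  before C_j, but stretches with all weights 1 preserve a definite form, so the loss is exponential
  only in the number of other entries, which is dominated by j * 2^((j-1)^2), smaller than 2^(j^2)
  by a factor of order j * 4^(-j). The measure is given by its moments alone; all that is used of it
  follows from orthonormality: Parseval for K_n(x,y) and (x-y) K_n(x,y), and Chebyshev's
  inequality.\<close>

declare opoly.simps(2,3) [simp del]

locale jacobi_seq =
  fixes a b :: "nat \<Rightarrow> real"
  assumes a_ge: "1 \<le> n \<Longrightarrow> 1/2 \<le> a n"
    and a_le: "1 \<le> n \<Longrightarrow> a n \<le> 1"
    and b_zero: "b n = 0"
begin

text \<open>Polynomials are counted from 0 and entries from 1: \<open>A n\<close> is the weight that
  couples \<open>p n\<close> with \<open>p (Suc n)\<close>.\<close>

abbreviation "A n \<equiv> a (Suc n)"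
abbreviation "p \<equiv> opoly a b"
abbreviation "K \<equiv> CD_kernel a b"

lemma A_ge: "1/2 \<le> A n" and A_le: "A n \<le> 1" and A_pos: "0 < A n" and A_nz: "A n \<noteq> 0"
  using a_ge[of "Suc n"] a_le[of "Suc n"] by auto

lemma p_one: "A 0 * p (Suc 0) x = x"
  using A_nz[of 0] by (simp add: b_zero opoly.simps)

lemma p_rec: "A (Suc n) * p (Suc (Suc n)) x = x * p (Suc n) x - A n * p n x"
  using A_nz[of "Suc n"] by (simp add: b_zero opoly.simps)

lemma K_Suc: "K (Suc n) x y = K n x y + p (Suc n) x * p (Suc n) y"
  by (simp add: CD_kernel_def)

lemma K_ge_1: "1 \<le> K n x x"
proof (induction n)
  case (Suc n)
  moreover have "0 \<le> p (Suc n) x * p (Suc n) x" by simp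
  ultimately show ?case unfolding K_Suc by linarith
qed (simp add: CD_kernel_def)

lemma K_pos: "0 < K n x x"
  using K_ge_1[of n x] by linarith

lemma p_sq_le_K: "k \<le> n \<Longrightarrow> (p k x)^2 \<le> K n x x"
  unfolding CD_kernel_def power2_eq_square by (rule member_le_sum) auto

lemma christoffel_darboux:
  "(x - y) * K n x y = A n * (p (Suc n) x * p n y - p n x * p (Suc n) y)"
proof (induction n)
  case 0
  have "A 0 * (p (Suc 0) x * p 0 y - p 0 x * p (Suc 0) y) = A 0 * p (Suc 0) x - A 0 * p (Suc 0) y"
    by (simp add: algebra_simps)
  then show ?case unfolding p_one by (simp add: CD_kernel_def)
next
  case (Suc n)
  have "A (Suc n) * (p (Suc (Suc n)) x * p (Suc n) y - p (Suc n) x * p (Suc (Suc n)) y)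
      = (A (Suc n) * p (Suc (Suc n)) x) * p (Suc n) y - p (Suc n) x * (A (Suc n) * p (Suc (Suc n)) y)"
    by (simp only: algebra_simps)
  also have "... = (x - y) * (p (Suc n) x * p (Suc n) y) + A n * (p (Suc n) x * p n y - p n x * p (Suc n) y)"
    unfolding p_rec by (simp only: algebra_simps)
  finally show ?case unfolding Suc[symmetric] K_Suc by (simp add: algebra_simps)
qed

lemma p_differentiable: "p n differentiable (at x)"
proof (induction n rule: induct_nat_012)
  case 0 then show ?case by (simp add: opoly.simps(1)[abs_def])
next
  case 1 then show ?case by (simp add: opoly.simps(2)[abs_def] divide_inverse)
next
  case (ge2 n)
  then show ?case by (simp add: opoly.simps(3)[abs_def] divide_inverse)
qed

lemma p_has_deriv: "(p n has_real_derivative deriv (p n) x) (at x)"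
  using p_differentiable DERIV_deriv_iff_real_differentiable by blast

lemma continuous_p: "continuous_on S (p n)"
  using p_has_deriv by (meson DERIV_continuous_on has_field_derivative_at_within)

text \<open>Differentiating the recursion shows that the left side gains
  \<open>(p (Suc n) x)^2\<close> at each step. Its positivity makes \<open>p (Suc n) / p n\<close>
  increasing between zeros of \<open>p n\<close>.\<close>

lemma christoffel_darboux_confluent:
  "A n * (deriv (p (Suc n)) x * p n x - deriv (p n) x * p (Suc n) x) = K n x x"
proof (induction n)
  case 0
  have "(p 0 has_real_derivative 0) (at x)" by (simp add: opoly.simps(1)[abs_def])
  moreover have "(p (Suc 0) has_real_derivative (1 / A 0)) (at x)"
    using A_nz[of 0] by (auto simp: opoly.simps(2)[abs_def] b_zero intro!: derivative_eq_intros)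
  ultimately show ?case using A_nz[of 0] by (simp add: DERIV_imp_deriv CD_kernel_def)
next
  case (Suc n)
  have "((\<lambda>x. A (Suc n) * p (Suc (Suc n)) x) has_real_derivative A (Suc n) * deriv (p (Suc (Suc n))) x) (at x)"
    by (auto intro!: derivative_eq_intros p_has_deriv)
  moreover have "((\<lambda>x. x * p (Suc n) x - A n * p n x) has_real_derivative
      p (Suc n) x + x * deriv (p (Suc n)) x - A n * deriv (p n) x) (at x)"
    by (auto intro!: derivative_eq_intros p_has_deriv)
  ultimately have d: "A (Suc n) * deriv (p (Suc (Suc n))) x
      = p (Suc n) x + x * deriv (p (Suc n)) x - A n * deriv (p n) x"
    unfolding p_rec by (rule DERIV_unique)
  have "A (Suc n) * (deriv (p (Suc (Suc n))) x * p (Suc n) x - deriv (p (Suc n)) x * p (Suc (Suc n)) x)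
      = (A (Suc n) * deriv (p (Suc (Suc n))) x) * p (Suc n) x - deriv (p (Suc n)) x * (A (Suc n) * p (Suc (Suc n)) x)"
    by (simp only: algebra_simps)
  also have "... = p (Suc n) x * p (Suc n) x + A n * (deriv (p (Suc n)) x * p n x - deriv (p n) x * p (Suc n) x)"
    unfolding p_rec d by (simp only: algebra_simps)
  finally show ?case unfolding Suc K_Suc by simp
qed

text \<open>Links \<open>p n\<close> to the type of polynomials, for counting zeros and for
  integrability under a measure of which only the moments are known.\<close>

lemma ex_opoly_poly: "\<exists>q::real poly. (\<forall>x. p n x = poly q x) \<and> degree q = n"
proof (induction n rule: induct_nat_012)
  case 0 show ?case by (rule exI[of _ 1]) simp
next
  case 1 show ?case using A_nz[of 0] by (intro exI[of _ "[:0, 1 / A 0:]"]) (simp add: b_zero opoly.simps)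
next
  case (ge2 n)
  then obtain q r where q: "\<forall>x. p n x = poly q x" "degree q = n"
    and r: "\<forall>x. p (Suc n) x = poly r x" "degree r = Suc n" by blast
  let ?s = "smult (1 / A (Suc n)) ([:0, 1:] * r - smult (A n) q)"
  have "degree ([:0, 1:] * r) = Suc (Suc n)" using r(2) by (subst degree_mult_eq) auto
  moreover have "degree (smult (A n) q) < Suc (Suc n)" using q(2) degree_smult_le[of "A n" q] by simp
  ultimately have "degree ([:0, 1:] * r - smult (A n) q) = Suc (Suc n)"
    using degree_add_eq_left[of "- smult (A n) q" "[:0, 1:] * r"] by simp
  then have "degree ?s = Suc (Suc n)" using A_nz[of "Suc n"] by simp
  moreover have "\<forall>x. p (Suc (Suc n)) x = poly ?s x"
    using q r by (auto simp: b_zero opoly.simps field_simps)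
  ultimately show ?case by blast
qed

definition opol :: "nat \<Rightarrow> real poly" where
  "opol n = (SOME q. (\<forall>x. p n x = poly q x) \<and> degree q = n)"

lemma p_eq_poly: "p n x = poly (opol n) x" and degree_opol: "degree (opol n) = n"
proof -
  have "(\<forall>x. p n x = poly (opol n) x) \<and> degree (opol n) = n"
    unfolding opol_def by (rule someI_ex[OF ex_opoly_poly])
  then show "p n x = poly (opol n) x" "degree (opol n) = n" by blast+
qed

lemma opol_nz: "opol n \<noteq> 0"
proof (cases "n = 0")
  case True
  then show ?thesis using p_eq_poly[of 0 0] by auto
next
  case False
  then show ?thesis using degree_opol[of n] by force
qed

lemma p_zeros: "finite {x. p n x = 0}" "card {x. p n x = 0} \<le> n"
  unfolding p_eq_poly using poly_roots_finite[OF opol_nz[of n]] card_poly_roots_bound[OF opol_nz[of n]] degree_opol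
  by auto

lemma p_minus: "p n (- x) = (-1)^n * p n x"
proof (induction n rule: induct_nat_012)
  case (ge2 n)
  then show ?case using A_nz[of "Suc n"] by (simp add: b_zero opoly.simps field_simps)
qed (auto simp: b_zero opoly.simps)

text \<open>On coefficient sequences, multiplication by the variable acts as the Jacobi matrix; the
  last two terms are left over by the truncation at \<open>M\<close>.\<close>

lemma mult_x_sum:
  "x * (\<Sum>n\<le>M. f n * p n x) = (\<Sum>n\<le>M. (case n of 0 \<Rightarrow> A 0 * f 1 | Suc k \<Rightarrow> A k * f k + A (Suc k) * f (Suc (Suc k))) * p n x)
     + A M * f M * p (Suc M) x - A M * f (Suc M) * p M x"
proof (induction M)
  case 0
  then show ?case using p_one[of x] by (simp add: algebra_simps)
next
  case (Suc M)
  have "x * (f (Suc M) * p (Suc M) x) = f (Suc M) * (A (Suc M) * p (Suc (Suc M)) x + A M * p M x)"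
    unfolding p_rec by (simp only: algebra_simps)
  then show ?case unfolding sum.atMost_Suc distrib_left Suc
    by (simp add: algebra_simps)
qed

text \<open>The vector J^k delta_1, with real entries and positions counted from 0.\<close>

primrec mvec :: "nat \<Rightarrow> nat \<Rightarrow> real" where
  "mvec 0 = (\<lambda>n. if n = 0 then 1 else 0)"
| "mvec (Suc k) = (\<lambda>n. case n of 0 \<Rightarrow> A 0 * mvec k 1 | Suc i \<Rightarrow> A i * mvec k i + A (Suc i) * mvec k (Suc (Suc i)))"

lemma jacobi_op_pow: "(jacobi_op a b ^^ k) delta1 (Suc n) = complex_of_real (mvec k n)"
proof (induction k arbitrary: n)
  case 0 then show ?case by (simp add: delta1_def)
next
  case (Suc k)
  then show ?case by (cases n) (simp_all add: jacobi_op_def b_zero)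
qed

lemma mvec_bound: "\<bar>mvec k n\<bar> \<le> 2^k"
proof (induction k arbitrary: n)
  case (Suc k)
  have *: "\<bar>A i * mvec k m\<bar> \<le> 2^k" for i m
    using mult_mono[of "\<bar>A i\<bar>" 1 "\<bar>mvec k m\<bar>" "2^k"] Suc[of m] A_le[of i] A_pos[of i] by (simp add: abs_mult)
  show ?case
  proof (cases n)
    case 0
    then show ?thesis using *[of 0 1] by simp
  next
    case (Suc i)
    then show ?thesis using *[of i i] *[of "Suc i" "Suc (Suc i)"] by simp
  qed
qed simp

lemma mvec_zero: "k < n \<Longrightarrow> mvec k n = 0"
  by (induction k arbitrary: n) (auto split: nat.split)

lemma mvec_diag: "mvec k k > 0"
  by (induction k) (auto simp: mvec_zero A_pos)

text \<open>In the basis \<open>p n\<close> the constant \<open>p 0\<close> corresponds to delta_1.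
  As \<open>mvec k\<close> vanishes beyond \<open>k\<close>, the truncation terms of
  \<open>mult_x_sum\<close> disappear.\<close>

lemma power_expansion: "x^k = (\<Sum>n\<le>k. mvec k n * p n x)"
proof (induction k)
  case (Suc k)
  have "x^Suc k = x * (\<Sum>n\<le>Suc k. mvec k n * p n x)" using Suc by (simp add: mvec_zero)
  also have "... = (\<Sum>n\<le>Suc k. mvec (Suc k) n * p n x)"
    unfolding mult_x_sum by (simp add: mvec_zero)
  finally show ?case .
qed simp

end

section \<open>Orthonormality and kernel integrals derived from the moments\<close>

locale jacobi_measure = jacobi_seq +
  fixes \<rho> :: "real measure"
  assumes spec: "is_spectral_measure a b \<rho>"
begin

sublocale finite_measure \<rho>
  using spec by (simp add: is_spectral_measure_def)

lemma sets_rho [measurable_cong, simp]: "sets \<rho> = sets borel"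
  using spec by (simp add: is_spectral_measure_def)

lemma space_rho [simp]: "space \<rho> = UNIV"
  using sets_eq_imp_space_eq[OF sets_rho] by simp

lemma measurable_p [measurable]: "p n \<in> borel_measurable borel"
  using continuous_p by (rule borel_measurable_continuous_onI)

lemma integrable_power: "integrable \<rho> (\<lambda>x. x^k)"
  using spec by (simp add: is_spectral_measure_def)

lemma moment: "(\<integral>x. x^k \<partial>\<rho>) = mvec k 0"
proof -
  have "complex_of_real (\<integral>x. x^k \<partial>\<rho>) = (jacobi_op a b ^^ k) delta1 1"
    using spec by (simp add: is_spectral_measure_def)
  then show ?thesis using jacobi_op_pow[of k 0] by (simp del: of_real_power)
qed

lemma integrable_polyfun:
  assumes "\<And>x. f x = poly q x"
  shows "integrable \<rho> f"
proof -
  have "integrable \<rho> (\<lambda>x. \<Sum>i\<le>degree q. coeff q i * x^i)"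
    by (intro Bochner_Integration.integrable_sum integrable_mult_right integrable_power)
  then show ?thesis unfolding assms[abs_def] poly_altdef .
qed

lemma integrable_p: "integrable \<rho> (p n)"
  by (rule integrable_polyfun[of _ "opol n"]) (simp add: p_eq_poly)

lemma integrable_p_mult: "integrable \<rho> (\<lambda>x. p n x * p m x)"
  by (rule integrable_polyfun[of _ "opol n * opol m"]) (simp add: p_eq_poly)

lemma integrable_x_p_mult: "integrable \<rho> (\<lambda>x. x * p n x * p m x)"
  by (rule integrable_polyfun[of _ "[:0,1:] * opol n * opol m"]) (simp add: p_eq_poly)

text \<open>Integrating the expansion of \<open>x^k\<close> and inserting the moments gives a
  triangular system for these integrals, solvable because \<open>mvec k k\<close> is
  positive.\<close>

lemma integral_p: "(\<integral>x. p n x \<partial>\<rho>) = (if n = 0 then 1 else 0)"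
proof (induction n rule: less_induct)
  case (less k)
  have "mvec k 0 = (\<integral>x. (\<Sum>n\<le>k. mvec k n * p n x) \<partial>\<rho>)"
    unfolding power_expansion[symmetric] moment ..
  also have "... = (\<Sum>n\<le>k. mvec k n * (\<integral>x. p n x \<partial>\<rho>))"
    by (simp add: integrable_p)
  also have "... = (\<Sum>n<k. mvec k n * (if n = 0 then 1 else 0)) + mvec k k * (\<integral>x. p k x \<partial>\<rho>)"
    using less by (simp add: lessThan_Suc_atMost[symmetric])
  also have "(\<Sum>n<k. mvec k n * (if n = 0 then 1 else 0)) = (if k = 0 then 0 else mvec k 0)"
    by (simp add: sum.delta if_distrib cong: if_cong)
  finally show ?case using mvec_diag[of k] by (auto split: if_splits)
qed

text \<open>Induction on \<open>m\<close>: the recursion for \<open>p (Suc (Suc m))\<close> brings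
  in a factor \<open>x\<close>, which the recursion for \<open>p n\<close> then absorbs.\<close>

lemma orthonormal: "(\<integral>x. p n x * p m x \<partial>\<rho>) = (if n = m then 1 else 0)"
proof (induction m arbitrary: n rule: induct_nat_012)
  case 0
  then show ?case using integral_p[of n] by simp
next
  case 1
  have x: "x * p n x = A n * p (Suc n) x + (case n of 0 \<Rightarrow> 0 | Suc k \<Rightarrow> A k * p k x)" for x
    using p_one[of x] p_rec[of "n - 1" x] by (cases n) auto
  have "A 0 * (\<integral>x. p n x * p (Suc 0) x \<partial>\<rho>) = (\<integral>x. x * p n x \<partial>\<rho>)"
    unfolding integral_mult_right_zero[symmetric] mult.left_commute[of _ "p n _"] p_one by (simp only: mult.commute)
  also have "... = (\<integral>x. A n * p (Suc n) x + (case n of 0 \<Rightarrow> 0 | Suc k \<Rightarrow> A k * p k x) \<partial>\<rho>)" unfolding x ..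
  also have "... = (if n = 1 then A 0 else 0)"
  proof (cases n)
    case 0 then show ?thesis using integral_p[of 1] by simp
  next
    case (Suc k) then show ?thesis
      by (simp add: integrable_p integral_p)
  qed
  finally show ?case using A_nz[of 0] by (auto split: if_splits)
next
  case (ge2 m)
  have x: "x * p n x = A n * p (Suc n) x + (case n of 0 \<Rightarrow> 0 | Suc k \<Rightarrow> A k * p k x)" for x
    using p_one[of x] p_rec[of "n - 1" x] by (cases n) auto
  have "A (Suc m) * (\<integral>x. p n x * p (Suc (Suc m)) x \<partial>\<rho>) = (\<integral>x. p n x * (A (Suc m) * p (Suc (Suc m)) x) \<partial>\<rho>)"
    by (simp only: mult.left_commute integral_mult_right_zero)
  also have "... = (\<integral>x. x * p n x * p (Suc m) x - A m * (p n x * p m x) \<partial>\<rho>)"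
    unfolding p_rec by (simp only: algebra_simps)
  also have "... = (\<integral>x. x * p n x * p (Suc m) x \<partial>\<rho>) - A m * (\<integral>x. p n x * p m x \<partial>\<rho>)"
    using integrable_x_p_mult[of n "Suc m"] integrable_p_mult[of n m] by simp
  also have "(\<integral>x. x * p n x * p (Suc m) x \<partial>\<rho>)
     = (\<integral>x. A n * (p (Suc n) x * p (Suc m) x) + (case n of 0 \<Rightarrow> 0 | Suc k \<Rightarrow> A k * (p k x * p (Suc m) x)) \<partial>\<rho>)"
    unfolding x by (intro Bochner_Integration.integral_cong) (auto simp: algebra_simps split: nat.split)
  also have "... = (if n = m then A n else 0) + (if n = Suc (Suc m) then A (Suc m) else 0)"
  proof (cases n)
    case 0 then show ?thesis using ge2(2)[of "Suc 0"] by simp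
  next
    case (Suc k) then show ?thesis
      using integrable_p_mult[of "Suc n" "Suc m"] integrable_p_mult[of k "Suc m"] ge2(2)
      by auto
  qed
  finally show ?case using A_nz[of "Suc m"] ge2(1)[of n] by (auto split: if_splits)
qed

lemma integrable_comb_sq: "integrable \<rho> (\<lambda>x. (\<Sum>j\<le>n. c j * p j x)^2)"
  and integral_comb_sq: "(\<integral>x. (\<Sum>j\<le>n. c j * p j x)^2 \<partial>\<rho>) = (\<Sum>j\<le>n. (c j)^2)"
proof -
  have e: "(\<Sum>j\<le>n. c j * p j x)^2 = (\<Sum>i\<le>n. \<Sum>j\<le>n. c i * c j * (p i x * p j x))" for x
    unfolding power2_eq_square sum_product by (intro sum.cong) auto
  show "integrable \<rho> (\<lambda>x. (\<Sum>j\<le>n. c j * p j x)^2)"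
    unfolding e by (intro Bochner_Integration.integrable_sum integrable_mult_right integrable_p_mult)
  have "(\<integral>x. (\<Sum>j\<le>n. c j * p j x)^2 \<partial>\<rho>) = (\<Sum>i\<le>n. \<Sum>j\<le>n. c i * c j * (if i = j then 1 else 0))"
    unfolding e by (simp add: integrable_p_mult orthonormal)
  also have "... = (\<Sum>i\<le>n. (c i)^2)"
    by (intro sum.cong) (auto simp: power2_eq_square if_distrib sum.delta cong: if_cong)
  finally show "(\<integral>x. (\<Sum>j\<le>n. c j * p j x)^2 \<partial>\<rho>) = (\<Sum>j\<le>n. (c j)^2)" .
qed

lemma integrable_K_sq: "integrable \<rho> (\<lambda>x. (K n x y)^2)"
  and integral_K_sq: "(\<integral>x. (K n x y)^2 \<partial>\<rho>) = K n y y"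
  using integrable_comb_sq[of "\<lambda>j. p j y" n] integral_comb_sq[of "\<lambda>j. p j y" n]
  by (simp_all add: CD_kernel_def mult.commute power2_eq_square)

text \<open>By Christoffel-Darboux \<open>(x - y) * K n x y\<close> is a combination of
  \<open>p n\<close> and \<open>p (Suc n)\<close> alone, so Parseval evaluates its square. Divided
  by \<open>K n y y\<close>, this is the second moment about \<open>y\<close> of the measure in the
  Nevai condition.\<close>

lemma integrable_K_var: "integrable \<rho> (\<lambda>x. (x - y)^2 * (K n x y)^2)"
  and integral_K_var: "(\<integral>x. (x - y)^2 * (K n x y)^2 \<partial>\<rho>) = (A n)^2 * ((p n y)^2 + (p (Suc n) y)^2)"
proof -
  define c where "c = (\<lambda>j. if j = n then - A n * p (Suc n) y else if j = Suc n then A n * p n y else 0)"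
  have s: "(\<Sum>j\<le>Suc n. c j * f j) = - A n * p (Suc n) y * f n + A n * p n y * f (Suc n)" for f
  proof -
    have "(\<Sum>j<n. c j * f j) = 0" by (intro sum.neutral) (auto simp: c_def)
    then show ?thesis by (simp add: lessThan_Suc_atMost[symmetric] c_def)
  qed
  have e: "(x - y)^2 * (K n x y)^2 = (\<Sum>j\<le>Suc n. c j * p j x)^2" for x
    unfolding s power_mult_distrib[symmetric] christoffel_darboux
    by (simp add: algebra_simps power2_eq_square)
  show "integrable \<rho> (\<lambda>x. (x - y)^2 * (K n x y)^2)" unfolding e by (rule integrable_comb_sq)
  have "(\<integral>x. (x - y)^2 * (K n x y)^2 \<partial>\<rho>) = (\<Sum>j\<le>Suc n. c j * c j)"
    unfolding e integral_comb_sq by (simp add: power2_eq_square)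
  then show "(\<integral>x. (x - y)^2 * (K n x y)^2 \<partial>\<rho>) = (A n)^2 * ((p n y)^2 + (p (Suc n) y)^2)"
    unfolding s by (simp add: c_def algebra_simps power2_eq_square)
qed

text \<open>The moment of order \<open>2*k\<close> is at most \<open>4^k\<close>, while the mass
  outside (-3, 3) contributes at least \<open>9^k\<close> times itself.\<close>

lemma AE_abs_less_3: "AE x in \<rho>. \<bar>x\<bar> < 3"
proof -
  let ?S = "{x::real. 3 \<le> \<bar>x\<bar>}"
  have S: "?S \<in> sets \<rho>" by simp
  have *: "measure \<rho> ?S \<le> (4/9)^k" for k
  proof -
    have "measure \<rho> ?S * 9^k = (\<integral>x. indicator ?S x * 9^k \<partial>\<rho>)" using S by simp
    also have "... \<le> (\<integral>x. x^(2*k) \<partial>\<rho>)"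
    proof (intro integral_mono)
      show "integrable \<rho> (\<lambda>x. indicator ?S x * (9::real)^k)" using S by (intro integrable_mult_left integrable_real_indicator) (auto simp: less_top[symmetric])
      show "integrable \<rho> (\<lambda>x. x^(2*k))" by (rule integrable_power)
      fix x :: real
      have "9^k \<le> x^(2*k)" if "3 \<le> \<bar>x\<bar>"
        using power_mono[OF power_mono[OF that, of 2], of k] by (simp add: power_mult)
      then show "indicator ?S x * 9^k \<le> x^(2*k)"
        by (auto simp: indicator_def)
    qed
    also have "... \<le> 4^k" unfolding moment using mvec_bound[of "2*k" 0] by (simp add: power_mult)
    finally show ?thesis by (simp add: power_divide field_simps)
  qed
  have "(\<lambda>k. (4/9::real)^k) \<longlonglongrightarrow> 0" by (rule LIMSEQ_power_zero) auto
  then have "measure \<rho> ?S \<le> 0" using * by (intro LIMSEQ_le_const) auto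
  then have "emeasure \<rho> ?S = 0" using S by (simp add: emeasure_eq_measure measure_le_0_iff)
  then have "AE x in \<rho>. x \<notin> ?S" by (intro AE_not_in) (auto simp: null_sets_def)
  then show ?thesis by eventually_elim auto
qed

text \<open>As \<open>p n\<close> has norm 1, Chebyshev's inequality bounds the exceptional sets by
  \<open>1 / (n + 1)^2\<close>, and Borel-Cantelli applies.\<close>

lemma AE_p_bound: "AE x in \<rho>. eventually (\<lambda>n. (p n x)^2 < (real n + 1)^2) sequentially"
proof -
  let ?S = "\<lambda>n. {x. (real n + 1)^2 \<le> (p n x)^2}"
  have S[measurable]: "?S n \<in> sets \<rho>" for n by simp
  have i: "integrable \<rho> (\<lambda>x. (p n x)^2)" for n using integrable_p_mult[of n n] by (simp add: power2_eq_square)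
  have *: "measure \<rho> (?S n) \<le> 1 / (real n + 1)^2" for n
  proof -
    have "measure \<rho> (?S n) * (real n + 1)^2 = (\<integral>x. indicator (?S n) x * (real n + 1)^2 \<partial>\<rho>)" using S by simp
    also have "... \<le> (\<integral>x. (p n x)^2 \<partial>\<rho>)"
    proof (intro integral_mono i)
      show "integrable \<rho> (\<lambda>x. indicator (?S n) x * (real n + 1)^2)" using S by (intro integrable_mult_left integrable_real_indicator) (auto simp: less_top[symmetric])
    qed (auto simp: indicator_def)
    also have "... = 1" using orthonormal[of n n] by (simp add: power2_eq_square)
    finally show ?thesis by (simp add: field_simps)
  qed
  have "summable (\<lambda>n. 1 / (real n + 1)^2)"
    using inverse_power_summable[of 2, where 'a=real] summable_Suc_iff[of "\<lambda>n. 1 / (real n)^2"]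
    by (simp add: field_simps)
  then have "summable (\<lambda>n. measure \<rho> (?S n))"
    by (rule summable_comparison_test_ev[rotated]) (use * in auto)
  then have "AE x in \<rho>. eventually (\<lambda>n. x \<in> space \<rho> - ?S n) sequentially"
    by (intro borel_cantelli_AE1) (auto simp: less_top[symmetric])
  then show ?thesis by eventually_elim (auto elim!: eventually_mono)
qed

end


section \<open>Amplitudes of solutions at elliptic energies\<close>

context jacobi_seq
begin

text \<open>Only the interior rows are imposed, so both \<open>p\<close> and the second solution
  \<open>qsol\<close> qualify.\<close>

definition sol :: "real \<Rightarrow> (nat \<Rightarrow> real) \<Rightarrow> bool" where
  "sol x u \<longleftrightarrow> (\<forall>n. A (Suc n) * u (Suc (Suc n)) = x * u (Suc n) - A n * u n)"

definition amp :: "(nat \<Rightarrow> real) \<Rightarrow> nat \<Rightarrow> real" where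
  "amp u n = (u (Suc n))^2 + (u n)^2"

definition delta :: "nat \<Rightarrow> real" where
  "delta n = (A (Suc n))^2 - (A n)^2"

text \<open>Of second order in the variation of the weights; it will bound the one-step change of
  the logarithm of the adiabatic invariant.\<close>

definition defect :: "nat \<Rightarrow> real" where
  "defect n = (delta n)^2 + \<bar>delta (Suc n) - delta n\<bar>"

lemma sol_p: "sol x (\<lambda>n. p n x)"
  unfolding sol_def using p_rec by blast

lemma solD: "sol x u \<Longrightarrow> A (Suc n) * u (Suc (Suc n)) = x * u (Suc n) - A n * u n"
  by (simp add: sol_def)

lemma amp_nonneg: "0 \<le> amp u n"
  by (simp add: amp_def)

lemma defect_nonneg: "0 \<le> defect n"
  by (simp add: defect_def)

text \<open>Dividing by \<open>c\<close> gives \<open>|z| \<le> 4 * |v| + 2 * |w|\<close>;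
  Cauchy-Schwarz turns this into 16 + 4 = 20.\<close>

lemma three_term_sq_bound:
  fixes c d v w x z :: real
  assumes "c * z = x * v - d * w" "1/2 \<le> c" "0 \<le> d" "d \<le> 1" "\<bar>x\<bar> \<le> 2"
  shows "z^2 \<le> 20 * (v^2 + w^2)"
proof -
  have "\<bar>x * v - d * w\<bar> \<le> \<bar>x * v\<bar> + \<bar>d * w\<bar>" by linarith
  also have "... \<le> 2 * \<bar>v\<bar> + \<bar>w\<bar>"
    unfolding abs_mult using assms by (intro add_mono mult_right_mono mult_left_le_one_le) auto
  finally have "\<bar>c * z\<bar> \<le> 2 * \<bar>v\<bar> + \<bar>w\<bar>" using assms(1) by simp
  moreover have "\<bar>z\<bar> / 2 \<le> \<bar>c * z\<bar>" unfolding abs_mult using assms(2) mult_right_mono[of "1/2" "\<bar>c\<bar>" "\<bar>z\<bar>"] by auto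
  ultimately have "\<bar>z\<bar> \<le> 4 * \<bar>v\<bar> + 2 * \<bar>w\<bar>" by linarith
  then have "z^2 \<le> (4 * \<bar>v\<bar> + 2 * \<bar>w\<bar>)^2" by (metis abs_ge_zero power2_abs power_mono)
  also have "... = 16 * v^2 + 16 * (\<bar>v\<bar> * \<bar>w\<bar>) + 4 * w^2" by (simp add: power2_eq_square algebra_simps)
  also have "... \<le> 20 * (v^2 + w^2)"
    using zero_le_power2[of "\<bar>v\<bar> - 2 * \<bar>w\<bar>"] by (simp add: power2_eq_square algebra_simps)
  finally show ?thesis .
qed

text \<open>The recurrence has the same shape in both directions, so one bound serves forwards and
  backwards; 21 is 20 for the new value plus 1 for the one kept.\<close>

lemma amp_Suc_le: "sol x u \<Longrightarrow> \<bar>x\<bar> \<le> 2 \<Longrightarrow> amp u (Suc n) \<le> 21 * amp u n"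
  and amp_le_Suc: "sol x u \<Longrightarrow> \<bar>x\<bar> \<le> 2 \<Longrightarrow> amp u n \<le> 21 * amp u (Suc n)"
  and sol_sq_le: "sol x u \<Longrightarrow> \<bar>x\<bar> \<le> 2 \<Longrightarrow> (u (Suc (Suc n)))^2 \<le> 20 * amp u n"
proof -
  assume s: "sol x u" and x: "\<bar>x\<bar> \<le> 2"
  have 1: "(u (Suc (Suc n)))^2 \<le> 20 * ((u (Suc n))^2 + (u n)^2)"
    by (rule three_term_sq_bound[of "A (Suc n)" _ x _ "A n"]) (use solD[OF s, of n] x A_ge A_le A_pos[of n, THEN less_imp_le] A_pos[of "Suc n", THEN less_imp_le] in auto)
  then show "(u (Suc (Suc n)))^2 \<le> 20 * amp u n" by (simp add: amp_def)
  have 2: "(u n)^2 \<le> 20 * ((u (Suc n))^2 + (u (Suc (Suc n)))^2)"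
    by (rule three_term_sq_bound[of "A n" _ x _ "A (Suc n)"]) (use solD[OF s, of n] x A_ge A_le A_pos[of n, THEN less_imp_le] A_pos[of "Suc n", THEN less_imp_le] in auto)
  show "amp u (Suc n) \<le> 21 * amp u n" using 1 zero_le_power2[of "u n"] unfolding amp_def distrib_left by linarith
  show "amp u n \<le> 21 * amp u (Suc n)" using 2 zero_le_power2[of "u (Suc (Suc n))"] unfolding amp_def distrib_left by linarith
qed

lemma amp_comparable_steps:
  assumes "sol x u" "\<bar>x\<bar> \<le> 2"
  shows "amp u (m + k) \<le> 21^k * amp u m" "amp u m \<le> 21^k * amp u (m + k)"
proof (induction k)
  case (Suc k)
  { case 1 show ?case using amp_Suc_le[OF assms, of "m + k"] Suc(1) by simp }
  { case 2
    have "21^k * amp u (m + k) \<le> 21^k * (21 * amp u (Suc (m + k)))"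
      using amp_le_Suc[OF assms, of "m + k"] by (intro mult_left_mono) auto
    also have "... = 21^Suc k * amp u (m + Suc k)" by simp
    finally show ?case using Suc(2) by linarith }
qed auto

text \<open>\<open>EE\<close> is the quadratic form conserved when the weights are constant; its
  determinant is \<open>(A n)^2 * DD x n\<close>, positive exactly at elliptic energies.
  \<open>cc\<close> is the coefficient that summation by parts attaches to the oscillating
  part.\<close>

definition "DD x n = (A n)^2 - x^2/4"
definition "EE x u n = (A n)^2 * ((u (Suc n))^2 + (u n)^2) - x * A n * u (Suc n) * u n"
definition "cc x n = delta n * (A n)^2 / (4 * DD x n)"
definition "GG x u n = EE x u n + cc x n * ((u (Suc n))^2 - (u n)^2)"

lemma DD_Suc: "DD x (Suc n) = DD x n + delta n"
  by (simp add: DD_def delta_def)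

lemma A_sq_bounds: "1/4 \<le> (A n)^2" "(A n)^2 \<le> 1"
  using power_mono[OF A_ge[of n], of 2] power_mono[OF A_le[of n], of 2] A_pos[of n] by (auto simp: power_divide)

lemma DD_bounds:
  assumes "x^2 \<le> 1 - 4 * \<kappa>"
  shows "\<kappa> \<le> DD x n" "DD x n \<le> 1"
  using A_sq_bounds[of n] assms zero_le_power2[of x] unfolding DD_def by linarith+

text \<open>Substituting the recurrence leaves only the change of the weight. The increment is of
  first order in \<open>delta n\<close>, and the correction in \<open>GG\<close> has to remove its
  oscillating part.\<close>

lemma EE_Suc:
  assumes "sol x u"
  shows "EE x u (Suc n) = EE x u n + delta n * (u (Suc n))^2"
proof -
  define y where "y = A (Suc n) * u (Suc (Suc n))"
  have y: "y = x * u (Suc n) - A n * u n" using solD[OF assms, of n] by (simp add: y_def)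
  have "EE x u (Suc n) = y^2 + (A (Suc n))^2 * (u (Suc n))^2 - x * y * u (Suc n)"
    by (simp add: EE_def y_def power2_eq_square algebra_simps)
  also have "... = EE x u n + delta n * (u (Suc n))^2"
    unfolding y by (simp add: EE_def delta_def power2_eq_square algebra_simps)
  finally show ?thesis .
qed

text \<open>The oscillating part of \<^term>\<open>(u (Suc n))^2\<close> is, up to second order, a discrete derivative;
  summation by parts moves it into the correction term of \<^const>\<open>GG\<close>, so that
  \<^term>\<open>GG x u n / sqrt (DD x n)\<close> is an adiabatic invariant.\<close>

lemma sq_average:
  assumes "sol x u"
  shows "4 * DD x n * (u (Suc n))^2 = 2 * EE x u n - delta n * (u (Suc (Suc n)))^2
     - (A n)^2 * (((u (Suc (Suc n)))^2 - (u (Suc n))^2) - ((u (Suc n))^2 - (u n)^2))"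
proof -
  define y where "y = A (Suc n) * u (Suc (Suc n))"
  have y: "y = x * u (Suc n) - A n * u n" using solD[OF assms, of n] by (simp add: y_def)
  have "delta n * (u (Suc (Suc n)))^2 + (A n)^2 * (u (Suc (Suc n)))^2 = y^2"
    by (simp add: delta_def y_def power2_eq_square algebra_simps)
  moreover have "4 * DD x n * (u (Suc n))^2 = 2 * EE x u n - y^2 + (A n)^2 * (2 * (u (Suc n))^2 - (u n)^2)"
    unfolding y by (simp add: DD_def EE_def power2_eq_square algebra_simps)
  ultimately show ?thesis by (simp add: algebra_simps)
qed

text \<open>Replacing \<open>(u (Suc n))^2\<close> by its average \<open>EE / (2 * DD)\<close>
  produces the factor \<open>1 + delta n / (2 * DD x n)\<close>, to first order the growth of
  \<open>sqrt (DD x n)\<close>. Every remaining term contains \<open>delta^2\<close>,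
  \<open>cc * delta\<close> or a difference of \<open>cc\<close>.\<close>

lemma GG_Suc:
  assumes "sol x u" "DD x n \<noteq> 0"
  shows "GG x u (Suc n) - GG x u n * (1 + delta n / (2 * DD x n)) =
    - cc x n * ((u (Suc n))^2 - (u n)^2) * delta n / (2 * DD x n)
    + (cc x (Suc n) - cc x n) * ((u (Suc (Suc n)))^2 - (u (Suc n))^2)
    - (delta n)^2 / (4 * DD x n) * (u (Suc (Suc n)))^2"
proof -
  define F F' s where "F = (u (Suc n))^2 - (u n)^2" and "F' = (u (Suc (Suc n)))^2 - (u (Suc n))^2"
    and "s = (u (Suc (Suc n)))^2"
  have "(u (Suc n))^2 = (2 * EE x u n - delta n * s - (A n)^2 * (F' - F)) / (4 * DD x n)"
    using sq_average[OF assms(1), of n] assms(2) unfolding F_def F'_def s_def by (simp add: field_simps)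
  then have "delta n * (u (Suc n))^2 = delta n * ((2 * EE x u n - delta n * s - (A n)^2 * (F' - F)) / (4 * DD x n))"
    by (rule arg_cong)
  also have "... = delta n * EE x u n / (2 * DD x n) - (delta n)^2 / (4 * DD x n) * s - cc x n * (F' - F)"
    using assms(2) by (simp add: cc_def field_simps power2_eq_square)
  finally have "EE x u (Suc n) = EE x u n + delta n * EE x u n / (2 * DD x n) - (delta n)^2 / (4 * DD x n) * s - cc x n * (F' - F)"
    using EE_Suc[OF assms(1), of n] by simp
  moreover have "GG x u (Suc n) = EE x u (Suc n) + cc x (Suc n) * F'" "GG x u n = EE x u n + cc x n * F"
    by (simp_all add: GG_def F_def F'_def)
  ultimately have "GG x u (Suc n) - GG x u n * (1 + delta n / (2 * DD x n)) =
      - cc x n * F * delta n / (2 * DD x n) + (cc x (Suc n) - cc x n) * F' - (delta n)^2 / (4 * DD x n) * s"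
    by (simp add: algebra_simps add_divide_distrib)
  then show ?thesis unfolding F_def F'_def s_def .
qed

lemma cc_bound:
  assumes "x^2 \<le> 1 - 4 * \<kappa>" "0 < \<kappa>"
  shows "\<bar>cc x n\<bar> \<le> \<bar>delta n\<bar> / (4 * \<kappa>)"
proof -
  have "\<bar>cc x n\<bar> = \<bar>delta n\<bar> * (A n)^2 / (4 * DD x n)"
    using DD_bounds[OF assms(1), of n] assms(2) by (simp add: cc_def abs_mult)
  also have "... \<le> \<bar>delta n\<bar> * 1 / (4 * \<kappa>)"
    using DD_bounds[OF assms(1), of n] assms(2) A_sq_bounds[of n] by (intro frac_le mult_left_mono) auto
  finally show ?thesis by simp
qed

lemma cc_diff_bound:
  assumes "x^2 \<le> 1 - 4 * \<kappa>" "0 < \<kappa>"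
  shows "\<bar>cc x (Suc n) - cc x n\<bar> \<le> \<bar>delta (Suc n) - delta n\<bar> / (4 * \<kappa>) + (delta n)^2 / (16 * \<kappa>^2)"
proof -
  define h where "h = (\<lambda>n. (A n)^2 / (4 * DD x n))"
  note D = DD_bounds[OF assms(1), of n] DD_bounds[OF assms(1), of "Suc n"]
  have nz: "DD x n > 0" "DD x (Suc n) > 0" using D assms(2) by auto
  have h': "0 \<le> h n" "h n \<le> 1 / (4 * \<kappa>)" for n
    using DD_bounds[OF assms(1), of n] assms(2) A_sq_bounds[of n] unfolding h_def
    by (auto intro!: frac_le divide_nonneg_pos)
  \<comment> \<open>In this form \<open>h\<close> depends on the index only through
    \<open>DD\<close>, whose increment is \<open>delta n\<close>.\<close>
  have hd: "h k = 1/4 + x^2 / (16 * DD x k)" if "DD x k > 0" for k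
    using that by (simp add: h_def DD_def field_simps)
  have "h (Suc n) - h n = - (x^2 / 16) * (delta n / (DD x n * DD x (Suc n)))"
  proof -
    have d: "delta n = DD x (Suc n) - DD x n" by (simp add: DD_Suc)
    show ?thesis unfolding hd[OF nz(1)] hd[OF nz(2)] d using nz by (simp add: divide_simps) (simp add: algebra_simps)
  qed
  then have "\<bar>h (Suc n) - h n\<bar> = x^2 / 16 * (\<bar>delta n\<bar> / (DD x n * DD x (Suc n)))"
    using nz by (simp add: abs_mult)
  also have "... \<le> 1 / 16 * (\<bar>delta n\<bar> / (\<kappa> * \<kappa>))"
    using D assms zero_le_power2[of x] by (intro mult_mono divide_right_mono frac_le) (auto intro!: mult_mono)
  finally have hh: "\<bar>h (Suc n) - h n\<bar> \<le> \<bar>delta n\<bar> / (16 * \<kappa>^2)" by (simp add: power2_eq_square)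
  have "cc x (Suc n) - cc x n = (delta (Suc n) - delta n) * h (Suc n) + delta n * (h (Suc n) - h n)"
  proof -
    have c: "cc x m = delta m * h m" for m by (simp add: cc_def h_def)
    show ?thesis unfolding c by (simp add: algebra_simps)
  qed
  then have "\<bar>cc x (Suc n) - cc x n\<bar> \<le> \<bar>delta (Suc n) - delta n\<bar> * \<bar>h (Suc n)\<bar> + \<bar>delta n\<bar> * \<bar>h (Suc n) - h n\<bar>"
    by (metis abs_mult abs_triangle_ineq)
  also have "... \<le> \<bar>delta (Suc n) - delta n\<bar> * (1 / (4 * \<kappa>)) + \<bar>delta n\<bar> * (\<bar>delta n\<bar> / (16 * \<kappa>^2))"
    using h'[of "Suc n"] hh by (intro add_mono mult_left_mono) auto
  finally show ?thesis by (simp add: power2_eq_square)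
qed

lemma GG_Suc_bound:
  assumes "sol x u" "x^2 \<le> 1 - 4 * \<kappa>" "0 < \<kappa>"
  shows "\<bar>GG x u (Suc n) - GG x u n * (1 + delta n / (2 * DD x n))\<bar>
    \<le> (2 / \<kappa>^2 + 11 / \<kappa>) * defect n * amp u n"
proof -
  note D = DD_bounds[OF assms(2), of n]
  have x: "\<bar>x\<bar> \<le> 2" using assms(2,3) abs_le_square_iff[of x 2] by simp
  have D0: "DD x n > 0" using D assms(3) by simp
  define F F' s where "F = (u (Suc n))^2 - (u n)^2" and "F' = (u (Suc (Suc n)))^2 - (u (Suc n))^2"
    and "s = (u (Suc (Suc n)))^2"
  have F: "\<bar>F\<bar> \<le> amp u n" unfolding F_def amp_def
    using zero_le_power2[of "u n"] zero_le_power2[of "u (Suc n)"] by linarith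
  have F': "\<bar>F'\<bar> \<le> 21 * amp u n" unfolding F'_def using amp_Suc_le[OF assms(1) x, of n] unfolding amp_def
    using zero_le_power2[of "u (Suc (Suc n))"] zero_le_power2[of "u (Suc n)"] by linarith
  have s: "0 \<le> s" "s \<le> 21 * amp u n" using sol_sq_le[OF assms(1) x, of n] amp_nonneg[of u n] by (auto simp: s_def)
  have 1: "\<bar>cc x n * F * delta n / (2 * DD x n)\<bar> \<le> (\<bar>delta n\<bar> / (4 * \<kappa>)) * amp u n * \<bar>delta n\<bar> / (2 * \<kappa>)"
    unfolding abs_mult abs_divide using D0 D assms(3) F cc_bound[OF assms(2,3), of n]
    by (intro frac_le mult_mono mult_nonneg_nonneg) (auto simp: amp_nonneg)
  have 2: "\<bar>(cc x (Suc n) - cc x n) * F'\<bar>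
     \<le> (\<bar>delta (Suc n) - delta n\<bar> / (4 * \<kappa>) + (delta n)^2 / (16 * \<kappa>^2)) * (21 * amp u n)"
    unfolding abs_mult using F' cc_diff_bound[OF assms(2,3), of n] assms(3) by (intro mult_mono) auto
  have 3: "\<bar>(delta n)^2 / (4 * DD x n) * s\<bar> \<le> (delta n)^2 / (4 * \<kappa>) * (21 * amp u n)"
    unfolding abs_mult abs_divide using D0 D assms(3) s by (intro mult_mono frac_le) auto
  have "\<bar>GG x u (Suc n) - GG x u n * (1 + delta n / (2 * DD x n))\<bar> \<le>
     \<bar>cc x n * F * delta n / (2 * DD x n)\<bar> + \<bar>(cc x (Suc n) - cc x n) * F'\<bar> + \<bar>(delta n)^2 / (4 * DD x n) * s\<bar>"
  proof -
    have "GG x u (Suc n) - GG x u n * (1 + delta n / (2 * DD x n)) =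
      - cc x n * F * delta n / (2 * DD x n) + (cc x (Suc n) - cc x n) * F' - (delta n)^2 / (4 * DD x n) * s"
      unfolding F_def F'_def s_def by (rule GG_Suc[OF assms(1)]) (use D0 in simp)
    then show ?thesis by linarith
  qed
  also have "... \<le> (\<bar>delta n\<bar> / (4 * \<kappa>)) * amp u n * \<bar>delta n\<bar> / (2 * \<kappa>)
     + (\<bar>delta (Suc n) - delta n\<bar> / (4 * \<kappa>) + (delta n)^2 / (16 * \<kappa>^2)) * (21 * amp u n)
     + (delta n)^2 / (4 * \<kappa>) * (21 * amp u n)"
    using 1 2 3 by linarith
  \<comment> \<open>The terms over \<open>\<kappa>^2\<close> add up to 1/8 + 21/16 = 23/16; the two
    terms over \<open>4 * \<kappa>\<close> both carry 21 and together make up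
    \<open>defect n\<close>.\<close>
  also have "... = (((delta n)^2 * (23/16)) / \<kappa>^2 + (defect n * (21/4)) / \<kappa>) * amp u n"
    using assms(3) by (simp add: defect_def field_simps power2_eq_square)
  also have "... \<le> ((defect n * 2) / \<kappa>^2 + (defect n * 11) / \<kappa>) * amp u n"
    using assms(3) defect_nonneg[of n] amp_nonneg[of u n] zero_le_power2[of "delta n"]
    by (intro mult_right_mono add_mono divide_right_mono) (auto simp: defect_def)
  finally show ?thesis by (simp add: algebra_simps)
qed

text \<open>The smaller eigenvalue of \<open>EE\<close> is \<open>A n * (A n - |x| / 2)\<close>, at
  least \<open>\<kappa> / 3\<close>. The bound on \<open>delta n\<close> keeps the correction below
  \<open>\<kappa> / 8\<close> of the amplitude, so a share \<open>\<kappa> / 6\<close>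
  survives.\<close>

lemma GG_amp:
  assumes "x^2 \<le> 1 - 4 * \<kappa>" "0 < \<kappa>" "\<bar>delta n\<bar> \<le> \<kappa>^2 / 2"
  shows "\<kappa> / 6 * amp u n \<le> GG x u n" "GG x u n \<le> 3 * amp u n"
proof -
  define v w where "v = u (Suc n)" and "w = u n"
  have am: "amp u n = v^2 + w^2" by (simp add: amp_def v_def w_def)
  have k: "\<kappa> \<le> 1/4" using assms(1) zero_le_power2[of x] by linarith
  have x1: "\<bar>x\<bar> \<le> 1" using assms(1,2) abs_le_square_iff[of x 1] by simp
  have vw: "2 * \<bar>v * w\<bar> \<le> v^2 + w^2" using sum_squares_bound[of "\<bar>v\<bar>" "\<bar>w\<bar>"] by (simp add: abs_mult)
  have b: "\<bar>x * A n * v * w\<bar> \<le> \<bar>x\<bar> * A n / 2 * (v^2 + w^2)"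
    using mult_left_mono[OF vw, of "\<bar>x\<bar> * A n / 2"] A_pos[of n] by (simp add: abs_mult algebra_simps)
  have E: "EE x u n = (A n)^2 * (v^2 + w^2) - x * A n * v * w" by (simp add: EE_def v_def w_def)
  have Ax: "A n + \<bar>x\<bar> / 2 \<le> 3/2" "0 < A n + \<bar>x\<bar>/2" using A_le[of n] A_pos[of n] x1 by auto
  \<comment> \<open>\<open>DD\<close> factors as a difference of squares; dividing by the larger
    factor, at most 3/2, keeps the smaller one away from 0.\<close>
  have "\<kappa> \<le> (A n - \<bar>x\<bar> / 2) * (A n + \<bar>x\<bar> / 2)"
    using DD_bounds(1)[OF assms(1), of n] by (simp add: DD_def algebra_simps power2_eq_square)
  then have pos: "A n - \<bar>x\<bar>/2 > 0" using assms(2) Ax(2) by (smt (verit) zero_less_mult_iff)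
  have "(A n - \<bar>x\<bar> / 2) * (A n + \<bar>x\<bar> / 2) \<le> (A n - \<bar>x\<bar> / 2) * (3/2)"
    using Ax pos by (intro mult_left_mono) auto
  then have q: "2/3 * \<kappa> \<le> A n - \<bar>x\<bar> / 2" using \<open>\<kappa> \<le> (A n - \<bar>x\<bar> / 2) * (A n + \<bar>x\<bar> / 2)\<close> unfolding left_diff_distrib by linarith
  have "\<kappa> / 3 \<le> A n * (A n - \<bar>x\<bar> / 2)"
    using mult_mono[OF A_ge[of n] q] assms(2) A_pos[of n] by simp
  then have "\<kappa> / 3 * (v^2 + w^2) \<le> A n * (A n - \<bar>x\<bar> / 2) * (v^2 + w^2)" by (intro mult_right_mono) auto
  also have "... = (A n)^2 * (v^2 + w^2) - \<bar>x\<bar> * A n / 2 * (v^2 + w^2)" by (simp add: power2_eq_square algebra_simps)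
  also have "... \<le> EE x u n" unfolding E using b by linarith
  finally have E1: "\<kappa> / 3 * amp u n \<le> EE x u n" unfolding am .
  have "\<bar>x\<bar> * A n / 2 * (v^2 + w^2) \<le> 1 * 1 / 2 * (v^2 + w^2)"
    using x1 A_le[of n] A_pos[of n] by (intro mult_right_mono divide_right_mono mult_mono) auto
  moreover have "(A n)^2 * (v^2 + w^2) \<le> 1 * (v^2 + w^2)" using A_sq_bounds[of n] by (intro mult_right_mono) auto
  ultimately have E2: "EE x u n \<le> 2 * amp u n" unfolding E am using b zero_le_power2[of v] zero_le_power2[of w] by linarith
  have F: "\<bar>v^2 - w^2\<bar> \<le> amp u n" unfolding am using zero_le_power2[of v] zero_le_power2[of w] by linarith
  have "\<bar>delta n\<bar> / (4 * \<kappa>) \<le> (\<kappa>^2 / 2) / (4 * \<kappa>)" using assms by (intro divide_right_mono) auto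
  also have "... = \<kappa> / 8" using assms(2) by (simp add: power2_eq_square field_simps)
  finally have "\<bar>cc x n\<bar> \<le> \<kappa> / 8" using cc_bound[OF assms(1,2), of n] by simp
  then have "\<bar>cc x n * (v^2 - w^2)\<bar> \<le> \<kappa> / 8 * amp u n" unfolding abs_mult
    using F assms(2) by (intro mult_mono) auto
  moreover have "\<kappa> / 8 * amp u n \<le> \<kappa> / 6 * amp u n" using assms(2) amp_nonneg[of u n] by (intro mult_right_mono) auto
  moreover have "\<kappa> / 6 * amp u n \<le> 1 * amp u n" using k amp_nonneg[of u n] by (intro mult_right_mono) auto
  moreover have "\<kappa> / 3 * amp u n = \<kappa> / 6 * amp u n + \<kappa> / 6 * amp u n" by simp
  ultimately show "\<kappa> / 6 * amp u n \<le> GG x u n" "GG x u n \<le> 3 * amp u n"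
    using E1 E2 unfolding GG_def v_def[symmetric] w_def[symmetric] by linarith+
qed

text \<open>The first-order terms in \<open>t\<close> cancel between the two logarithms; hence a
  bound linear in \<open>r\<close> but quadratic in \<open>t\<close>.\<close>

lemma ln_half_diff_bound:
  fixes t r :: real
  assumes "\<bar>t\<bar> \<le> 1/4" "\<bar>r\<bar> \<le> 1/4"
  shows "\<bar>ln (1 + t + r) - ln (1 + 2 * t) / 2\<bar> \<le> 2 * \<bar>r\<bar> + 8 * t^2"
proof -
  have 1: "\<bar>ln (1 + (t + r)) - (t + r)\<bar> \<le> 2 * (t + r)^2"
    using assms by (intro abs_ln_one_plus_x_minus_x_bound) linarith
  have 2: "\<bar>ln (1 + 2 * t) - 2 * t\<bar> \<le> 2 * (2 * t)^2"
    using assms by (intro abs_ln_one_plus_x_minus_x_bound) linarith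
  have 3: "(t + r)^2 \<le> 2 * t^2 + 2 * r^2" using sum_squares_bound[of t r] by (simp add: power2_eq_square algebra_simps)
  have 4: "r^2 \<le> \<bar>r\<bar> / 4" using mult_right_mono[OF assms(2), of "\<bar>r\<bar>"] by (simp add: power2_eq_square abs_mult[symmetric])
  show ?thesis using 1 2 3 4 by (simp add: add.assoc power_mult_distrib)
qed

text \<open>\<open>\<Phi>\<close> is the logarithm of \<open>GG / sqrt DD\<close>. Its increments
  are bounded by \<open>defect\<close>, so it varies boundedly over the tail, in both directions.
  The constants depend on \<open>\<kappa>\<close> and the weights only, whence uniformity in
  \<open>x\<close> and \<open>u\<close>.\<close>

lemma amp_comparable_tail:
  assumes sm: "summable defect" and k: "0 < \<kappa>" "\<kappa> \<le> 1/4"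
  shows "\<exists>n0 C. 0 < C \<and> (\<forall>x u m n. x^2 \<le> 1 - 4 * \<kappa> \<longrightarrow> sol x u \<longrightarrow> n0 \<le> m \<longrightarrow> n0 \<le> n \<longrightarrow>
     amp u n \<le> C * amp u m)"
proof -
  define C2 where "C2 = 6 / \<kappa> * (2 / \<kappa>^2 + 11 / \<kappa>)"
  have C2: "C2 > 0" unfolding C2_def by (intro mult_pos_pos add_pos_pos divide_pos_pos) (use k in auto)
  \<comment> \<open>The first entry yields \<open>|delta| \<le> \<kappa>^2 / 2\<close>, as
    \<open>GG_amp\<close> requires; the second keeps the relative error \<open>r\<close> below
    1/4.\<close>
  define \<eta> where "\<eta> = min ((\<kappa>^2 / 2)^2) (1 / (4 * C2))"
  have "\<eta> > 0" using C2 k by (auto simp: \<eta>_def)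
  with sm have "eventually (\<lambda>n. defect n < \<eta>) sequentially"
    using summable_LIMSEQ_zero order_tendstoD(2) by blast
  then obtain n0 where n0: "\<And>n. n0 \<le> n \<Longrightarrow> defect n < \<eta>" by (auto simp: eventually_sequentially)
  define C3 where "C3 = 2 * C2 + 2 / \<kappa>^2"
  have C3: "C3 > 0" unfolding C3_def using C2 k by (auto intro!: add_pos_pos)
  define S where "S = suminf defect"
  \<comment> \<open>18 = 6 * 3 comes from the two sides of \<open>GG_amp\<close>, the exponential
    from telescoping, \<open>sqrt \<kappa>\<close> from
    \<open>\<kappa> \<le> DD \<le> 1\<close>.\<close>
  define C where "C = 18 / \<kappa> * (exp (C3 * S) / sqrt \<kappa>)"
  have Cp: "C > 0" using k by (simp add: C_def)
  have "amp u n \<le> C * amp u m"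
    if x: "x^2 \<le> 1 - 4 * \<kappa>" and so: "sol x u" and m: "n0 \<le> m" and n: "n0 \<le> n" for x u m n
  \<comment> \<open>A vanishing amplitude belongs to the zero solution, for which the logarithms
    below make no sense.\<close>
  proof (cases "amp u m = 0")
    case True
    have x2: "\<bar>x\<bar> \<le> 2" using x k abs_le_square_iff[of x 2] by simp
    have "amp u n \<le> 0"
      using True amp_comparable_steps(1)[OF so x2, of m "n - m"] amp_comparable_steps(2)[OF so x2, of n "m - n"]
      by (cases "m \<le> n") auto
    then show ?thesis using True by simp
  next
    case False
    have x2: "\<bar>x\<bar> \<le> 2" using x k abs_le_square_iff[of x 2] by simp
    have pos: "amp u i > 0" for i
    proof (rule ccontr)
      assume "\<not> amp u i > 0"
      then have "amp u i = 0" using amp_nonneg[of u i] by simp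
      then have "amp u m \<le> 0"
        using amp_comparable_steps(1)[OF so x2, of i "m - i"] amp_comparable_steps(2)[OF so x2, of m "i - m"]
        by (cases "i \<le> m") auto
      then show False using False amp_nonneg[of u m] by simp
    qed
    have dl: "\<bar>delta i\<bar> \<le> \<kappa>^2 / 2" if "n0 \<le> i" for i
    proof -
      have "(delta i)^2 \<le> (\<kappa>^2 / 2)^2" using n0[OF that] unfolding defect_def \<eta>_def by linarith
      then have "\<bar>delta i\<bar> \<le> \<bar>\<kappa>^2 / 2\<bar>" by (simp only: abs_le_square_iff)
      then show ?thesis by simp
    qed
    have G: "\<kappa> / 6 * amp u i \<le> GG x u i" "GG x u i \<le> 3 * amp u i" "0 < GG x u i" if "n0 \<le> i" for i
    proof -
      show "\<kappa> / 6 * amp u i \<le> GG x u i" "GG x u i \<le> 3 * amp u i" by (rule GG_amp[OF x k(1) dl[OF that]])+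
      then show "0 < GG x u i" using pos[of i] k by (smt (verit) mult_pos_pos divide_pos_pos)
    qed
    note D = DD_bounds[OF x]
    have D0: "DD x i > 0" for i using D[of i] k by simp
    define \<Phi> where "\<Phi> = (\<lambda>i. ln (GG x u i) - ln (DD x i) / 2)"
    have step: "\<bar>\<Phi> (Suc i) - \<Phi> i\<bar> \<le> C3 * defect i" if i: "n0 \<le> i" for i
    proof -
      define t where "t = delta i / (2 * DD x i)"
      define r where "r = GG x u (Suc i) / GG x u i - (1 + t)"
      have Gi: "GG x u i > 0" "GG x u (Suc i) > 0" using G(3) i by auto
      have "\<bar>r\<bar> * GG x u i = \<bar>GG x u (Suc i) - GG x u i * (1 + t)\<bar>"
        using Gi by (simp add: r_def abs_mult_pos[symmetric] field_simps)
      also have "... \<le> (2 / \<kappa>^2 + 11 / \<kappa>) * defect i * amp u i"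
        unfolding t_def by (rule GG_Suc_bound[OF so x k(1)])
      also have "... \<le> (2 / \<kappa>^2 + 11 / \<kappa>) * defect i * (6 / \<kappa> * GG x u i)"
        using G(1)[OF i] k defect_nonneg[of i] by (intro mult_left_mono) (auto simp: field_simps)
      also have "... = (C2 * defect i) * GG x u i" by (simp add: C2_def)
      finally have r: "\<bar>r\<bar> \<le> C2 * defect i" using Gi by simp
      have "C2 * defect i \<le> C2 * (1 / (4 * C2))" using n0[OF i] C2 unfolding \<eta>_def by (intro mult_left_mono) auto
      then have r4: "\<bar>r\<bar> \<le> 1/4" using r C2 by simp
      have "\<bar>t\<bar> = \<bar>delta i\<bar> / (2 * DD x i)" using D0[of i] by (simp add: t_def)
      also have "... \<le> \<bar>delta i\<bar> / (2 * \<kappa>)" using D[of i] k by (intro divide_left_mono) auto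
      finally have t: "\<bar>t\<bar> \<le> \<bar>delta i\<bar> / (2 * \<kappa>)" .
      also have "... \<le> (\<kappa>^2 / 2) / (2 * \<kappa>)" using dl[OF i] k by (intro divide_right_mono) auto
      also have "... = \<kappa> / 4" using k by (simp add: power2_eq_square)
      finally have t4: "\<bar>t\<bar> \<le> 1/4" using k by simp
      have "t^2 = \<bar>t\<bar>^2" by simp
      also have "... \<le> (\<bar>delta i\<bar> / (2 * \<kappa>))^2" using t by (intro power_mono) auto
      also have "... = (delta i)^2 / (4 * \<kappa>^2)" by (simp add: power_divide power_mult_distrib)
      also have "... \<le> defect i / (4 * \<kappa>^2)" unfolding defect_def by (intro divide_right_mono) auto
      finally have tt: "8 * t^2 \<le> 2 / \<kappa>^2 * defect i" by simp
      have "GG x u (Suc i) = GG x u i * (1 + t + r)" using Gi by (simp add: r_def field_simps)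
      then have lg: "ln (GG x u (Suc i)) = ln (GG x u i) + ln (1 + t + r)"
        using Gi t4 r4 by (simp add: ln_mult)
      have "DD x (Suc i) = DD x i * (1 + 2 * t)" using D0[of i] by (simp add: DD_Suc t_def field_simps)
      then have ld: "ln (DD x (Suc i)) = ln (DD x i) + ln (1 + 2 * t)"
        using D0[of i] t4 by (simp add: ln_mult)
      have "\<bar>\<Phi> (Suc i) - \<Phi> i\<bar> = \<bar>ln (1 + t + r) - ln (1 + 2 * t) / 2\<bar>"
        unfolding \<Phi>_def lg ld by (simp add: add_divide_distrib)
      also have "... \<le> 2 * \<bar>r\<bar> + 8 * t^2" by (rule ln_half_diff_bound[OF t4 r4])
      also have "... \<le> 2 * (C2 * defect i) + 2 / \<kappa>^2 * defect i" using r tt by linarith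
      finally show ?thesis by (simp add: C3_def algebra_simps)
    qed
    have tele: "\<bar>\<Phi> (i + l) - \<Phi> i\<bar> \<le> C3 * (\<Sum>q=i..<i+l. defect q)" if "n0 \<le> i" for i l
    proof (induction l)
      case (Suc l)
      then show ?case using step[of "i + l"] that by (simp add: algebra_simps)
    qed simp
    have part: "(\<Sum>q=i..<i+l. defect q) \<le> S" for i l
      unfolding S_def using sm by (intro sum_le_suminf) (auto simp: defect_nonneg)
    have tele': "\<bar>\<Phi> (i + l) - \<Phi> i\<bar> \<le> C3 * S" if "n0 \<le> i" for i l
      using C3 by (intro order_trans[OF tele[OF that] mult_left_mono[OF part]]) simp
    have "\<bar>\<Phi> n - \<Phi> m\<bar> \<le> C3 * S"
    proof (cases "m \<le> n")
      case True
      then show ?thesis using tele'[OF m, of "n - m"] by simp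
    next
      case False
      then show ?thesis using tele'[OF n, of "m - n"]
        by (simp add: abs_minus_commute)
    qed
    then have "ln (GG x u n) \<le> C3 * S + ln (GG x u m) + (ln (DD x n) / 2 - ln (DD x m) / 2)"
      unfolding \<Phi>_def by linarith
    moreover have "ln (DD x n) \<le> 0" using D(2)[of n] D0[of n] by simp
    moreover have "ln \<kappa> \<le> ln (DD x m)" using D(1)[of m] k by simp
    ultimately have "ln (GG x u n) \<le> C3 * S + ln (GG x u m) - ln \<kappa> / 2" by simp
    then have "exp (ln (GG x u n)) \<le> exp (C3 * S + ln (GG x u m) - ln \<kappa> / 2)" by simp
    also have "... = exp (C3 * S) * GG x u m / exp (ln \<kappa> / 2)"
      using G(3)[OF m] by (simp add: exp_add exp_diff)
    also have "exp (ln \<kappa> / 2) = sqrt \<kappa>" using k by (simp add: ln_sqrt[symmetric])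
    finally have "GG x u n \<le> exp (C3 * S) / sqrt \<kappa> * GG x u m" using G(3)[OF n] by simp
    also have "... \<le> exp (C3 * S) / sqrt \<kappa> * (3 * amp u m)" using G(2)[OF m] k by (intro mult_left_mono) auto
    finally have "\<kappa> / 6 * amp u n \<le> exp (C3 * S) / sqrt \<kappa> * (3 * amp u m)" using G(1)[OF n] by linarith
    then have "6 / \<kappa> * (\<kappa> / 6 * amp u n) \<le> 6 / \<kappa> * (exp (C3 * S) / sqrt \<kappa> * (3 * amp u m))"
      using k by (intro mult_left_mono) auto
    then show ?thesis using k by (simp add: C_def)
  qed
  then show ?thesis using Cp by blast
qed

text \<open>The finitely many indices before the tail cost only powers of the one-step factor: both
  indices are moved forward by \<open>n0\<close>.\<close>

theorem amp_comparable:
  assumes sm: "summable defect" and k: "0 < \<kappa>"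
  shows "\<exists>C>0. \<forall>x u m n. x^2 \<le> 1 - 4 * \<kappa> \<longrightarrow> sol x u \<longrightarrow> amp u n \<le> C * amp u m"
proof (cases "\<kappa> \<le> 1/4")
  case False
  then have "\<not> x^2 \<le> 1 - 4 * \<kappa>" for x :: real using zero_le_power2[of x] by linarith
  then show ?thesis by (intro exI[of _ 1]) auto
next
  case True
  then obtain n0 C where C: "0 < C" "\<And>x u m n. x^2 \<le> 1 - 4 * \<kappa> \<Longrightarrow> sol x u \<Longrightarrow> n0 \<le> m \<Longrightarrow> n0 \<le> n \<Longrightarrow>
     amp u n \<le> C * amp u m" using amp_comparable_tail[OF sm k] by blast
  have "amp u n \<le> (21^n0 * C * 21^n0) * amp u m" if x: "x^2 \<le> 1 - 4 * \<kappa>" and so: "sol x u" for x u m n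
  proof -
    have x2: "\<bar>x\<bar> \<le> 2" using x k abs_le_square_iff[of x 2] by simp
    have 1: "amp u n \<le> 21^n0 * amp u (n + n0)" using amp_comparable_steps(2)[OF so x2] .
    have 2: "amp u (m + n0) \<le> 21^n0 * amp u m" using amp_comparable_steps(1)[OF so x2] .
    have "amp u (n + n0) \<le> C * amp u (m + n0)" using C(2)[OF x so] by simp
    also have "... \<le> C * (21^n0 * amp u m)" using 2 C(1) by (intro mult_left_mono) auto
    finally have "21^n0 * amp u (n + n0) \<le> 21^n0 * (C * (21^n0 * amp u m))" by (intro mult_left_mono) auto
    then show ?thesis using 1 unfolding mult.assoc by linarith
  qed
  then show ?thesis using C(1) by (intro exI[of _ "21^n0 * C * 21^n0"]) auto
qed

end


section \<open>The block structure of the example\<close>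

abbreviation "gs \<equiv> grp_start"

lemma gs_Suc: "1 \<le> j \<Longrightarrow> gs (Suc j) = gs j + grp_len j"
  by (simp add: grp_start_def)

lemma gs_1 [simp]: "gs (Suc 0) = 0"
  by (simp add: grp_start_def)

lemma gs_mono: "i \<le> j \<Longrightarrow> gs i \<le> gs j"
  unfolding grp_start_def by (rule sum_mono2) auto

lemma grp_len_ge: "3^(j^2) \<le> grp_len j"
  by (simp add: grp_len_def)

lemma less_gs: "j \<le> gs (Suc j)"
proof (induction j)
  case (Suc j)
  have "1 \<le> grp_len (Suc j)" using grp_len_ge[of "Suc j"] by (metis One_nat_def Suc_leI le_trans zero_less_numeral zero_less_power)
  then show ?case using Suc gs_Suc[of "Suc j"] by simp
qed simp

lemma grp_of_eq:
  assumes "1 \<le> j" "m < grp_len j"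
  shows "grp_of (Suc (gs j + m)) = j"
  unfolding grp_of_def
proof (rule Least_equality)
  show "Suc (gs j + m) \<le> gs (Suc j)" using assms gs_Suc by simp
  fix y assume y: "Suc (gs j + m) \<le> gs (Suc y)"
  show "j \<le> y"
  proof (rule ccontr)
    assume "\<not> j \<le> y"
    then have "gs (Suc y) \<le> gs j" by (intro gs_mono) simp
    then show False using y by simp
  qed
qed

lemma index_in_group:
  obtains j m where "1 \<le> j" "m < grp_len j" "n = gs j + m"
proof -
  define j where "j = (LEAST j. n < gs (Suc j))"
  have "n < gs (Suc (Suc n))" using less_gs[of "Suc n"] by simp
  then have j: "n < gs (Suc j)" unfolding j_def by (rule LeastI)
  have "j \<noteq> 0" using j by (intro notI) simp
  then obtain i where i: "j = Suc i" using not0_implies_Suc by blast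
  have "\<not> n < gs (Suc i)" using not_less_Least[of i "\<lambda>j. n < gs (Suc j)"] i unfolding j_def by simp
  then have "gs j \<le> n" using i by simp
  moreover have "n - gs j < grp_len j" using j \<open>gs j \<le> n\<close> gs_Suc[of j] i by simp
  ultimately show thesis using that[of j "n - gs j"] i by simp
qed

definition clamp :: "real \<Rightarrow> real" where
  "clamp t = max 0 (min 1 t)"

lemma clamp_frac_0: "0 < q \<Longrightarrow> y \<le> 0 \<Longrightarrow> clamp (y / q) = 0"
  using divide_nonpos_pos[of y q] by (simp add: clamp_def)

lemma clamp_frac_1: "0 < q \<Longrightarrow> q \<le> y \<Longrightarrow> clamp (y / q) = 1"
  by (simp add: clamp_def)

lemma clamp_frac: "0 < q \<Longrightarrow> 0 \<le> y \<Longrightarrow> y \<le> q \<Longrightarrow> clamp (y / q) = y / q"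
  by (simp add: clamp_def)

text \<open>Offsets inside a group are counted from 0, while the entries of the matrix are counted from 1.\<close>

definition blkE :: "nat \<Rightarrow> nat" where
  "blkE j = 3^(j^2) + (j^6 - 1) + 2^(j^2)"

text \<open>The exponent e in a = 2^(-e): a ramp rising after A_j minus a ramp rising after C_j. One
  formula for all four blocks makes differences across block borders easy to estimate.\<close>

definition lev :: "nat \<Rightarrow> nat \<Rightarrow> real" where
  "lev j m = clamp ((real m + 1 - 3^(j^2)) / real (j^6)) - clamp ((real m + 1 - real (blkE j)) / real (j^6))"

lemma lev_bounds: "0 \<le> lev j m" "lev j m \<le> 1"
proof -
  have "real (blkE j) \<ge> 3^(j^2)" unfolding blkE_def by simp
  then have "(real m + 1 - real (blkE j)) / real (j^6) \<le> (real m + 1 - 3^(j^2)) / real (j^6)"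
    by (intro divide_right_mono) auto
  then show "0 \<le> lev j m" "lev j m \<le> 1" unfolding lev_def clamp_def by auto
qed

lemma ex_a_lev_inside:
  assumes "1 \<le> j" "m < grp_len j"
  shows "ex_a (Suc (gs j + m)) = 2 powr (- lev j m)"
proof -
  let ?q = "j^6" let ?A = "3^(j^2) :: nat" let ?C = "2^(j^2) :: nat"
  have q: "1 \<le> ?q" using assms(1) by simp
  have C: "1 \<le> ?C" by simp
  have blk: "blkE j = ?A + (?q - 1) + ?C" by (simp add: blkE_def)
  have g: "grp_of (Suc (gs j + m)) = j" by (rule grp_of_eq[OF assms])
  have off: "Suc (gs j + m) - gs j = Suc m" by simp
  have rA: "real ?A = 3^(j^2)" by simp
  have E: "real (blkE j) = 3^(j^2) + (real ?q - 1) + 2^(j^2)"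
    unfolding blk using q by (simp add: of_nat_diff)
  have rC: "(1::real) \<le> 2^(j^2)" by simp
  have rq: "0 < real ?q" using assms(1) by simp
  consider "Suc m \<le> ?A" | "?A < Suc m" "Suc m \<le> ?A + (?q - 1)"
    | "?A + (?q - 1) < Suc m" "Suc m \<le> ?A + (?q - 1) + ?C" | "?A + (?q - 1) + ?C < Suc m" by linarith
  then show ?thesis
  proof cases
    case 1
    then have "real m + 1 \<le> 3^(j^2)" unfolding rA[symmetric] by linarith
    moreover then have "real m + 1 - real (blkE j) \<le> 0" using E rC rq q by linarith
    ultimately have "lev j m = 0" using clamp_frac_0[OF rq] unfolding lev_def by simp
    then show ?thesis using 1 unfolding ex_a_def g Let_def off by simp
  next
    case 2
    then have m: "3^(j^2) < real m + 1" "real m + 1 \<le> 3^(j^2) + (real ?q - 1)"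
      unfolding rA[symmetric] using q by linarith+
    have d: "real m + 1 - real (blkE j) \<le> 0" using E rC m by linarith
    have "clamp ((real m + 1 - real (blkE j)) / real ?q) = 0" using clamp_frac_0[OF rq d] .
    moreover have "clamp ((real m + 1 - 3^(j^2)) / real ?q) = (real m + 1 - 3^(j^2)) / real ?q"
      using m by (intro clamp_frac rq) linarith+
    ultimately have l: "lev j m = (real m + 1 - 3^(j^2)) / real ?q" unfolding lev_def by simp
    have "real (Suc m - ?A) = real m + 1 - 3^(j^2)" using 2 by (simp add: of_nat_diff)
    moreover have "ex_a (Suc (gs j + m)) = 2 powr (- real (Suc m - ?A) / real ?q)"
      using 2 unfolding ex_a_def g Let_def off by auto
    ultimately have e: "ex_a (Suc (gs j + m)) = 2 powr (- (real m + 1 - 3^(j^2)) / real ?q)" by simp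
    have "- ((real m + 1 - 3^(j^2)) / real ?q) = - (real m + 1 - 3^(j^2)) / real ?q" by (rule minus_divide_left)
    then show ?thesis unfolding e l by simp
  next
    case 3
    then have m: "3^(j^2) + (real ?q - 1) + 1 \<le> real m + 1" "real m + 1 \<le> real (blkE j)"
      unfolding rA[symmetric] blk using q by linarith+
    have "clamp ((real m + 1 - real (blkE j)) / real ?q) = 0" using m by (intro clamp_frac_0 rq) linarith
    moreover have "clamp ((real m + 1 - 3^(j^2)) / real ?q) = 1" using m by (intro clamp_frac_1 rq) linarith
    ultimately have l: "lev j m = 1" unfolding lev_def by simp
    have "ex_a (Suc (gs j + m)) = 1/2" using 3 q unfolding ex_a_def g Let_def off by auto
    then show ?thesis unfolding l by (simp add: powr_minus_divide)
  next
    case 4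
    have "Suc m < blkE j + ?q" using assms(2) q unfolding grp_len_def blk by linarith
    then have m: "real (blkE j) < real m + 1" "real m + 1 < real (blkE j) + real ?q"
      using 4 unfolding blk by linarith+
    have "clamp ((real m + 1 - 3^(j^2)) / real ?q) = 1" using m E rC by (intro clamp_frac_1 rq) linarith
    moreover have "clamp ((real m + 1 - real (blkE j)) / real ?q) = (real m + 1 - real (blkE j)) / real ?q"
      using m by (intro clamp_frac rq) linarith+
    ultimately have l: "lev j m = 1 - (real m + 1 - real (blkE j)) / real ?q" unfolding lev_def by simp
    have r: "real (Suc m - blkE j) = real m + 1 - real (blkE j)" using 4 unfolding blk by (simp add: of_nat_diff)
    have "ex_a (Suc (gs j + m)) = 2 powr (-1 + real (Suc m - blkE j) / real ?q)"
      using 4 unfolding ex_a_def g Let_def off blk by auto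
    then show ?thesis unfolding l r by simp
  qed
qed

lemma lev_block_A: "1 \<le> j \<Longrightarrow> m < 3^(j^2) \<Longrightarrow> lev j m = 0"
proof -
  assume j: "1 \<le> j" and "m < 3^(j^2)"
  then have "Suc m \<le> 3^(j^2)" by simp
  then have "real (Suc m) \<le> real (3^(j^2))" unfolding of_nat_le_iff .
  then have 1: "real m + 1 - 3^(j^2) \<le> 0" by simp
  moreover have "real (blkE j) \<ge> 3^(j^2)" unfolding blkE_def by simp
  ultimately have 2: "real m + 1 - real (blkE j) \<le> 0" by linarith
  show "lev j m = 0" using 1 2 j unfolding lev_def by (simp add: clamp_frac_0)
qed

text \<open>D_j has only \<open>j^6 - 1\<close> entries; the last step of its ramp is completed by
  the first entry of the next group, so the formula of group \<open>j\<close> remains right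
  there.\<close>

lemma lev_after: "1 \<le> j \<Longrightarrow> grp_len j \<le> m \<Longrightarrow> lev j m = 0"
proof -
  assume j: "1 \<le> j" and m: "grp_len j \<le> m"
  have q: "0 < real (j^6)" using j by simp
  have "blkE j + j^6 \<le> Suc m" using m j unfolding grp_len_def blkE_def by linarith
  then have "real (blkE j) + real (j^6) \<le> real m + 1" by linarith
  moreover have "real (blkE j) \<ge> 3^(j^2)" unfolding blkE_def by simp
  ultimately have "real (j^6) \<le> real m + 1 - real (blkE j)" "real (j^6) \<le> real m + 1 - 3^(j^2)" by linarith+
  then show "lev j m = 0" using clamp_frac_1[OF q] unfolding lev_def by simp
qed

text \<open>\<open>defect\<close> at the last offset of a group reads two entries of the next group;
  the range of \<open>m\<close> reaches that far.\<close>

lemma ex_a_lev: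
  assumes "1 \<le> j" "m \<le> Suc (grp_len j)"
  shows "ex_a (Suc (gs j + m)) = 2 powr (- lev j m)"
proof (cases "m < grp_len j")
  case True
  then show ?thesis using ex_a_lev_inside assms by blast
next
  case False
  have 81: "(3::nat) \<le> 3^((Suc j)^2)" using power_increasing[of 1 "(Suc j)^2" "3::nat"] by simp
  have "gs j + m = gs (Suc j) + (m - grp_len j)" using False assms gs_Suc by simp
  moreover have mm: "m - grp_len j < 3^((Suc j)^2)" using assms 81 by linarith
  moreover have "m - grp_len j < grp_len (Suc j)" using mm grp_len_ge[of "Suc j"] by linarith
  ultimately have "ex_a (Suc (gs j + m)) = 2 powr (- lev (Suc j) (m - grp_len j))"
    using ex_a_lev_inside[of "Suc j" "m - grp_len j"] by simp
  also have "lev (Suc j) (m - grp_len j) = 0" using lev_block_A[OF _ mm] by simp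
  finally show ?thesis using lev_after[of j m] assms False by simp
qed

lemma ex_a_block_A:
  assumes "1 \<le> j" "m < 3^(j^2)"
  shows "ex_a (Suc (gs j + m)) = 1"
proof -
  have "m < grp_len j" using assms grp_len_ge[of j] by linarith
  then show ?thesis using ex_a_lev_inside[OF assms(1)] lev_block_A[OF assms] by simp
qed

lemma ex_a_block_C:
  assumes "1 \<le> j" "i < 2^(j^2)"
  shows "ex_a (Suc (gs j + 3^(j^2) + (j^6 - 1) + i)) = 1/2"
proof -
  have m: "3^(j^2) + (j^6 - 1) + i < grp_len j" using assms unfolding grp_len_def by linarith
  have g: "grp_of (Suc (gs j + (3^(j^2) + (j^6 - 1) + i))) = j" by (rule grp_of_eq[OF assms(1) m])
  have s: "Suc (gs j + (3^(j^2) + (j^6 - 1) + i)) - gs j = Suc (3^(j^2) + (j^6 - 1) + i)" by simp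
  have "ex_a (Suc (gs j + (3^(j^2) + (j^6 - 1) + i))) = 1/2"
    using assms unfolding ex_a_def g Let_def s by (cases "j^6") auto
  then show ?thesis by (simp only: add.assoc)
qed

lemma ex_a_bounds: "1 \<le> n \<Longrightarrow> 1/2 \<le> ex_a n" "1 \<le> n \<Longrightarrow> ex_a n \<le> 1"
proof -
  assume "1 \<le> n"
  then obtain k where k: "n = Suc k" by (metis One_nat_def Suc_le_D)
  obtain j m where j: "1 \<le> j" "m < grp_len j" "k = gs j + m" by (rule index_in_group)
  have e: "ex_a n = 2 powr (- lev j m)" unfolding k j(3) by (rule ex_a_lev_inside[OF j(1,2)])
  have "2 powr (-1) \<le> ex_a n" unfolding e using lev_bounds[of j m] by (intro powr_mono) auto
  then show "1/2 \<le> ex_a n" by (simp add: powr_minus_divide)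
  have "ex_a n \<le> 2 powr 0" unfolding e using lev_bounds[of j m] by (intro powr_mono) auto
  then show "ex_a n \<le> 1" by simp
qed

interpretation ex: jacobi_seq ex_a ex_b
  by unfold_locales (use ex_a_bounds in \<open>simp_all add: ex_b_def\<close>)

section \<open>Second differences of the squared weights and summability of the defect\<close>

lemma exp_taylor_bound:
  fixes s :: real
  assumes "\<bar>s\<bar> \<le> 2"
  shows "\<bar>exp s - 1 - s\<bar> \<le> 9/2 * s^2"
proof -
  obtain t where t: "\<bar>t\<bar> \<le> \<bar>s\<bar>" "exp s = (\<Sum>m<2. s^m / fact m) + exp t / fact 2 * s^2"
    using Maclaurin_exp_le[of s 2] by blast
  have "exp t \<le> exp 2" using t assms by simp
  also have "exp (2::real) = exp 1 * exp 1" by (simp add: exp_add[symmetric])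
  also have "... \<le> 3 * 3" using exp_le by (intro mult_mono) auto
  finally have e: "exp t \<le> 9" by simp
  have "exp s - 1 - s = exp t / 2 * s^2" using t(2) by (simp add: numeral_2_eq_2)
  then have "\<bar>exp s - 1 - s\<bar> = exp t / 2 * s^2" by (simp only: abs_mult) simp
  also have "... \<le> 9/2 * s^2" using e by (intro mult_right_mono) auto
  finally show ?thesis .
qed

lemma ln_4_bounds: "0 \<le> ln (4::real)" "ln (4::real) \<le> 2"
proof -
  have "ln (4::real) = 2 * ln 2" using ln_realpow[of 2 2] by simp
  then show "ln (4::real) \<le> 2" "0 \<le> ln (4::real)" using ln_2_less_1 by auto
qed

text \<open>Taylor expansion of 4^(-e), the squared weight as a function of the exponent; 18 = 9/2 *
  2^2, from \<open>ln 4 \<le> 2\<close>.\<close>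

lemma quarter_power_taylor:
  fixes e d :: real
  assumes "0 \<le> e" "\<bar>d\<bar> \<le> 1"
  shows "\<bar>exp (- ln 4 * (e + d)) - exp (- ln 4 * e) + ln 4 * exp (- ln 4 * e) * d\<bar> \<le> 18 * d^2"
proof -
  note l = ln_4_bounds
  have s: "\<bar>- ln 4 * d\<bar> \<le> 2" using mult_mono[OF l(2) assms(2)] l by (simp add: abs_mult)
  have "exp (- ln 4 * (e + d)) - exp (- ln 4 * e) + ln 4 * exp (- ln 4 * e) * d
     = exp (- ln 4 * e) * (exp (- ln 4 * d) - 1 - (- ln 4 * d))"
    by (simp add: algebra_simps exp_add[symmetric])
  then have "\<bar>exp (- ln 4 * (e + d)) - exp (- ln 4 * e) + ln 4 * exp (- ln 4 * e) * d\<bar>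
     = exp (- ln 4 * e) * \<bar>exp (- ln 4 * d) - 1 - (- ln 4 * d)\<bar>" by (simp add: abs_mult)
  also have "... \<le> 1 * (9/2 * (- ln 4 * d)^2)"
    using assms l by (intro mult_mono exp_taylor_bound s) auto
  also have "(- ln 4 * d)^2 = (ln 4)^2 * d^2" by (simp add: power_mult_distrib)
  also have "1 * (9/2 * ((ln 4)^2 * d^2)) \<le> 1 * (9/2 * (2^2 * d^2))"
    using l by (intro mult_left_mono mult_right_mono power_mono) auto
  finally show ?thesis by simp
qed

text \<open>Expanding around the middle point turns the second difference of 4^(-e) into that of the
  exponents plus quadratic errors. In 418 = 400 + 18 the 400 bounds the squared first
  difference.\<close>

lemma second_difference_bound:
  fixes e0 e1 e2 :: real and f :: "real \<Rightarrow> real"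
  defines "f \<equiv> (\<lambda>e. exp (- ln 4 * e))"
  assumes "0 \<le> e0" "e0 \<le> 1" "0 \<le> e1" "e1 \<le> 1" "0 \<le> e2" "e2 \<le> 1"
  shows "(f e1 - f e0)^2 + \<bar>(f e2 - f e1) - (f e1 - f e0)\<bar>
    \<le> 2 * \<bar>e2 - 2 * e1 + e0\<bar> + 418 * (e1 - e0)^2 + 18 * (e2 - e1)^2"
proof -
  note l = ln_4_bounds
  define c where "c = ln 4 * exp (- ln 4 * e1)"
  have "exp (- ln 4 * e1) \<le> 1" using assms l by simp
  then have "c \<le> 2 * 1" unfolding c_def using l by (intro mult_mono) auto
  then have c: "0 \<le> c" "c \<le> 2" using l by (auto simp: c_def)
  have 1: "\<bar>f e2 - f e1 + c * (e2 - e1)\<bar> \<le> 18 * (e2 - e1)^2"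
    using quarter_power_taylor[of e1 "e2 - e1"] assms unfolding f_def c_def by simp
  have 2: "\<bar>f e0 - f e1 + c * (e0 - e1)\<bar> \<le> 18 * (e1 - e0)^2"
    using quarter_power_taylor[of e1 "e0 - e1"] assms unfolding f_def c_def by (simp add: power2_commute)
  have "\<bar>c * (e2 - 2 * e1 + e0)\<bar> \<le> 2 * \<bar>e2 - 2 * e1 + e0\<bar>"
    unfolding abs_mult using c by (intro mult_right_mono) auto
  then have 3: "\<bar>(f e2 - f e1) - (f e1 - f e0)\<bar> \<le> 2 * \<bar>e2 - 2 * e1 + e0\<bar> + 18 * (e1 - e0)^2 + 18 * (e2 - e1)^2"
  proof -
    have "(f e2 - f e1) - (f e1 - f e0) = (f e2 - f e1 + c * (e2 - e1)) + (f e0 - f e1 + c * (e0 - e1)) - c * (e2 - 2 * e1 + e0)"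
      by (simp add: algebra_simps)
    then show ?thesis using 1 2 \<open>\<bar>c * (e2 - 2 * e1 + e0)\<bar> \<le> 2 * \<bar>e2 - 2 * e1 + e0\<bar>\<close> by linarith
  qed
  have "\<bar>c * (e0 - e1)\<bar> \<le> 2 * \<bar>e1 - e0\<bar>"
    unfolding abs_mult using c by (auto intro!: mult_mono)
  moreover have "18 * (e1 - e0)^2 \<le> 18 * \<bar>e1 - e0\<bar>"
    using assms mult_left_le[of "\<bar>e1 - e0\<bar>" "\<bar>e1 - e0\<bar>"] by (simp add: power2_eq_square abs_mult[symmetric])
  ultimately have "\<bar>f e1 - f e0\<bar> \<le> 20 * \<bar>e1 - e0\<bar>" using 2 by linarith
  then have "(f e1 - f e0)^2 \<le> (20 * \<bar>e1 - e0\<bar>)^2" by (metis abs_ge_zero power2_abs power_mono)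
  also have "... = 400 * (e1 - e0)^2" by (simp add: power_mult_distrib)
  finally show ?thesis using 3 by linarith
qed

lemma clamp_lipschitz: "\<bar>clamp s - clamp t\<bar> \<le> \<bar>s - t\<bar>"
  unfolding clamp_def by (auto simp: min_def max_def)

lemma sum_interval_indicator_le:
  fixes s :: nat
  shows "(\<Sum>m<M. if s \<le> m + 1 \<and> m + 1 < s + q then 1 else 0 :: real) \<le> real q"
proof -
  have "(\<Sum>m<M. if s \<le> m + 1 \<and> m + 1 < s + q then 1 else 0 :: real) = real (card {m\<in>{..<M}. s \<le> m + 1 \<and> m + 1 < s + q})"
    by (simp add: sum.If_cases Int_def)
  also have "card {m\<in>{..<M}. s \<le> m + 1 \<and> m + 1 < s + q} = card (Suc ` {m\<in>{..<M}. s \<le> m + 1 \<and> m + 1 < s + q})"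
    by (simp add: card_image)
  also have "... \<le> card {s..<s+q}" by (intro card_mono) auto
  finally show ?thesis by simp
qed

lemma sum_point_indicator_le:
  fixes s :: nat
  shows "(\<Sum>m<M. if m + 2 = s then 1 else 0 :: real) \<le> 1"
proof -
  have "(\<Sum>m<M. if m + 2 = s then 1 else 0 :: real) = (\<Sum>m\<in>{..<M}. if m = s - 2 \<and> 2 \<le> s then 1 else 0)"
    by (intro sum.cong) auto
  also have "... \<le> 1" by (cases "2 \<le> s") (simp_all add: sum.delta)
  finally show ?thesis .
qed

definition ramp :: "nat \<Rightarrow> nat \<Rightarrow> nat \<Rightarrow> real" where
  "ramp q s m = clamp ((real m + 1 - real s) / real q)"

lemma ramp_first:
  assumes "1 \<le> q"
  shows "\<bar>ramp q s (Suc m) - ramp q s m\<bar> \<le> (if s \<le> m + 1 \<and> m + 1 < s + q then 1 else 0) / real q"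
proof -
  have q: "0 < real q" using assms by simp
  consider "m + 1 < s" | "s \<le> m + 1" "m + 1 < s + q" | "s + q \<le> m + 1" by linarith
  then show ?thesis
  proof cases
    case 1
    then have "real m + 2 \<le> real s" by linarith
    then show ?thesis using q 1 unfolding ramp_def by (simp add: clamp_frac_0)
  next
    case 2
    have "(real (Suc m) + 1 - real s) / real q - (real m + 1 - real s) / real q = 1 / real q"
      by (simp add: diff_divide_distrib[symmetric])
    then show ?thesis unfolding ramp_def using clamp_lipschitz[of "(real (Suc m) + 1 - real s) / real q" "(real m + 1 - real s) / real q"] 2 q
      by simp
  next
    case 3
    then have "real s + real q \<le> real m + 1" by linarith
    then show ?thesis using q 3 unfolding ramp_def by (simp add: clamp_frac_1)
  qed
qed

text \<open>A piecewise linear function has zero second difference except across its two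
  kinks.\<close>

lemma ramp_second:
  assumes "1 \<le> q"
  shows "\<bar>ramp q s (Suc (Suc m)) - 2 * ramp q s (Suc m) + ramp q s m\<bar>
    \<le> (if m + 2 = s then 1 else 0) / real q + (if m + 2 = s + q then 1 else 0) / real q"
proof -
  have q: "0 < real q" using assms by simp
  let ?r = "ramp q s"
  have lo: "?r k = 0" if "k + 1 \<le> s" for k
  proof -
    have "real k + 1 \<le> real s" using that by linarith
    then show ?thesis using q unfolding ramp_def by (simp add: clamp_frac_0)
  qed
  have hi: "?r k = 1" if "s + q \<le> k + 1" for k
  proof -
    have "real s + real q \<le> real k + 1" using that by linarith
    then show ?thesis using q unfolding ramp_def by (simp add: clamp_frac_1)
  qed
  have mid: "?r k = (real k + 1 - real s) / real q" if "s \<le> k + 1" "k + 1 \<le> s + q" for k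
  proof -
    have "real s \<le> real k + 1" "real k + 1 \<le> real s + real q" using that by linarith+
    then show ?thesis using q unfolding ramp_def by (simp add: clamp_frac)
  qed
  \<comment> \<open>At a kink only one of the two indicators is nonzero, so this already gives
    \<open>1 / q\<close> there.\<close>
  have crude: "\<bar>?r (Suc (Suc m)) - 2 * ?r (Suc m) + ?r m\<bar> \<le>
    (if s \<le> m + 2 \<and> m + 2 < s + q then 1 else 0) / real q + (if s \<le> m + 1 \<and> m + 1 < s + q then 1 else 0) / real q"
    using ramp_first[OF assms, of s "Suc m"] ramp_first[OF assms, of s m] by simp
  consider "m + 2 = s" | "m + 2 = s + q" "m + 2 \<noteq> s" | "m + 3 \<le> s" | "s + q \<le> m + 1"
    | "s \<le> m + 1" "m + 3 \<le> s + q" using assms by linarith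
  then show ?thesis
  proof cases
    case 1 then show ?thesis using crude assms by auto
  next
    case 2 then show ?thesis using crude assms by auto
  next
    case 3 then show ?thesis using lo[of m] lo[of "Suc m"] lo[of "Suc (Suc m)"] by simp
  next
    case 4 then show ?thesis using hi[of m] hi[of "Suc m"] hi[of "Suc (Suc m)"] by simp
  next
    case 5
    have e: "?r m = (real m + 1 - real s) / real q" "?r (Suc m) = (real m + 2 - real s) / real q"
      "?r (Suc (Suc m)) = (real m + 3 - real s) / real q"
      using mid[of m] mid[of "Suc m"] mid[of "Suc (Suc m)"] 5 by (simp_all add: add_ac)
    have "?r (Suc (Suc m)) - 2 * ?r (Suc m) + ?r m = 0"
      unfolding e using q by (simp add: field_simps)
    then show ?thesis by simp
  qed
qed

lemma lev_ramp: "lev j m = ramp (j^6) (3^(j^2)) m - ramp (j^6) (blkE j) m"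
  by (simp add: lev_def ramp_def)

lemma A_sq_lev:
  assumes "1 \<le> j" "m \<le> Suc (grp_len j)"
  shows "(ex_a (Suc (gs j + m)))^2 = exp (- ln 4 * lev j m)"
proof -
  have "ln (4::real) = 2 * ln 2" using ln_realpow[of 2 2] by simp
  then show ?thesis unfolding ex_a_lev[OF assms] by (simp add: powr_def exp_double[symmetric])
qed

text \<open>A group has four kinks of size \<open>1 / j^6\<close> and at most \<open>2 * j^6\<close>
  sloped steps of that size, which enter squared: 8 + 1672 + 72 = 1752, rounded up.\<close>

lemma group_defect_sum:
  assumes j: "1 \<le> j"
  shows "(\<Sum>m<grp_len j. ex.defect (gs j + m)) \<le> 2000 / real (j^6)"
proof -
  define q where "q = j^6"
  have q: "1 \<le> q" using j by (simp add: q_def)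
  have rq: "0 < real q" using q by simp
  define s1 s2 where "s1 = (3::nat)^(j^2)" and "s2 = blkE j"
  define i1 where "i1 = (\<lambda>s m. if s \<le> m + 1 \<and> m + 1 < s + q then 1 else 0 :: real)"
  define i2 where "i2 = (\<lambda>s (m::nat). if m + 2 = s then 1 else 0 :: real)"
  have lev: "lev j m = ramp q s1 m - ramp q s2 m" for m unfolding lev_ramp q_def s1_def s2_def ..
  have d1: "(lev j (Suc m) - lev j m)^2 \<le> 2 / (real q)^2 * (i1 s1 m + i1 s2 m)" for m
  proof -
    have r: "\<bar>ramp q s (Suc m) - ramp q s m\<bar> \<le> i1 s m / real q" for s unfolding i1_def by (rule ramp_first[OF q])
    have "(x + y)^2 \<le> 2 * x^2 + 2 * y^2" for x y :: real using sum_squares_bound[of x y] by (simp add: power2_eq_square algebra_simps)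
    from this[of "ramp q s1 (Suc m) - ramp q s1 m" "- (ramp q s2 (Suc m) - ramp q s2 m)"]
    have "(lev j (Suc m) - lev j m)^2 \<le> 2 * (ramp q s1 (Suc m) - ramp q s1 m)^2 + 2 * (ramp q s2 (Suc m) - ramp q s2 m)^2"
      unfolding lev by (simp add: algebra_simps power2_eq_square)
    also have "... \<le> 2 * (i1 s1 m / real q)^2 + 2 * (i1 s2 m / real q)^2"
      using power_mono[OF r[of s1], of 2] power_mono[OF r[of s2], of 2] by simp
    also have "... = 2 / (real q)^2 * (i1 s1 m + i1 s2 m)"
      by (simp add: i1_def power_divide)
    finally show ?thesis .
  qed
  have d2: "\<bar>lev j (Suc (Suc m)) - 2 * lev j (Suc m) + lev j m\<bar>
      \<le> (i2 s1 m + i2 (s1 + q) m + i2 s2 m + i2 (s2 + q) m) / real q" for m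
  proof -
    have r: "\<bar>ramp q s (Suc (Suc m)) - 2 * ramp q s (Suc m) + ramp q s m\<bar> \<le> i2 s m / real q + i2 (s + q) m / real q" for s
      unfolding i2_def by (rule ramp_second[OF q])
    show ?thesis using r[of s1] r[of s2] unfolding lev add_divide_distrib right_diff_distrib by linarith
  qed
  have dd: "ex.defect (gs j + m) \<le> 2 * ((i2 s1 m + i2 (s1 + q) m + i2 s2 m + i2 (s2 + q) m) / real q)
     + 418 * (2 / (real q)^2 * (i1 s1 m + i1 s2 m)) + 18 * (2 / (real q)^2 * (i1 s1 (Suc m) + i1 s2 (Suc m)))"
    if m: "m < grp_len j" for m
  proof -
    have A: "(ex_a (Suc (gs j + k)))^2 = exp (- ln 4 * lev j k)" if "k \<le> Suc (Suc m)" for k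
      using A_sq_lev[OF j, of k] m that by simp
    have "ex.defect (gs j + m) \<le> 2 * \<bar>lev j (Suc (Suc m)) - 2 * lev j (Suc m) + lev j m\<bar>
       + 418 * (lev j (Suc m) - lev j m)^2 + 18 * (lev j (Suc (Suc m)) - lev j (Suc m))^2"
      using second_difference_bound[of "lev j m" "lev j (Suc m)" "lev j (Suc (Suc m))"]
        A[of m] A[of "Suc m"] A[of "Suc (Suc m)"] lev_bounds
      unfolding ex.defect_def ex.delta_def by simp
    also have "... \<le> 2 * ((i2 s1 m + i2 (s1 + q) m + i2 s2 m + i2 (s2 + q) m) / real q)
     + 418 * (2 / (real q)^2 * (i1 s1 m + i1 s2 m)) + 18 * (2 / (real q)^2 * (i1 s1 (Suc m) + i1 s2 (Suc m)))"
      by (intro add_mono mult_left_mono d1 d2) auto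
    finally show ?thesis .
  qed
  let ?M = "grp_len j"
  have S1: "(\<Sum>m<?M. i1 s m) \<le> real q" for s
    unfolding i1_def by (rule sum_interval_indicator_le)
  have S1': "(\<Sum>m<?M. i1 s (Suc m)) \<le> real q" for s
  proof -
    have "(\<Sum>m<?M. i1 s (Suc m)) \<le> (\<Sum>m<Suc ?M. i1 s m)"
      by (subst sum.lessThan_Suc_shift) (simp add: i1_def)
    also have "... \<le> real q" unfolding i1_def by (rule sum_interval_indicator_le)
    finally show ?thesis .
  qed
  have S2: "(\<Sum>m<?M. i2 s m) \<le> 1" for s unfolding i2_def by (rule sum_point_indicator_le)
  have "(\<Sum>m<?M. ex.defect (gs j + m)) \<le> (\<Sum>m<?M. 2 * ((i2 s1 m + i2 (s1 + q) m + i2 s2 m + i2 (s2 + q) m) / real q)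
     + 418 * (2 / (real q)^2 * (i1 s1 m + i1 s2 m)) + 18 * (2 / (real q)^2 * (i1 s1 (Suc m) + i1 s2 (Suc m))))"
    by (intro sum_mono dd) auto
  also have "... = 2 * (((\<Sum>m<?M. i2 s1 m) + (\<Sum>m<?M. i2 (s1 + q) m) + (\<Sum>m<?M. i2 s2 m) + (\<Sum>m<?M. i2 (s2 + q) m)) / real q)
     + 418 * (2 / (real q)^2 * ((\<Sum>m<?M. i1 s1 m) + (\<Sum>m<?M. i1 s2 m))) + 18 * (2 / (real q)^2 * ((\<Sum>m<?M. i1 s1 (Suc m)) + (\<Sum>m<?M. i1 s2 (Suc m))))"
    by (simp only: sum.distrib sum_distrib_left[symmetric] sum_divide_distrib[symmetric])
  also have "... \<le> 2 * ((1 + 1 + 1 + 1) / real q) + 418 * (2 / (real q)^2 * (real q + real q)) + 18 * (2 / (real q)^2 * (real q + real q))"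
    by (intro add_mono mult_left_mono divide_right_mono S1 S1' S2) auto
  also have "... = 1752 / real q" using rq by (simp add: field_simps power2_eq_square)
  also have "... \<le> 2000 / real q" using rq by (intro divide_right_mono) auto
  finally show ?thesis by (simp add: q_def)
qed

lemma sum_lessThan_add:
  fixes f :: "nat \<Rightarrow> 'a::comm_monoid_add"
  shows "(\<Sum>n<k + l. f n) = (\<Sum>n<k. f n) + (\<Sum>m<l. f (k + m))"
  by (induction l) (simp_all add: add.assoc)

lemma sum_gs:
  fixes f :: "nat \<Rightarrow> 'a::comm_monoid_add"
  shows "(\<Sum>n<gs (Suc J). f n) = (\<Sum>j=1..J. \<Sum>m<grp_len j. f (gs j + m))"
proof (induction J)
  case (Suc J)
  have "(\<Sum>n<gs (Suc (Suc J)). f n) = (\<Sum>n<gs (Suc J) + grp_len (Suc J). f n)" using gs_Suc[of "Suc J"] by simp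
  also have "... = (\<Sum>n<gs (Suc J). f n) + (\<Sum>m<grp_len (Suc J). f (gs (Suc J) + m))"
    by (rule sum_lessThan_add)
  finally show ?case using Suc by simp
qed simp

lemma summable_defect: "summable ex.defect"
proof -
  have s: "summable (\<lambda>j. 2000 / real (j^6))"
    using summable_mult[OF inverse_power_summable[of 6, where 'a=real], of 2000] by (simp add: field_simps)
  have "(\<Sum>n<N. ex.defect n) \<le> (\<Sum>j. 2000 / real (j^6))" for N
  proof -
    have "(\<Sum>n<N. ex.defect n) \<le> (\<Sum>n<gs (Suc N). ex.defect n)"
      using less_gs[of N] by (intro sum_mono2) (auto simp: ex.defect_nonneg)
    also have "... \<le> (\<Sum>j=1..N. 2000 / real (j^6))"
      unfolding sum_gs by (intro sum_mono group_defect_sum) auto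
    also have "... \<le> (\<Sum>j. 2000 / real (j^6))" using s by (intro sum_le_suminf) auto
    finally show ?thesis .
  qed
  then show ?thesis by (intro summableI_nonneg_bounded ex.defect_nonneg)
qed


section \<open>Density of the entries different from 1 and the limit of the geometric means\<close>

lemma sq_le_3_pow: "j^2 \<le> (3::nat)^j"
proof (induction j)
  case (Suc j)
  have "j < 2^j" by (rule less_exp)
  also have "(2::nat)^j \<le> 3^j" by (rule power_mono) auto
  finally show ?case using Suc by (simp add: power2_eq_square)
qed simp

lemma le_3_pow_sq: "j \<le> (3::nat)^(j^2)"
proof -
  have "j \<le> j^2" by (simp add: power2_eq_square)
  moreover have "j^2 < 2^(j^2)" by (rule less_exp)
  moreover have "(2::nat)^(j^2) \<le> 3^(j^2)" by (rule power_mono) auto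
  ultimately show ?thesis by linarith
qed

lemma pow6_le: "j^6 \<le> (3::nat)^(j^2)"
proof -
  consider "j = 0" | "j = 1" | "j = 2" | "3 \<le> j" by linarith
  then show ?thesis
  proof cases
    case 4
    have "j^6 = (j^2)^3" by (simp add: power_mult[symmetric])
    also have "... \<le> (3^j)^3" by (rule power_mono[OF sq_le_3_pow]) simp
    also have "... = 3^(j*3)" by (simp add: power_mult[symmetric])
    also have "... \<le> 3^(j^2)" using 4 by (intro power_increasing) (auto simp: power2_eq_square)
    finally show ?thesis .
  qed auto
qed

lemma grp_len_le: "grp_len j \<le> 4 * 3^(j^2)"
proof -
  have "(2::nat)^(j^2) \<le> 3^(j^2)" by (rule power_mono) auto
  then show ?thesis using pow6_le[of j] unfolding grp_len_def by linarith
qed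

lemma three_pow_Suc_sq: "3 * 3^(j^2) \<le> (3::nat)^((Suc j)^2)"
proof -
  have "(3::nat)^(Suc (j^2)) \<le> 3^((Suc j)^2)" by (rule power_increasing) (auto simp: power2_eq_square)
  then show ?thesis by simp
qed

lemma gs_le: "gs j \<le> 4 * 3^(j^2)"
proof (induction j)
  case 0 show ?case by (simp add: grp_start_def)
next
  case (Suc j)
  show ?case
  proof (cases "j = 0")
    case False
    then show ?thesis using gs_Suc[of j] Suc grp_len_le[of j] three_pow_Suc_sq[of j] by simp
  qed simp
qed

text \<open>Used twice: each such entry lowers the product of the weights by at most a factor 1/2,
  and their number limits the loss of amplitude before C_j.\<close>

definition badcount :: "nat \<Rightarrow> nat" where
  "badcount n = (\<Sum>i<n. if ex_a (Suc i) = 1 then 0 else 1)"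

lemma badcount_add_le: "badcount (n + k) \<le> badcount n + k"
proof -
  have "(\<Sum>m<k. if ex_a (Suc (n + m)) = 1 then 0 else 1) \<le> (\<Sum>m<k. 1::nat)" by (intro sum_mono) auto
  then show ?thesis unfolding badcount_def sum_lessThan_add by simp
qed

lemma badcount_mono: "m \<le> n \<Longrightarrow> badcount m \<le> badcount n"
  unfolding badcount_def by (rule sum_mono2) auto

lemma badcount_block_A: "1 \<le> j \<Longrightarrow> badcount (gs j + 3^(j^2)) = badcount (gs j)"
  unfolding badcount_def sum_lessThan_add using ex_a_block_A by simp

lemma badcount_gs: "badcount (gs (Suc J)) \<le> J * (2 * J^6 + 2^(J^2))"
proof -
  have "badcount (gs (Suc J)) = (\<Sum>j=1..J. \<Sum>m<grp_len j. if ex_a (Suc (gs j + m)) = 1 then 0 else 1)"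
    unfolding badcount_def by (rule sum_gs)
  also have "... \<le> (\<Sum>j=1..J. 2 * J^6 + 2^(J^2))"
  proof (intro sum_mono)
    fix j assume j: "j \<in> {1..J}"
    let ?b = "\<lambda>m. if ex_a (Suc (gs j + m)) = 1 then 0 else 1::nat"
    define R where "R = (j^6 - 1) + 2^(j^2) + (j^6 - 1)"
    have "(\<Sum>m<grp_len j. ?b m) = (\<Sum>m<3^(j^2) + R. ?b m)" by (simp add: grp_len_def R_def add.assoc)
    also have "... = (\<Sum>m<3^(j^2). ?b m) + (\<Sum>m<R. ?b (3^(j^2) + m))" by (rule sum_lessThan_add)
    also have "(\<Sum>m<3^(j^2). ?b m) = 0" using ex_a_block_A[of j] j by simp
    also have "(\<Sum>m<R. ?b (3^(j^2) + m)) \<le> (\<Sum>m<R. 1)" by (intro sum_mono) auto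
    also have "(\<Sum>m<R. 1::nat) = R" by simp
    finally have "(\<Sum>m<grp_len j. ?b m) \<le> R" by simp
    also have "R \<le> 2 * j^6 + 2^(j^2)" unfolding R_def by linarith
    also have "... \<le> 2 * J^6 + 2^(J^2)"
      using j by (intro add_mono mult_left_mono power_mono power_increasing) auto
    finally show "(\<Sum>m<grp_len j. ?b m) \<le> 2 * J^6 + 2^(J^2)" .
  qed
  also have "... = J * (2 * J^6 + 2^(J^2))" by simp
  finally show ?thesis .
qed

text \<open>The sequence lies below the seventh power of \<open>j * c^j\<close>. It is applied with
  \<open>c = 7/8\<close>, whose seventh power is about 0.39.\<close>

lemma power7_times_power_tendsto:
  fixes c :: real
  assumes "1/3 \<le> c^7" "0 \<le> c" "c < 1"
  shows "(\<lambda>j. (real j)^7 / 3^j) \<longlonglongrightarrow> 0"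
proof (rule tendsto_sandwich[where f = "\<lambda>_. 0"])
  have "(\<lambda>j. real j * c^j) \<longlonglongrightarrow> 0" using assms by (intro powser_times_n_limit_0) auto
  then have "(\<lambda>j. (real j * c^j)^7) \<longlonglongrightarrow> 0^7" by (rule tendsto_power)
  then show "(\<lambda>j. (real j * c^j)^7) \<longlonglongrightarrow> 0" by simp
  have "(real j)^7 / 3^j \<le> (real j * c^j)^7" for j
  proof -
    have "(1/3::real)^j \<le> (c^7)^j" using assms by (intro power_mono) auto
    also have "... = (c^j)^7" by (simp add: power_mult[symmetric] mult.commute)
    finally have "(real j)^7 * (1/3::real)^j \<le> (real j)^7 * (c^j)^7" by (intro mult_left_mono) auto
    then show ?thesis by (simp add: power_mult_distrib power_divide)
  qed
  then show "\<forall>\<^sub>F j in sequentially. (real j)^7 / 3^j \<le> (real j * c^j)^7" by simp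
qed auto

lemma badcount_ratio_tendsto: "(\<lambda>j. real (j * (2 * j^6 + 2^(j^2))) / 3^(j^2)) \<longlonglongrightarrow> 0"
proof (rule tendsto_sandwich[where f = "\<lambda>_. 0"])
  have "(\<lambda>j. real j * (2/3)^j) \<longlonglongrightarrow> 0" by (intro powser_times_n_limit_0) simp
  moreover have "(\<lambda>j. (real j)^7 / 3^j) \<longlonglongrightarrow> 0"
    by (rule power7_times_power_tendsto[of "7/8"]) (simp_all add: power_divide)
  ultimately have "(\<lambda>j. 2 * ((real j)^7 / 3^j) + real j * (2/3)^j) \<longlonglongrightarrow> 2 * 0 + 0"
    by (intro tendsto_intros)
  then show "(\<lambda>j. 2 * ((real j)^7 / 3^j) + real j * (2/3)^j) \<longlonglongrightarrow> 0" by simp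
  show "\<forall>\<^sub>F j in sequentially. 0 \<le> real (j * (2 * j^6 + 2^(j^2))) / 3^(j^2)" by simp
  have "real (j * (2 * j^6 + 2^(j^2))) / 3^(j^2) \<le> 2 * ((real j)^7 / 3^j) + real j * (2/3)^j" for j
  proof -
    have jj: "j \<le> j^2" by (simp add: power2_eq_square)
    have "real (j * (2 * j^6 + 2^(j^2))) = 2 * (real j)^7 + real j * 2^(j^2)"
      by (simp add: algebra_simps power_Suc[symmetric] del: power_Suc)
    then have "real (j * (2 * j^6 + 2^(j^2))) / 3^(j^2) = 2 * ((real j)^7 / 3^(j^2)) + real j * (2/3)^(j^2)"
      by (simp add: add_divide_distrib power_divide)
    also have "... \<le> 2 * ((real j)^7 / 3^j) + real j * (2/3)^j"
      using jj by (intro add_mono divide_left_mono mult_left_mono power_increasing power_decreasing) auto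
    finally show ?thesis .
  qed
  then show "\<forall>\<^sub>F j in sequentially. real (j * (2 * j^6 + 2^(j^2))) / 3^(j^2) \<le> 2 * ((real j)^7 / 3^j) + real j * (2/3)^j"
    by simp
qed simp

text \<open>Within A_j the count is still that of the preceding groups, while \<open>n\<close>
  already exceeds \<open>3^((j-1)^2)\<close>; after A_j, \<open>n\<close> exceeds
  \<open>3^(j^2)\<close>. Either way the ratio is bounded by a value of \<open>g\<close>.\<close>

lemma badcount_density: "(\<lambda>n. real (badcount n) / real n) \<longlonglongrightarrow> 0"
proof (rule LIMSEQ_I)
  fix \<epsilon> :: real assume "0 < \<epsilon>"
  define g where "g = (\<lambda>j. real (j * (2 * j^6 + 2^(j^2))) / 3^(j^2))"
  have "eventually (\<lambda>j. g j < \<epsilon>) sequentially"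
    using badcount_ratio_tendsto \<open>0 < \<epsilon>\<close> unfolding g_def by (rule order_tendstoD)
  then obtain J where J: "\<And>j. J \<le> j \<Longrightarrow> g j < \<epsilon>" by (auto simp: eventually_sequentially)
  have key: "real b / real n < \<epsilon>" if "b \<le> j * (2 * j^6 + 2^(j^2))" "3^(j^2) \<le> n" "J \<le> j" for b n j
  proof -
    have "real b / real n \<le> real (j * (2 * j^6 + 2^(j^2))) / real n"
      using that by (intro divide_right_mono) (auto simp only: of_nat_le_iff of_nat_0_le_iff)
    also have "... \<le> g j" unfolding g_def
    proof (intro divide_left_mono)
      have "real (3^(j^2)) \<le> real n" using that(2) by (simp only: of_nat_le_iff)
      then show n: "3^(j^2) \<le> real n" by simp
      show "0 < real n * 3^(j^2)" using less_le_trans[OF zero_less_power n, of] by simp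
    qed simp
    finally show ?thesis using J[OF that(3)] by simp
  qed
  have "norm (real (badcount n) / real n - 0) < \<epsilon>" if n: "gs (Suc (Suc J)) \<le> n" for n
  proof -
    obtain j m where j: "1 \<le> j" "m < grp_len j" "n = gs j + m" by (rule index_in_group)
    have "Suc J < j"
    proof (rule ccontr)
      assume "\<not> Suc J < j"
      then have "gs (Suc j) \<le> gs (Suc (Suc J))" by (intro gs_mono) simp
      then show False using n j gs_Suc[of j] by simp
    qed
    then obtain i where i: "j = Suc i" "J \<le> i" "1 \<le> i" by (cases j) auto
    have "real (badcount n) / real n < \<epsilon>"
    proof (cases "m \<le> 3^(j^2)")
      case True
      have "badcount n \<le> badcount (gs j)"
        using badcount_mono[of n "gs j + 3^(j^2)"] badcount_block_A[OF j(1)] True j(3) by simp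
      then have "badcount n \<le> i * (2 * i^6 + 2^(i^2))" using badcount_gs[of i] unfolding i(1) by linarith
      moreover have "3^(i^2) \<le> n" using gs_Suc[OF i(3)] grp_len_ge[of i] j(3) i(1) by simp
      ultimately show ?thesis using i(2) by (rule key)
    next
      case False
      have "badcount n \<le> badcount (gs (Suc j))" using j gs_Suc[of j] by (intro badcount_mono) simp
      then have "badcount n \<le> j * (2 * j^6 + 2^(j^2))" using badcount_gs[of j] by linarith
      then show ?thesis using False j i by (intro key[of _ j]) auto
    qed
    then show ?thesis by simp
  qed
  then show "\<exists>no. \<forall>n\<ge>no. norm (real (badcount n) / real n - 0) < \<epsilon>" by blast
qed

lemma prod_ex_a_bounds: "(1/2)^badcount n \<le> (\<Prod>i=1..n. ex_a i)" "(\<Prod>i=1..n. ex_a i) \<le> 1"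
proof (induction n)
  case (Suc n)
  have e: "(\<Prod>i=1..Suc n. ex_a i) = (\<Prod>i=1..n. ex_a i) * ex_a (Suc n)" by simp
  have p: "0 \<le> (\<Prod>i=1..n. ex_a i)" by (rule order_trans[OF _ Suc(1)]) simp
  have b: "1/2 \<le> ex_a (Suc n)" "ex_a (Suc n) \<le> 1" using ex_a_bounds[of "Suc n"] by auto
  { case 1
    have c: "(1/2::real)^badcount (Suc n) = (1/2)^badcount n * (if ex_a (Suc n) = 1 then 1 else 1/2)"
      by (simp add: badcount_def)
    show ?case unfolding e c using Suc(1) b p by (intro mult_mono) auto }
  { case 2 show ?case unfolding e using Suc(2) b p by (intro mult_le_one) auto }
qed (simp_all add: badcount_def)

lemma root_prod_tendsto: "(\<lambda>n. (\<Prod>i=1..n. ex_a i) powr (1 / real n)) \<longlonglongrightarrow> 1"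
proof (rule tendsto_sandwich)
  have "(\<lambda>n. (1/2::real) powr (real (badcount n) / real n)) \<longlonglongrightarrow> (1/2) powr 0"
    by (intro tendsto_intros badcount_density) auto
  then show "(\<lambda>n. (1/2::real) powr (real (badcount n) / real n)) \<longlonglongrightarrow> 1" by simp
  have "(1/2::real) powr (real (badcount n) / real n) \<le> (\<Prod>i=1..n. ex_a i) powr (1 / real n)" for n
  proof -
    have "(1/2::real) powr (real (badcount n) / real n) = ((1/2)^badcount n) powr (1 / real n)"
      by (simp add: powr_powr powr_realpow[symmetric])
    also have "... \<le> (\<Prod>i=1..n. ex_a i) powr (1 / real n)"
      using prod_ex_a_bounds(1)[of n] by (intro powr_mono2) auto
    finally show ?thesis .
  qed
  then show "\<forall>\<^sub>F n in sequentially. (1/2::real) powr (real (badcount n) / real n) \<le> (\<Prod>i=1..n. ex_a i) powr (1 / real n)" by simp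
  have "(\<Prod>i=1..n. ex_a i) powr (1 / real n) \<le> 1" for n
  proof -
    have "0 \<le> (\<Prod>i=1..n. ex_a i)" by (rule order_trans[OF _ prod_ex_a_bounds(1)]) simp
    then have "(\<Prod>i=1..n. ex_a i) powr (1 / real n) \<le> 1 powr (1 / real n)"
      using prod_ex_a_bounds(2)[of n] by (intro powr_mono2) auto
    then show ?thesis by simp
  qed
  then show "\<forall>\<^sub>F n in sequentially. (\<Prod>i=1..n. ex_a i) powr (1 / real n) \<le> 1" by simp
qed simp


section \<open>The spectrum\<close>

lemma l2_summable: "u \<in> l2 \<Longrightarrow> summable (\<lambda>n. (cmod (u n))^2)" and l2_zero: "u \<in> l2 \<Longrightarrow> u 0 = 0"
  by (auto simp: l2_def)

lemma l2_tendsto_zero: "u \<in> l2 \<Longrightarrow> u \<longlonglongrightarrow> 0"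
proof -
  assume "u \<in> l2"
  then have "(\<lambda>n. (cmod (u n))^2) \<longlonglongrightarrow> 0" by (intro summable_LIMSEQ_zero l2_summable)
  then have "(\<lambda>n. sqrt ((cmod (u n))^2)) \<longlonglongrightarrow> sqrt 0" by (intro tendsto_intros)
  then show ?thesis by (simp add: tendsto_norm_zero_iff)
qed

lemma norm_add_sq_le: "(norm (x + y :: 'a::real_normed_vector))^2 \<le> 2 * (norm x)^2 + 2 * (norm y)^2"
proof -
  have "(norm (x + y))^2 \<le> (norm x + norm y)^2" by (intro power_mono norm_triangle_ineq) simp
  also have "... \<le> 2 * (norm x)^2 + 2 * (norm y)^2"
    using sum_squares_bound[of "norm x" "norm y"] by (simp add: power2_eq_square algebra_simps)
  finally show ?thesis .
qed

lemma l2_add: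
  assumes "u \<in> l2" "v \<in> l2"
  shows "(\<lambda>n. u n + v n) \<in> l2"
proof -
  have "summable (\<lambda>n. 2 * (cmod (u n))^2 + 2 * (cmod (v n))^2)"
    using assms by (intro summable_add summable_mult l2_summable)
  then have "summable (\<lambda>n. (cmod (u n + v n))^2)"
    by (rule summable_comparison_test'[where N=0]) (auto intro: norm_add_sq_le)
  then show ?thesis using assms by (simp add: l2_def)
qed

lemma l2_scale: "u \<in> l2 \<Longrightarrow> (\<lambda>n. c * u n) \<in> l2"
  unfolding l2_def by (auto simp: norm_mult power_mult_distrib intro: summable_mult)

lemma l2_diff: "u \<in> l2 \<Longrightarrow> v \<in> l2 \<Longrightarrow> (\<lambda>n. u n - v n) \<in> l2"
  using l2_add[of u "\<lambda>n. (-1) * v n"] l2_scale[of v "-1"] by simp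

context jacobi_seq
begin

definition Jz :: "complex \<Rightarrow> (nat \<Rightarrow> complex) \<Rightarrow> nat \<Rightarrow> complex" where
  "Jz z u n = jacobi_op a b u n - z * u n"

lemma Jz_Suc:
  fixes u :: "nat \<Rightarrow> complex" and z :: complex
  shows "u 0 = 0 \<Longrightarrow> Jz z u (Suc n) = a n * u n + A n * u (Suc (Suc n)) - z * u (Suc n)"
  by (cases n) (auto simp: Jz_def jacobi_op_def b_zero)

lemma Jz_0: "Jz z u 0 = - z * u 0"
  by (simp add: Jz_def jacobi_op_def)

lemma Jz_l2: "u \<in> l2 \<Longrightarrow> Jz z u \<in> l2"
proof -
  assume u: "u \<in> l2"
  have a1: "(cmod (of_real (a n) * y))^2 \<le> (cmod y)^2" if "1 \<le> n" for n y
    using a_ge[OF that] a_le[OF that] by (auto simp: norm_mult power_mult_distrib intro!: mult_left_le_one_le power_le_one)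
  have "(\<lambda>n. case n of 0 \<Rightarrow> 0 | Suc k \<Rightarrow> a k * u k) \<in> l2"
  proof -
    have "summable (\<lambda>k. (cmod (a k * u k))^2)"
      by (rule summable_comparison_test'[OF l2_summable[OF u], where N=1]) (use a1 in auto)
    then have "summable (\<lambda>n. (cmod (case n of 0 \<Rightarrow> 0 | Suc k \<Rightarrow> a k * u k))^2)"
      by (subst summable_Suc_iff[symmetric]) simp
    then show ?thesis by (simp add: l2_def)
  qed
  moreover have "(\<lambda>n. case n of 0 \<Rightarrow> 0 | Suc k \<Rightarrow> A k * u (Suc (Suc k))) \<in> l2"
  proof -
    have "summable (\<lambda>k. (cmod (u (Suc (Suc k))))^2)"
      using l2_summable[OF u] by (simp add: summable_Suc_iff[of "\<lambda>k. (cmod (u k))^2"] summable_Suc_iff[of "\<lambda>k. (cmod (u (Suc k)))^2"])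
    then have "summable (\<lambda>k. (cmod (A k * u (Suc (Suc k))))^2)"
      by (rule summable_comparison_test'[where N=0]) (use a1[of "Suc _"] in auto)
    then have "summable (\<lambda>n. (cmod (case n of 0 \<Rightarrow> 0 | Suc k \<Rightarrow> A k * u (Suc (Suc k))))^2)"
      by (subst summable_Suc_iff[symmetric]) simp
    then show ?thesis by (simp add: l2_def)
  qed
  ultimately have "(\<lambda>n. (case n of 0 \<Rightarrow> 0 | Suc k \<Rightarrow> a k * u k) + (case n of 0 \<Rightarrow> 0 | Suc k \<Rightarrow> A k * u (Suc (Suc k))) - z * u n) \<in> l2"
    by (intro l2_diff l2_add l2_scale u)
  also have "(\<lambda>n. (case n of 0 \<Rightarrow> 0 | Suc k \<Rightarrow> a k * u k) + (case n of 0 \<Rightarrow> 0 | Suc k \<Rightarrow> A k * u (Suc (Suc k))) - z * u n) = Jz z u"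
  proof
    fix n
    show "(case n of 0 \<Rightarrow> 0 | Suc k \<Rightarrow> a k * u k) + (case n of 0 \<Rightarrow> 0 | Suc k \<Rightarrow> A k * u (Suc (Suc k))) - z * u n = Jz z u n"
      using Jz_Suc[where u=u, OF l2_zero[OF u]] Jz_0 by (cases n) simp_all
  qed
  finally show ?thesis .
qed

definition Q :: "(nat \<Rightarrow> complex) \<Rightarrow> nat \<Rightarrow> real" where
  "Q u N = (\<Sum>n\<le>N. (cmod (u n))^2)"

lemma Q_mono: "m \<le> n \<Longrightarrow> Q u m \<le> Q u n"
  unfolding Q_def by (rule sum_mono2) auto

text \<open>The quadratic form of a finite section; the last term is the coupling of the section to
  the index \<open>Suc N\<close>.\<close>

lemma quadratic_form:
  assumes "u 0 = 0"
  shows "(\<Sum>n\<le>N. cnj (u n) * Jz z u n) =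
     of_real (\<Sum>n<N. 2 * a n * Re (cnj (u n) * u (Suc n))) - z * of_real (Q u N) + a N * cnj (u N) * u (Suc N)"
proof (induction N)
  case 0 then show ?case using assms by (simp add: Q_def)
next
  case (Suc N)
  have r: "of_real (2 * a N * Re (cnj (u N) * u (Suc N))) = a N * (cnj (u N) * u (Suc N)) + a N * (cnj (u (Suc N)) * u N)"
    by (simp add: complex_eq_iff algebra_simps)
  have q: "of_real ((cmod (u (Suc N)))^2) = cnj (u (Suc N)) * u (Suc N)"
    by (simp only: complex_norm_square mult.commute)
  have "(\<Sum>n\<le>Suc N. cnj (u n) * Jz z u n) = (\<Sum>n\<le>N. cnj (u n) * Jz z u n) + cnj (u (Suc N)) * Jz z u (Suc N)" by simp
  also have "... = of_real (\<Sum>n<N. 2 * a n * Re (cnj (u n) * u (Suc n))) - z * of_real (Q u N)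
      + a N * cnj (u N) * u (Suc N) + cnj (u (Suc N)) * (a N * u N + A N * u (Suc (Suc N)) - z * u (Suc N))"
    unfolding Suc Jz_Suc[where u=u, OF assms] ..
  also have "... = of_real (\<Sum>n<N. 2 * a n * Re (cnj (u n) * u (Suc n))) + of_real (2 * a N * Re (cnj (u N) * u (Suc N)))
      - z * (of_real (Q u N) + of_real ((cmod (u (Suc N)))^2)) + A N * cnj (u (Suc N)) * u (Suc (Suc N))"
    unfolding r q by (simp add: algebra_simps)
  finally show ?case by (simp add: Q_def)
qed

lemma numerical_range:
  assumes "u 0 = 0"
  shows "\<bar>\<Sum>n<N. 2 * a n * Re (cnj (u n) * u (Suc n))\<bar> \<le> 2 * Q u N"
proof -
  have t: "\<bar>2 * a n * Re (cnj (u n) * u (Suc n))\<bar> \<le> (cmod (u n))^2 + (cmod (u (Suc n)))^2" for n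
  proof (cases "n = 0")
    case True then show ?thesis using assms by simp
  next
    case False
    then have an: "0 \<le> a n" "a n \<le> 1" using a_ge[of n] a_le[of n] by auto
    have "\<bar>Re (cnj (u n) * u (Suc n))\<bar> \<le> cmod (u n) * cmod (u (Suc n))"
      by (metis abs_Re_le_cmod complex_mod_cnj norm_mult)
    then have "\<bar>a n * Re (cnj (u n) * u (Suc n))\<bar> \<le> 1 * (cmod (u n) * cmod (u (Suc n)))"
      unfolding abs_mult using an by (intro mult_mono) auto
    moreover have "2 * (cmod (u n) * cmod (u (Suc n))) \<le> (cmod (u n))^2 + (cmod (u (Suc n)))^2"
      using sum_squares_bound[of "cmod (u n)" "cmod (u (Suc n))"] by (simp add: mult.assoc)
    ultimately show ?thesis by (simp add: abs_mult)
  qed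
  have "\<bar>\<Sum>n<N. 2 * a n * Re (cnj (u n) * u (Suc n))\<bar> \<le> (\<Sum>n<N. (cmod (u n))^2 + (cmod (u (Suc n)))^2)"
    by (rule order_trans[OF sum_abs]) (intro sum_mono t)
  also have "... = (\<Sum>n<N. (cmod (u n))^2) + (\<Sum>n<N. (cmod (u (Suc n)))^2)" by (rule sum.distrib)
  also have "... \<le> Q u N + Q u N"
  proof (rule add_mono)
    show "(\<Sum>n<N. (cmod (u n))^2) \<le> Q u N" unfolding Q_def by (intro sum_mono2) auto
    have "Q u N = (\<Sum>n<Suc N. (cmod (u n))^2)" unfolding Q_def lessThan_Suc_atMost ..
    also have "... = (cmod (u 0))^2 + (\<Sum>n<N. (cmod (u (Suc n)))^2)" by (rule sum.lessThan_Suc_shift)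
    finally show "(\<Sum>n<N. (cmod (u (Suc n)))^2) \<le> Q u N" by simp
  qed
  finally show ?thesis by simp
qed

text \<open>The Rayleigh quotient of the section lies in [-2, 2], at distance at least
  \<open>d\<close> from \<open>z\<close>. The boundary product disappears in both uses: because
  \<open>u (Suc N) = 0\<close>, or in the limit for \<open>u\<close> in \<open>l2\<close>.\<close>

lemma resolvent_bound:
  assumes u0: "u 0 = 0" and d: "\<And>t. -2 \<le> t \<Longrightarrow> t \<le> 2 \<Longrightarrow> d \<le> cmod (of_real t - z)"
  shows "d * Q u N \<le> cmod (\<Sum>n\<le>N. cnj (u n) * Jz z u n) + cmod (u N) * cmod (u (Suc N))"
proof (cases "Q u N = 0")
  case True then show ?thesis by simp
next
  case False
  then have Qp: "0 < Q u N" using sum_nonneg[of "{..N}" "\<lambda>n. (cmod (u n))^2"] by (simp add: Q_def)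
  define T where "T = (\<Sum>n<N. 2 * a n * Re (cnj (u n) * u (Suc n)))"
  have "\<bar>T\<bar> \<le> 2 * Q u N" unfolding T_def by (rule numerical_range) (rule u0)
  then have "-2 \<le> T / Q u N" "T / Q u N \<le> 2" using Qp by (auto simp: field_simps)
  then have "d \<le> cmod (of_real (T / Q u N) - z)" by (rule d)
  then have "d * Q u N \<le> cmod (of_real (T / Q u N) - z) * cmod (of_real (Q u N))" using Qp by simp
  also have "... = cmod (of_real T - z * of_real (Q u N))"
    unfolding norm_mult[symmetric] using Qp by (simp add: algebra_simps)
  also have "... = cmod ((\<Sum>n\<le>N. cnj (u n) * Jz z u n) - a N * cnj (u N) * u (Suc N))"
    unfolding quadratic_form[where u=u, OF u0] T_def[symmetric] by simp
  also have "... \<le> cmod (\<Sum>n\<le>N. cnj (u n) * Jz z u n) + cmod (a N * cnj (u N) * u (Suc N))"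
    by (rule norm_triangle_ineq4)
  also have "cmod (a N * cnj (u N) * u (Suc N)) \<le> cmod (u N) * cmod (u (Suc N))"
  proof (cases "N = 0")
    case True then show ?thesis using u0 by simp
  next
    case False
    then have "0 \<le> a N" "a N \<le> 1" using a_ge[of N] a_le[of N] by auto
    then show ?thesis by (simp add: norm_mult mult_left_le_one_le mult.assoc)
  qed
  finally show ?thesis by simp
qed

text \<open>Solves (J - z) u = w row by row from a free value \<open>t\<close> at index 1;
  surjectivity amounts to finding a \<open>t\<close> that makes the solution square
  summable.\<close>

fun rsol :: "complex \<Rightarrow> complex \<Rightarrow> (nat \<Rightarrow> complex) \<Rightarrow> nat \<Rightarrow> complex" where
  "rsol z t w 0 = 0"
| "rsol z t w (Suc 0) = t"
| "rsol z t w (Suc (Suc n)) = (w (Suc n) + z * rsol z t w (Suc n) - a n * rsol z t w n) / A n"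

lemma Jz_rsol: "w 0 = 0 \<Longrightarrow> Jz z (rsol z t w) = w"
proof
  fix n assume "w 0 = 0"
  then show "Jz z (rsol z t w) n = w n"
    using A_nz[of "n - 1"] by (cases n) (simp_all add: Jz_0 Jz_Suc)
qed

lemma rsol_affine: "rsol z t w n = rsol z 0 w n + t * rsol z 1 (\<lambda>_. 0) n"
proof (induction n rule: induct_nat_012)
  case (ge2 n)
  show ?case unfolding rsol.simps ge2 by (simp add: algebra_simps add_divide_distrib diff_divide_distrib)
qed auto

lemma cauchy_schwarz_Q:
  "cmod (\<Sum>n\<le>N. cnj (u n) * w n) \<le> sqrt (Q u N) * sqrt (Q w N)"
proof -
  have "cmod (\<Sum>n\<le>N. cnj (u n) * w n) \<le> (\<Sum>n\<le>N. cmod (u n) * cmod (w n))"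
    by (rule order_trans[OF norm_sum]) (simp add: norm_mult)
  also have "... \<le> sqrt (Q u N) * sqrt (Q w N)"
    using L2_set_mult_ineq[of "\<lambda>n. cmod (u n)" "\<lambda>n. cmod (w n)" "{..N}"] unfolding L2_set_def Q_def by simp
  finally show ?thesis .
qed

text \<open>Surjectivity by truncation: a \<open>t\<close> that makes the solution vanish at
  \<open>Suc N\<close> bounds it on the section by \<open>W / d^2\<close>, independently of
  \<open>N\<close>, and a limit point of these \<open>t\<close> gives the preimage. Injectivity: for
  a difference in the kernel the boundary product tends to 0.\<close>

lemma outside_spectrum:
  assumes d: "0 < d" "\<And>t. -2 \<le> t \<Longrightarrow> t \<le> 2 \<Longrightarrow> d \<le> cmod (of_real t - z)"
  shows "bij_betw (Jz z) l2 l2"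
proof (rule bij_betwI')
  fix u assume "u \<in> l2" then show "Jz z u \<in> l2" by (rule Jz_l2)
next
  fix u v assume u: "u \<in> l2" and v: "v \<in> l2"
  show "(Jz z u = Jz z v) = (u = v)"
  proof
    assume e: "Jz z u = Jz z v"
    define w where "w = (\<lambda>n. u n - v n)"
    have w: "w \<in> l2" unfolding w_def using u v by (rule l2_diff)
    have Jw: "Jz z w n = 0" for n
      using fun_cong[OF e, of n] l2_zero[OF u] l2_zero[OF v] unfolding w_def
      by (cases n) (auto simp: Jz_Suc Jz_0 algebra_simps)
    have b: "d * Q w N \<le> cmod (w N) * cmod (w (Suc N))" for N
      using resolvent_bound[where u=w and N=N, OF l2_zero[OF w] d(2)] by (simp add: Jw)
    have "(\<lambda>n. cmod (w n)) \<longlonglongrightarrow> 0" using l2_tendsto_zero[OF w] by (rule tendsto_norm_zero)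
    then have "(\<lambda>n. cmod (w n) * cmod (w (Suc n))) \<longlonglongrightarrow> 0 * 0"
      by (intro tendsto_mult LIMSEQ_Suc)
    then have c1: "(\<lambda>n. cmod (w n) * cmod (w (Suc n))) \<longlonglongrightarrow> 0" by simp
    have "w M = 0" for M
    proof -
      have "eventually (\<lambda>N. d * Q w M \<le> cmod (w N) * cmod (w (Suc N))) sequentially"
        unfolding eventually_sequentially
      proof (intro exI[of _ M] allI impI)
        fix N assume "M \<le> N"
        then have "d * Q w M \<le> d * Q w N" using d(1) Q_mono by simp
        then show "d * Q w M \<le> cmod (w N) * cmod (w (Suc N))" using b[of N] by linarith
      qed
      then have "d * Q w M \<le> 0" using c1 by (intro tendsto_lowerbound) auto
      then have "Q w M \<le> 0" using d(1) by (simp add: mult_le_0_iff)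
      moreover have "(cmod (w M))^2 \<le> Q w M" unfolding Q_def by (rule member_le_sum) auto
      ultimately have "(cmod (w M))^2 \<le> 0" by linarith
      then show "w M = 0" by simp
    qed
    then show "u = v" by (auto simp: w_def)
  qed simp
next
  fix w assume w: "w \<in> l2"
  define W where "W = suminf (\<lambda>n. (cmod (w n))^2)"
  have QW: "Q w N \<le> W" for N
    unfolding Q_def W_def lessThan_Suc_atMost[symmetric] by (intro sum_le_suminf l2_summable[OF w]) auto
  have W0: "0 \<le> W" using QW[of 0] by (simp add: Q_def order_trans[OF zero_le_power2])
  let ?h = "rsol z 1 (\<lambda>_. 0)" let ?g = "rsol z 0 w"
  \<comment> \<open>A zero would make \<open>?h\<close> an eigenvector of a finite section for
    \<open>z\<close>.\<close>
  have h: "?h (Suc N) \<noteq> 0" for N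
  proof
    assume h0: "?h (Suc N) = 0"
    then have N: "N \<noteq> 0" by (intro notI) simp
    have "d * Q ?h N \<le> 0"
      using resolvent_bound[of ?h d z N, OF _ d(2)] h0 by (simp add: Jz_rsol)
    then have "Q ?h N \<le> 0" using d(1) by (simp add: mult_le_0_iff)
    moreover have "(cmod (?h 1))^2 \<le> Q ?h N" unfolding Q_def using N by (intro member_le_sum) auto
    ultimately show False by simp
  qed
  define t where "t = (\<lambda>N. - ?g (Suc N) / ?h (Suc N))"
  have v0: "rsol z (t N) w (Suc N) = 0" for N
    using rsol_affine[of z "t N" w "Suc N"] h[of N] by (simp add: t_def)
  have Qv: "Q (rsol z (t N) w) N \<le> W / d^2" for N
  proof -
    define q where "q = Q (rsol z (t N) w) N"
    have q0: "0 \<le> q" unfolding q_def Q_def by (intro sum_nonneg) auto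
    have "d * q \<le> cmod (\<Sum>n\<le>N. cnj (rsol z (t N) w n) * Jz z (rsol z (t N) w) n)"
      using resolvent_bound[of "rsol z (t N) w" d z N, OF _ d(2)] v0[of N] unfolding q_def by simp
    also have "... \<le> sqrt q * sqrt (Q w N)"
      unfolding Jz_rsol[where w=w, OF l2_zero[OF w]] q_def by (rule cauchy_schwarz_Q)
    also have "... \<le> sqrt q * sqrt W" using QW q0 by (intro mult_left_mono) auto
    finally have "(d * q)^2 \<le> (sqrt q * sqrt W)^2" using d(1) q0 by (intro power_mono) auto
    then have "q * (d^2 * q) \<le> q * W" using q0 W0 by (simp add: power_mult_distrib power2_eq_square algebra_simps)
    then have "d^2 * q \<le> W" using q0 W0 by (cases "q = 0") auto
    then show ?thesis using d(1) unfolding q_def[symmetric] by (simp add: field_simps)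
  qed
  \<comment> \<open>The shift to \<open>Suc N\<close> puts index 1, where the solution has the value
    \<open>t\<close>, inside the section.\<close>
  have "bounded (range (\<lambda>N. t (Suc N)))"
  proof (rule boundedI)
    fix x assume "x \<in> range (\<lambda>N. t (Suc N))"
    then obtain N where x: "x = t (Suc N)" by auto
    have "(cmod x)^2 = (cmod (rsol z (t (Suc N)) w 1))^2" by (simp add: x)
    also have "... \<le> Q (rsol z (t (Suc N)) w) (Suc N)" unfolding Q_def by (rule member_le_sum) auto
    also have "... \<le> W / d^2" by (rule Qv)
    finally show "norm x \<le> sqrt (W / d^2)" by (rule real_le_rsqrt)
  qed
  then obtain t' r where r: "strict_mono (r::nat \<Rightarrow> nat)" "((\<lambda>N. t (Suc N)) \<circ> r) \<longlonglongrightarrow> t'"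
    using bounded_imp_convergent_subsequence by blast
  define v where "v = rsol z t' w"
  have conv: "(\<lambda>k. rsol z (t (Suc (r k))) w n) \<longlonglongrightarrow> v n" for n
    unfolding v_def rsol_affine[of z "t _" w] rsol_affine[of z t' w]
    using r(2) unfolding o_def by (intro tendsto_intros)
  have "Q v M \<le> W / d^2" for M
  proof -
    have "(\<lambda>k. Q (rsol z (t (Suc (r k))) w) M) \<longlonglongrightarrow> Q v M"
      unfolding Q_def by (intro tendsto_intros conv)
    moreover have "eventually (\<lambda>k. Q (rsol z (t (Suc (r k))) w) M \<le> W / d^2) sequentially"
      unfolding eventually_sequentially
    proof (intro exI[of _ M] allI impI)
      fix k assume "M \<le> k"
      then have "M \<le> Suc (r k)" using seq_suble[OF r(1), of k] by linarith
      then show "Q (rsol z (t (Suc (r k))) w) M \<le> W / d^2" using Q_mono Qv order_trans by blast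
    qed
    ultimately show ?thesis by (intro tendsto_upperbound[of _ "Q v M" sequentially]) auto
  qed
  then have "summable (\<lambda>n. (cmod (v n))^2)"
    unfolding Q_def by (intro bounded_imp_summable[where B="W / d^2"]) auto
  then have "v \<in> l2" by (simp add: l2_def v_def)
  moreover have "w = Jz z v" unfolding v_def using Jz_rsol[of w z t'] l2_zero[OF w] by simp
  ultimately show "\<exists>v\<in>l2. w = Jz z v" by blast
qed

end

lemma inside_spectrum:
  assumes x: "x = 2 * cos t"
  shows "\<not> bij_betw (ex.Jz (of_real x)) l2 l2"
proof
  assume bij: "bij_betw (ex.Jz (of_real x)) l2 l2"
  \<comment> \<open>The exponent lies between -1/2, the border of square summability, and -1, the
    border of summability.\<close>
  define y where "y = (\<lambda>n::nat. if n = 0 then 0 else cis (t * real n) * of_real (real n powr (-3/4)))"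
  have "summable (\<lambda>n. (cmod (y n))^2)"
  proof -
    have "summable (\<lambda>n. real n powr (-3/2))" by (simp add: summable_real_powr_iff)
    moreover have "(cmod (y n))^2 = real n powr (-3/2)" for n
      by (simp add: y_def norm_mult powr_power)
    ultimately show ?thesis by simp
  qed
  then have "y \<in> l2" by (simp add: l2_def y_def)
  then obtain v where v: "v \<in> l2" "ex.Jz (of_real x) v = y"
    using bij unfolding bij_betw_def by (metis imageE)
  have "Bseq v" using l2_tendsto_zero[OF v(1)] by (rule convergent_imp_Bseq[OF convergentI])
  then obtain B where B: "B > 0" "\<And>n. cmod (v n) \<le> B" by (auto elim!: BseqE)
  \<comment> \<open>The Wronskian of \<open>v\<close> and \<open>cis (- t * n)\<close> for weight 1:
    bounded because \<open>v\<close> is, with positive increments \<open>n powr (-3/4)\<close> along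
    an A block.\<close>
  define T where "T = (\<lambda>n::nat. cis (- t * real n) * v (Suc n) - cis (- t * real (Suc n)) * v n)"
  have T: "cmod (T n) \<le> 2 * B" for n
    unfolding T_def using norm_triangle_ineq4[of "cis (- t * real n) * v (Suc n)" "cis (- t * real (Suc n)) * v n"] B(2)[of n] B(2)[of "Suc n"]
    by (simp add: norm_mult)
  have step: "T (Suc n) - T n = of_real (real (Suc n) powr (-3/4))"
    if "ex_a n = 1" "ex_a (Suc n) = 1" for n
  proof -
    have c: "cis (- t) + cis t = of_real x" by (simp add: x complex_eq_iff)
    have e1: "cis (- t * real (Suc (Suc n))) = cis (- t * real (Suc n)) * cis (- t)"
      unfolding cis_mult by (rule arg_cong[where f=cis]) (simp add: algebra_simps)
    have e2: "cis (- t * real n) = cis (- t * real (Suc n)) * cis t"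
      unfolding cis_mult by (rule arg_cong[where f=cis]) (simp add: algebra_simps)
    have "T (Suc n) - T n = cis (- t * real (Suc n)) * (v n + v (Suc (Suc n)) - (cis (- t) + cis t) * v (Suc n))"
      unfolding T_def e1 e2 by (simp add: algebra_simps)
    also have "v n + v (Suc (Suc n)) - (cis (- t) + cis t) * v (Suc n) = ex.Jz (of_real x) v (Suc n)"
      unfolding ex.Jz_Suc[where u=v, OF l2_zero[OF v(1)]] c using that by simp
    also have "... = cis (t * real (Suc n)) * of_real (real (Suc n) powr (-3/4))"
      unfolding v(2) y_def by simp
    also have "cis (- t * real (Suc n)) * (cis (t * real (Suc n)) * of_real (real (Suc n) powr (-3/4))) = of_real (real (Suc n) powr (-3/4))"
      by (simp add: mult.assoc[symmetric] cis_mult)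
    finally show ?thesis .
  qed
  have bound: "(3::real)^(i^2) \<le> 40 * B" if "1 \<le> i" for i
  proof -
    \<comment> \<open>An even group number makes the fourth root of \<open>3^(j^2)\<close> equal to
      \<open>3^(i^2)\<close>.\<close>
    define j where "j = 2 * i"
    have j: "1 \<le> j" using that by (simp add: j_def)
    define G where "G = gs j + 1"
    \<comment> \<open>One less than the block length, because each step needs two neighbouring
      weights equal to 1.\<close>
    define M where "M = 3^(j^2) - (1::nat)"
    define P where "P = real (3^(j^2))"
    have P1: "3 \<le> P" unfolding P_def using power_increasing[of 1 "j^2" "3::real"] j by simp
    have a1: "ex_a (G + m) = 1" "ex_a (Suc (G + m)) = 1" if "m < M" for m
      using ex_a_block_A[OF j, of m] ex_a_block_A[OF j, of "Suc m"] that unfolding G_def M_def by auto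
    have "T (G + M) - T G = (\<Sum>m<M. T (Suc (G + m)) - T (G + m))"
      using sum_lessThan_telescope[of "\<lambda>m. T (G + m)" M] by simp
    also have "... = of_real (\<Sum>m<M. real (Suc (G + m)) powr (-3/4))"
      unfolding of_real_sum using a1 by (intro sum.cong refl step) auto
    finally have "cmod (T (G + M) - T G) = \<bar>\<Sum>m<M. real (Suc (G + m)) powr (-3/4)\<bar>" by (simp only: norm_of_real)
    then have "(\<Sum>m<M. real (Suc (G + m)) powr (-3/4)) \<le> cmod (T (G + M) - T G)" by linarith
    also have "... \<le> 4 * B" using norm_triangle_ineq4[of "T (G + M)" "T G"] T[of "G + M"] T[of G] by linarith
    finally have up: "(\<Sum>m<M. real (Suc (G + m)) powr (-3/4)) \<le> 4 * B" .
    have "P / 2 * (5 * P) powr (-3/4) \<le> real M * (5 * P) powr (-3/4)"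
      using P1 unfolding M_def P_def by (intro mult_right_mono) (auto simp: of_nat_diff)
    also have "... = (\<Sum>m<M. (5 * P) powr (-3/4))" by simp
    also have "... \<le> (\<Sum>m<M. real (Suc (G + m)) powr (-3/4))"
    proof (intro sum_mono powr_mono2')
      fix m assume "m \<in> {..<M}"
      then have "Suc (G + m) \<le> 5 * 3^(j^2)" using gs_le[of j] unfolding G_def M_def by auto
      then have "real (Suc (G + m)) \<le> real (5 * 3^(j^2))" unfolding of_nat_le_iff .
      then show "real (Suc (G + m)) \<le> 5 * P" unfolding P_def by simp
    qed auto
    finally have lo: "P / 2 * (5 * P) powr (-3/4) \<le> 4 * B" using up by linarith
    have "(5 * P) powr (3/4) \<le> 5 * P powr (3/4)"
    proof -
      have "(5::real) powr (3/4) \<le> 5 powr 1" by (intro powr_mono) auto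
      then show ?thesis using P1 by (simp add: powr_mult mult_right_mono)
    qed
    moreover have "P = P powr (1/4) * P powr (3/4)" using P1 by (simp add: powr_add[symmetric])
    moreover have p34: "0 < P powr (3/4)" using P1 by simp
    moreover have "P / 2 \<le> 4 * B * (5 * P) powr (3/4)"
      using lo P1 by (simp add: powr_minus field_simps)
    ultimately have "P powr (1/4) * P powr (3/4) / 2 \<le> 4 * B * (5 * P powr (3/4))"
      using B(1) mult_left_mono[of "(5 * P) powr (3/4)" "5 * P powr (3/4)" "4 * B"] by linarith
    then have "P powr (1/4) \<le> 40 * B" using p34 by (simp add: field_simps)
    moreover have "P powr (1/4) = 3^(i^2)"
    proof -
      have "P = (3^(i^2))^4" unfolding P_def j_def by (simp add: power_mult[symmetric] power_mult_distrib)
      then have "P = (3^(i^2)) powr 4" by simp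
      then show ?thesis by (simp only: powr_powr) simp
    qed
    ultimately show ?thesis by simp
  qed
  obtain i :: nat where i: "40 * B < real i" using reals_Archimedean2 by blast
  have "real i \<le> real (3^(i^2))" using le_3_pow_sq[of i] unfolding of_nat_le_iff .
  then have "real i \<le> 3^(i^2)" by simp
  moreover have "1 \<le> i" using i B(1) by (cases i) auto
  ultimately show False using bound[of i] i by linarith
qed

theorem spectrum_eq: "jacobi_spectrum ex_a ex_b = complex_of_real ` {-2..2}"
proof (intro equalityI subsetI)
  fix z assume "z \<in> jacobi_spectrum ex_a ex_b"
  then have nb: "\<not> bij_betw (ex.Jz z) l2 l2" unfolding jacobi_spectrum_def ex.Jz_def[abs_def] by simp
  show "z \<in> complex_of_real ` {-2..2}"
  proof (rule ccontr)
    assume nz: "z \<notin> complex_of_real ` {-2..2}"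
    have "closed (complex_of_real ` {-2..2})"
      by (intro compact_imp_closed compact_continuous_image continuous_intros) auto
    then obtain d where d: "0 < d" "\<forall>y\<in>complex_of_real ` {-2..2}. d \<le> dist z y"
      using separate_point_closed[OF _ nz] by blast
    have "bij_betw (ex.Jz z) l2 l2"
      by (rule ex.outside_spectrum[OF d(1)]) (use d(2) in \<open>auto simp: dist_norm norm_minus_commute\<close>)
    then show False using nb by simp
  qed
next
  fix z assume "z \<in> complex_of_real ` {-2..2}"
  then obtain x where x: "z = of_real x" "-2 \<le> x" "x \<le> 2" by auto
  have "x = 2 * cos (arccos (x / 2))" using x by (simp add: cos_arccos)
  then have "\<not> bij_betw (ex.Jz z) l2 l2" unfolding x(1) by (rule inside_spectrum)
  then show "z \<in> jacobi_spectrum ex_a ex_b" unfolding jacobi_spectrum_def ex.Jz_def[abs_def] by simp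
qed


section \<open>Absolute continuity and the Nevai condition at elliptic energies\<close>

text \<open>\<open>S\<close> is covered by closed intervals with disjoint interiors inside an open
  set of length at most \<open>\<epsilon>\<close>. Their lengths add up, and for
  \<open>\<rho>\<close> subadditivity suffices, so shared endpoints do no harm.\<close>

lemma null_of_interval_bound:
  fixes \<rho> :: "real measure"
  assumes "finite_measure \<rho>" and sets: "sets \<rho> = sets borel" and M: "0 < M" and c: "0 < c"
    and bnd: "\<And>l r. -c \<le> l \<Longrightarrow> l < r \<Longrightarrow> r \<le> c \<Longrightarrow> measure \<rho> {l..r} \<le> M * (r - l)"
    and S: "S \<in> sets borel" "S \<subseteq> {-c..c}" "emeasure lborel S = 0"
  shows "emeasure \<rho> S = 0"
proof -
  interpret finite_measure \<rho> by fact
  have small: "measure \<rho> S \<le> M * \<epsilon>" if \<epsilon>: "0 < \<epsilon>" for \<epsilon>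
  proof -
    obtain U where U: "open U" "S \<subseteq> U" "emeasure lborel (U - S) \<le> \<epsilon>"
      using outer_regular_lborel_le[OF S(1) \<epsilon>] by blast
    have "emeasure lborel U \<le> emeasure lborel ((U - S) \<union> S)"
      using U S by (intro emeasure_mono) auto
    also have "... \<le> emeasure lborel (U - S) + emeasure lborel S"
      using U S by (intro emeasure_subadditive) auto
    finally have eU: "emeasure lborel U \<le> \<epsilon>" using U S by simp
    \<comment> \<open>Each covering interval lies in \<open>g x\<close> for some \<open>x\<close> in
      \<open>S\<close>, hence in \<open>U\<close>.\<close>
    define g where "g = (\<lambda>x. if x \<in> U then U else UNIV)"
    have g: "gauge g" unfolding gauge_def g_def using U(1) by auto
    obtain \<D> where D: "countable \<D>" "\<Union>\<D> \<subseteq> cbox (-c) c"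
      "\<And>K. K \<in> \<D> \<Longrightarrow> interior K \<noteq> {} \<and> (\<exists>l r. K = cbox l r)"
      "pairwise (\<lambda>A B. interior A \<inter> interior B = {}) \<D>"
      "\<And>K. K \<in> \<D> \<Longrightarrow> \<exists>x\<in>S \<inter> K. K \<subseteq> g x" "S \<subseteq> \<Union>\<D>"
      by (rule covering_lemma[of S "-c" c g]) (use S c g in \<open>auto simp: cbox_interval box_real\<close>)
    have K: "K \<subseteq> U" "K \<in> sets \<rho>" "measure \<rho> K \<le> M * measure lborel (interior K)" "emeasure lborel (interior K) \<noteq> \<infinity>"
      if K0: "K \<in> \<D>" for K
    proof -
      obtain l r where lr: "K = {l..r}" using D(3)[OF K0] by (auto simp: cbox_interval)
      have "interior K = {l<..<r}" unfolding lr by simp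
      then have "l < r" using D(3)[OF K0] by auto
      show "K \<subseteq> U" using D(5)[OF K0] U(2) unfolding g_def by fastforce
      show "K \<in> sets \<rho>" unfolding sets lr by simp
      have "K \<subseteq> {-c..c}" using D(2) K0 by (auto simp: cbox_interval)
      then have "-c \<le> l" "r \<le> c" using \<open>l < r\<close> unfolding lr by auto
      then show "measure \<rho> K \<le> M * measure lborel (interior K)"
        using bnd[of l r] \<open>l < r\<close> \<open>interior K = {l<..<r}\<close> unfolding lr by simp
      show "emeasure lborel (interior K) \<noteq> \<infinity>" unfolding \<open>interior K = {l<..<r}\<close> using \<open>l < r\<close> by simp
    qed
    have "measure \<rho> (\<Union>\<D>) \<le> M * \<epsilon>"
    proof (rule measure_Union_bound[OF D(1)])
      fix K assume "K \<in> \<D>" then show "K \<in> fmeasurable \<rho>" using K(2) by (simp add: fmeasurable_eq_sets)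
    next
      fix \<C> assume C: "\<C> \<subseteq> \<D>" "finite \<C>"
      have "measure \<rho> (\<Union>\<C>) \<le> (\<Sum>K\<in>\<C>. measure \<rho> K)"
        using C K(2) by (intro measure_Union_le) auto
      also have "... \<le> (\<Sum>K\<in>\<C>. M * measure lborel (interior K))"
        using C K(3) by (intro sum_mono) auto
      also have "... = M * (\<Sum>K\<in>\<C>. measure lborel (interior K))" by (simp add: sum_distrib_left)
      also have "(\<Sum>K\<in>\<C>. measure lborel (interior K)) = measure lborel (\<Union>K\<in>\<C>. interior K)"
      proof (rule measure_finite_Union[symmetric])
        show "disjoint_family_on interior \<C>" unfolding disjoint_family_on_def
          using D(4) C(1) unfolding pairwise_def by (metis subsetD)
      qed (use C K(4) in auto)
      also have "... \<le> \<epsilon>"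
      proof -
        have "emeasure lborel (\<Union>K\<in>\<C>. interior K) \<le> emeasure lborel U"
          using C K(1) U(1) interior_subset by (intro emeasure_mono) fastforce+
        then have "emeasure lborel (\<Union>K\<in>\<C>. interior K) \<le> ennreal \<epsilon>" using eU by (rule order_trans)
        then show ?thesis using \<epsilon> by (simp add: measure_def enn2real_leI)
      qed
      finally show "measure \<rho> (\<Union>\<C>) \<le> M * \<epsilon>" using M by simp
    qed
    moreover have "measure \<rho> S \<le> measure \<rho> (\<Union>\<D>)"
      using D(1,6) K(2) by (intro finite_measure_mono) auto
    ultimately show ?thesis by linarith
  qed
  have "measure \<rho> S \<le> 0"
  proof (rule field_le_epsilon)
    fix e :: real assume "0 < e"
    then show "measure \<rho> S \<le> 0 + e" using small[of "e / M"] M by simp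
  qed
  then show ?thesis by (simp add: emeasure_eq_measure measure_le_0_iff)
qed

section \<open>Second solution, kernel bounds and masses of intervals\<close>

context jacobi_seq
begin

text \<open>The solution of the second kind, normalised so that its weighted Wronskian with
  \<open>p\<close> is 1.\<close>

fun qsol :: "nat \<Rightarrow> real \<Rightarrow> real" where
  "qsol 0 x = 0"
| "qsol (Suc 0) x = 1 / A 0"
| "qsol (Suc (Suc n)) x = (x * qsol (Suc n) x - A n * qsol n x) / A (Suc n)"

lemma sol_qsol: "sol x (\<lambda>n. qsol n x)"
  unfolding sol_def using A_nz by simp

lemma wronskian: "A n * (qsol (Suc n) x * p n x - p (Suc n) x * qsol n x) = 1"
proof (induction n)
  case 0 then show ?case using A_nz[of 0] by simp
next
  case (Suc n)
  have "A (Suc n) * (qsol (Suc (Suc n)) x * p (Suc n) x - p (Suc (Suc n)) x * qsol (Suc n) x)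
     = (A (Suc n) * qsol (Suc (Suc n)) x) * p (Suc n) x - (A (Suc n) * p (Suc (Suc n)) x) * qsol (Suc n) x"
    by (simp only: algebra_simps)
  also have "... = A n * (qsol (Suc n) x * p n x - p (Suc n) x * qsol n x)"
    unfolding p_rec solD[OF sol_qsol] by (simp only: algebra_simps)
  finally show ?case unfolding Suc .
qed

text \<open>Variation of constants: \<open>p\<close> at \<open>y\<close> solves the equation at
  \<open>x\<close> with source \<open>(y - x) * p k y\<close>. The bracket is the discrete Green
  function and vanishes on the diagonal.\<close>

lemma p_variation:
  "p n y - p n x = (y - x) * (\<Sum>k<n. (qsol n x * p k x - p n x * qsol k x) * p k y)"
proof (induction n rule: induct_nat_012)
  case 0 then show ?case by simp
next
  case 1
  have "A 0 * (p (Suc 0) y - p (Suc 0) x) = A 0 * ((y - x) * (\<Sum>k<Suc 0. (qsol (Suc 0) x * p k x - p (Suc 0) x * qsol k x) * p k y))"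
    unfolding right_diff_distrib[of "A 0"] p_one using A_nz[of 0] by simp
  then show ?case unfolding mult_cancel_left using A_nz[of 0] by blast
next
  case (ge2 n)
  define g where "g = (\<lambda>n k. qsol n x * p k x - p n x * qsol k x)"
  define S where "S = (\<lambda>n. \<Sum>k<n. g n k * p k y)"
  have grec: "A (Suc n) * g (Suc (Suc n)) k = x * g (Suc n) k - A n * g n k" for k
  proof -
    have "A (Suc n) * g (Suc (Suc n)) k = (A (Suc n) * qsol (Suc (Suc n)) x) * p k x - (A (Suc n) * p (Suc (Suc n)) x) * qsol k x"
      unfolding g_def by (simp only: algebra_simps)
    then show ?thesis unfolding p_rec solD[OF sol_qsol] g_def by (simp add: algebra_simps)
  qed
  have gd: "g m m = 0" for m by (simp add: g_def)
  have gw: "A n * g n (Suc n) = -1" using wronskian[of n x] unfolding g_def by (simp add: algebra_simps)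
  have "A (Suc n) * S (Suc (Suc n)) = (\<Sum>k<Suc (Suc n). (A (Suc n) * g (Suc (Suc n)) k) * p k y)"
    unfolding S_def by (simp only: sum_distrib_left mult.assoc)
  also have "... = x * (\<Sum>k<Suc (Suc n). g (Suc n) k * p k y) - A n * (\<Sum>k<Suc (Suc n). g n k * p k y)"
    unfolding grec by (simp only: sum_distrib_left sum_subtractf[symmetric] left_diff_distrib mult.assoc)
  also have "(\<Sum>k<Suc (Suc n). g (Suc n) k * p k y) = S (Suc n)" unfolding S_def by (simp add: gd)
  also have "(\<Sum>k<Suc (Suc n). g n k * p k y) = S n + g n (Suc n) * p (Suc n) y" unfolding S_def by (simp add: gd)
  also have "x * S (Suc n) - A n * (S n + g n (Suc n) * p (Suc n) y)
      = x * S (Suc n) - A n * S n - (A n * g n (Suc n)) * p (Suc n) y" by (simp only: algebra_simps)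
  finally have S: "A (Suc n) * S (Suc (Suc n)) = x * S (Suc n) - A n * S n + p (Suc n) y" unfolding gw by simp
  have i1: "p n y - p n x = (y - x) * S n" and i2: "p (Suc n) y - p (Suc n) x = (y - x) * S (Suc n)"
    using ge2 unfolding S_def g_def .
  have "A (Suc n) * (p (Suc (Suc n)) y - p (Suc (Suc n)) x) = y * p (Suc n) y - A n * p n y - (x * p (Suc n) x - A n * p n x)"
    unfolding right_diff_distrib[of "A (Suc n)"] p_rec ..
  also have "... = (y - x) * p (Suc n) y + x * (p (Suc n) y - p (Suc n) x) - A n * (p n y - p n x)" by (simp only: algebra_simps)
  also have "... = (y - x) * (A (Suc n) * S (Suc (Suc n)))"
    unfolding S i1 i2 by (simp only: algebra_simps)
  finally have "A (Suc n) * (p (Suc (Suc n)) y - p (Suc (Suc n)) x) = A (Suc n) * ((y - x) * S (Suc (Suc n)))"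
    by (simp only: mult.left_commute)
  then show ?case using A_nz[of "Suc n"] unfolding S_def g_def by simp
qed

text \<open>Both solutions start with amplitude at most 5, and \<open>p\<close> with at least 1.
  Comparability keeps the amplitude of \<open>p\<close> away from 0, and summation gives the linear
  growth of \<open>K\<close>.\<close>

lemma inside_bounds:
  assumes "summable defect" "0 < \<kappa>"
  shows "\<exists>B\<ge>1. \<forall>x n. x^2 \<le> 1 - 4 * \<kappa> \<longrightarrow> \<bar>p n x\<bar> \<le> B \<and> \<bar>qsol n x\<bar> \<le> B \<and> real n + 1 \<le> B * K n x x"
proof -
  obtain C where C: "C > 0" "\<And>x u m n. x^2 \<le> 1 - 4 * \<kappa> \<Longrightarrow> sol x u \<Longrightarrow> amp u n \<le> C * amp u m"
    using amp_comparable[OF assms] by blast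
  define B where "B = 5 * C + 1"
  have sq: "\<bar>y\<bar> \<le> B" if "y^2 \<le> 5 * C" for y
  proof -
    have "B * 1 \<le> B * B" using C(1) by (intro mult_left_mono) (auto simp: B_def)
    then have "y^2 \<le> B^2" using that by (simp add: power2_eq_square B_def)
    then show ?thesis using abs_le_square_iff[of y B] C(1) by (simp add: B_def)
  qed
  have A0: "1 / A 0 \<le> 2" "0 < 1 / A 0" using A_ge[of 0] A_pos[of 0] by (auto simp: divide_le_eq)
  have A0sq: "(1 / A 0)^2 \<le> 4" using power_mono[OF A0(1), of 2] A0(2) by simp
  have "\<bar>p n x\<bar> \<le> B \<and> \<bar>qsol n x\<bar> \<le> B \<and> real n + 1 \<le> B * K n x x" if x: "x^2 \<le> 1 - 4 * \<kappa>" for x n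
  proof (intro conjI)
    have p1: "p (Suc 0) x = x * (1 / A 0)" using p_one[of x] A_nz[of 0] by (simp add: field_simps)
    have "(p (Suc 0) x)^2 \<le> 1 * 4" unfolding p1 power_mult_distrib using x assms(2) A0sq by (intro mult_mono) auto
    then have a0: "amp (\<lambda>n. p n x) 0 \<le> 5" "1 \<le> amp (\<lambda>n. p n x) 0" by (auto simp: amp_def)
    have u: "amp (\<lambda>n. p n x) n \<le> C * 5" for n using C(2)[OF x sol_p, of n 0] mult_left_mono[OF a0(1), of C] C(1) by linarith
    have l: "1 \<le> C * amp (\<lambda>n. p n x) n" for n using C(2)[OF x sol_p, of 0 n] a0 by linarith
    show "\<bar>p n x\<bar> \<le> B" using u[of n] zero_le_power2[of "p (Suc n) x"] unfolding amp_def by (intro sq) linarith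
    have a1: "amp (\<lambda>n. qsol n x) 0 \<le> 5" using A0sq by (simp add: amp_def)
    then have "amp (\<lambda>n. qsol n x) n \<le> C * 5" using C(2)[OF x sol_qsol, of n 0] mult_left_mono[OF a1, of C] C(1) by linarith
    then show "\<bar>qsol n x\<bar> \<le> B" using zero_le_power2[of "qsol (Suc n) x"] unfolding amp_def by (intro sq) linarith
    \<comment> \<open>Each \<open>(p k x)^2\<close> occurs in at most two of these
      amplitudes.\<close>
    have s: "(\<Sum>k<n. amp (\<lambda>n. p n x) k) \<le> 2 * K n x x"
    proof -
      have "(\<Sum>k<n. (p k x)^2) \<le> K n x x" unfolding CD_kernel_def power2_eq_square by (intro sum_mono2) auto
      moreover have "(\<Sum>k<n. (p (Suc k) x)^2) \<le> K n x x"
      proof -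
        have "K n x x = (\<Sum>k<Suc n. (p k x)^2)" unfolding CD_kernel_def power2_eq_square lessThan_Suc_atMost ..
        also have "... = (p 0 x)^2 + (\<Sum>k<n. (p (Suc k) x)^2)" by (rule sum.lessThan_Suc_shift)
        finally show ?thesis by simp
      qed
      ultimately show ?thesis unfolding amp_def sum.distrib by linarith
    qed
    have "real n = (\<Sum>k<n. 1)" by simp
    also have "... \<le> (\<Sum>k<n. C * amp (\<lambda>n. p n x) k)" by (intro sum_mono l)
    also have "... = C * (\<Sum>k<n. amp (\<lambda>n. p n x) k)" by (simp add: sum_distrib_left)
    also have "... \<le> C * (2 * K n x x)" using s C(1) by (intro mult_left_mono) auto
    finally have "real n + 1 \<le> C * (2 * K n x x) + K n x x" using K_ge_1[of n x] by linarith
    also have "... \<le> B * K n x x" using C(1) K_pos[of n x] by (simp add: B_def algebra_simps)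
    finally show "real n + 1 \<le> B * K n x x" .
  qed
  moreover have "B \<ge> 1" using C(1) by (simp add: B_def)
  ultimately show ?thesis by blast
qed

text \<open>Of the factors in \<open>B^5\<close>, three come from \<open>p_variation\<close>, one
  from \<open>p k x\<close> and one from the lower bound on \<open>K\<close>.\<close>

lemma K_offdiag_lower:
  assumes B: "1 \<le> B" and bx: "\<And>k. \<bar>p k x\<bar> \<le> B" "\<And>k. \<bar>qsol k x\<bar> \<le> B" "real n + 1 \<le> B * K n x x"
    and B_y: "\<And>k. \<bar>p k y\<bar> \<le> B" and xy: "\<bar>y - x\<bar> * (4 * B^5 * (real n + 1)) \<le> 1"
  shows "K n x x / 2 \<le> K n y x"
proof -
  have d: "\<bar>p k y - p k x\<bar> \<le> \<bar>y - x\<bar> * ((real n + 1) * (2 * B^3))" if "k \<le> n" for k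
  proof -
    have "\<bar>\<Sum>i<k. (qsol k x * p i x - p k x * qsol i x) * p i y\<bar> \<le> (\<Sum>i<k. 2 * B^3)"
    proof (rule order_trans[OF sum_abs], rule sum_mono)
      fix i
      have "\<bar>qsol k x * p i x - p k x * qsol i x\<bar> \<le> \<bar>qsol k x\<bar> * \<bar>p i x\<bar> + \<bar>p k x\<bar> * \<bar>qsol i x\<bar>"
        unfolding abs_mult[symmetric] by linarith
      also have "... \<le> B * B + B * B" using bx B by (intro add_mono mult_mono) auto
      finally have "\<bar>(qsol k x * p i x - p k x * qsol i x) * p i y\<bar> \<le> (B * B + B * B) * B"
        unfolding abs_mult using B_y B by (intro mult_mono) auto
      then show "\<bar>(qsol k x * p i x - p k x * qsol i x) * p i y\<bar> \<le> 2 * B^3" by (simp add: power3_eq_cube algebra_simps)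
    qed
    also have "... \<le> (real n + 1) * (2 * B^3)" using that B by (simp add: mult_right_mono)
    finally show ?thesis unfolding p_variation abs_mult by (intro mult_left_mono) auto
  qed
  have "K n x x - K n y x = (\<Sum>k\<le>n. (p k x - p k y) * p k x)"
    unfolding CD_kernel_def by (simp add: sum_subtractf[symmetric] algebra_simps)
  also have "... \<le> (\<Sum>k\<le>n. \<bar>y - x\<bar> * ((real n + 1) * (2 * B^3)) * B)"
  proof (rule sum_mono)
    fix k assume "k \<in> {..n}"
    then have "\<bar>(p k x - p k y) * p k x\<bar> \<le> (\<bar>y - x\<bar> * ((real n + 1) * (2 * B^3))) * B"
      unfolding abs_mult using d[of k] bx(1)[of k] B by (intro mult_mono) (auto simp: abs_minus_commute)
    then show "(p k x - p k y) * p k x \<le> \<bar>y - x\<bar> * ((real n + 1) * (2 * B^3)) * B" by linarith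
  qed
  also have "... = (\<bar>y - x\<bar> * (4 * B^5 * (real n + 1))) * ((real n + 1) / (2 * B))"
    using B by (simp add: field_simps power_numeral_reduce)
  also have "... \<le> 1 * ((real n + 1) / (2 * B))" using xy B by (intro mult_right_mono) auto
  also have "... \<le> K n x x / 2" using bx(3) B by (simp add: field_simps)
  finally show ?thesis by linarith
qed

end

context jacobi_measure
begin

lemma prob: "measure \<rho> UNIV = 1"
  using moment[of 0] by simp

text \<open>On an interval of length about 1/n the kernel based at the left endpoint is at least
  half its diagonal value, while its squared norm equals that value. So the mass is at most
  \<open>4 / K n l l\<close>, of order 1/n.\<close>

lemma interval_measure_bound:
  assumes "summable defect" "0 < \<kappa>"
  shows "\<exists>M>0. \<forall>l r. l < r \<longrightarrow> (\<forall>y\<in>{l..r}. y^2 \<le> 1 - 4 * \<kappa>) \<longrightarrow> measure \<rho> {l..r} \<le> M * (r - l)"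
proof -
  obtain B where B: "1 \<le> B" "\<And>x n. x^2 \<le> 1 - 4 * \<kappa> \<Longrightarrow> \<bar>p n x\<bar> \<le> B"
    "\<And>x n. x^2 \<le> 1 - 4 * \<kappa> \<Longrightarrow> \<bar>qsol n x\<bar> \<le> B" "\<And>x n. x^2 \<le> 1 - 4 * \<kappa> \<Longrightarrow> real n + 1 \<le> B * K n x x"
    using inside_bounds[OF assms] by blast
  define D where "D = 4 * B^5"
  have D4: "4 \<le> D" unfolding D_def using B(1) by simp
  have "measure \<rho> {l..r} \<le> (8 * B * D) * (r - l)" if lr: "l < r" and I: "\<forall>y\<in>{l..r}. y^2 \<le> 1 - 4 * \<kappa>" for l r
  proof (cases "D * (r - l) \<le> 1")
    case False
    have "measure \<rho> {l..r} \<le> measure \<rho> UNIV" by (intro finite_measure_mono) auto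
    also have "... \<le> 1 * (D * (r - l))" using False prob by simp
    also have "... \<le> (8 * B) * (D * (r - l))" using B(1) D4 lr by (intro mult_right_mono) auto
    finally show ?thesis by simp
  next
    case True
    \<comment> \<open>\<open>n + 1\<close> will be the integer part of \<open>y\<close>, the largest
      value meeting the smallness condition of \<open>K_offdiag_lower\<close> on the whole
      interval.\<close>
    define y where "y = 1 / (D * (r - l))"
    have y1: "1 \<le> y" using True lr D4 by (simp add: y_def)
    define n where "n = nat \<lfloor>y\<rfloor> - 1"
    have n: "real n + 1 \<le> y" "y < real n + 2" unfolding n_def using y1 by linarith+
    have l: "l^2 \<le> 1 - 4 * \<kappa>" using I lr by simp
    have low: "K n l l / 2 \<le> K n z l" if z: "z \<in> {l..r}" for z
    proof (rule K_offdiag_lower[OF B(1)])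
      have "\<bar>z - l\<bar> * (D * (real n + 1)) \<le> (r - l) * (D * y)"
        using z n D4 lr by (intro mult_mono) auto
      also have "... = 1" using lr D4 by (simp add: y_def)
      finally show "\<bar>z - l\<bar> * (4 * B^5 * (real n + 1)) \<le> 1" by (simp add: D_def)
    qed (use B l I z in auto)
    have Kp: "0 < K n l l" by (rule K_pos)
    have "measure \<rho> {l..r} * (K n l l / 2)^2 = (\<integral>z. indicator {l..r} z * (K n l l / 2)^2 \<partial>\<rho>)" by simp
    also have "... \<le> (\<integral>z. (K n z l)^2 \<partial>\<rho>)"
    proof (intro integral_mono integrable_K_sq)
      show "integrable \<rho> (\<lambda>z. indicator {l..r} z * (K n l l / 2)^2)"
        by (intro integrable_mult_left integrable_real_indicator) (auto simp: less_top[symmetric])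
      fix z
      show "indicator {l..r} z * (K n l l / 2)^2 \<le> (K n z l)^2"
        using low[of z] Kp by (auto simp: indicator_def intro!: power_mono)
    qed
    also have "... = K n l l" by (rule integral_K_sq)
    finally have "measure \<rho> {l..r} * K n l l \<le> 4" using Kp by (simp add: power2_eq_square)
    then have m: "measure \<rho> {l..r} \<le> 4 / K n l l" using Kp by (simp add: field_simps)
    have "y \<le> 2 * (real n + 1)" using n of_nat_0_le_iff[of n] unfolding distrib_left by linarith
    also have "... \<le> 2 * (B * K n l l)" using B(4)[OF l, of n] by simp
    finally have "4 * y \<le> 8 * B * K n l l" by simp
    then have "4 / K n l l \<le> 8 * B / y" using Kp y1 by (simp add: field_simps)
    also have "... = (8 * B * D) * (r - l)" by (simp add: y_def)
    finally show ?thesis using m by linarith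
  qed
  moreover have "8 * B * D > 0" using B(1) D4 by simp
  ultimately show ?thesis by blast
qed

text \<open>The constant of the interval bound depends on the distance to the endpoints 1 and -1;
  for null sets a countable exhaustion by compact intervals is enough.\<close>

theorem absolutely_continuous_inside:
  assumes sd: "summable defect" and S: "S \<in> sets borel" "S \<subseteq> {-1<..<1}" "emeasure lborel S = 0"
  shows "emeasure \<rho> S = 0"
proof -
  define c where "c = (\<lambda>k::nat. 1 - 1 / (real k + 2))"
  have c: "0 < c k" "c k < 1" for k by (simp_all add: c_def)
  have z: "emeasure \<rho> (S \<inter> {- c k..c k}) = 0" for k
  proof -
    define \<kappa> where "\<kappa> = (1 - (c k)^2) / 4"
    have "(c k)^2 < 1" using c[of k] by (simp add: power_less_one_iff abs_square_less_1)
    then have "0 < \<kappa>" by (simp add: \<kappa>_def)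
    then obtain M where M: "0 < M" "\<And>l r. l < r \<Longrightarrow> (\<forall>y\<in>{l..r}. y^2 \<le> 1 - 4 * \<kappa>) \<Longrightarrow> measure \<rho> {l..r} \<le> M * (r - l)"
      using interval_measure_bound[OF sd] by blast
    show ?thesis
    proof (rule null_of_interval_bound[of \<rho> M "c k"])
      show "emeasure lborel (S \<inter> {- c k..c k}) = 0"
        using emeasure_mono[of "S \<inter> {- c k..c k}" S lborel] S by simp
      fix l r assume lr: "- c k \<le> l" "l < r" "r \<le> c k"
      have "y^2 \<le> 1 - 4 * \<kappa>" if "y \<in> {l..r}" for y
      proof -
        have "\<bar>y\<bar> \<le> \<bar>c k\<bar>" using that lr by auto
        then have "y^2 \<le> (c k)^2" by (simp only: abs_le_square_iff)
        moreover have "4 * \<kappa> = 1 - (c k)^2" by (simp add: \<kappa>_def)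
        ultimately show ?thesis by linarith
      qed
      then show "measure \<rho> {l..r} \<le> M * (r - l)" using M(2) lr(2) by blast
    qed (use S c M finite_measure_axioms in auto)
  qed
  have "S \<subseteq> (\<Union>k. S \<inter> {- c k..c k})"
  proof
    fix x assume x: "x \<in> S"
    then have "x \<in> {-1<..<1}" using S(2) by blast
    then have "\<bar>x\<bar> < 1" by auto
    then obtain k where k: "1 / (1 - \<bar>x\<bar>) < real k" using reals_Archimedean2 by blast
    then have "1 / (real k + 2) \<le> 1 - \<bar>x\<bar>" using \<open>\<bar>x\<bar> < 1\<close> by (simp add: field_simps)
    then have "- c k \<le> x \<and> x \<le> c k" unfolding c_def by linarith
    then show "x \<in> (\<Union>k. S \<inter> {- c k..c k})" using x by auto
  qed
  then have "emeasure \<rho> S \<le> emeasure \<rho> (\<Union>k. S \<inter> {- c k..c k})" using S by (intro emeasure_mono) auto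
  also have "... = 0" using z S by (intro emeasure_UN_eq_0) auto
  finally show ?thesis by simp
qed

end

lemma compact_inside:
  fixes C :: "real set"
  assumes "compact C" "C \<subseteq> {-1<..<1}"
  obtains \<kappa> where "0 < \<kappa>" "\<And>x. x \<in> C \<Longrightarrow> x^2 \<le> 1 - 4 * \<kappa>"
proof (cases "C = {}")
  case True then show ?thesis using that[of 1] by simp
next
  case False
  then obtain m where m: "m \<in> C" "\<And>x. x \<in> C \<Longrightarrow> x^2 \<le> m^2"
    using continuous_attains_sup[OF assms(1) False, of "\<lambda>x. x^2"] continuous_on_power[OF continuous_on_id, of C 2] by auto
  have "m \<in> {-1<..<1}" using m(1) assms(2) by blast
  then have "m^2 < 1" by (auto simp: abs_square_less_1)
  have e: "1 - 4 * ((1 - m^2) / 4) = m^2" by (simp add: field_simps)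
  show ?thesis
  proof (rule that)
    show "0 < (1 - m^2) / 4" using \<open>m^2 < 1\<close> by simp
    show "x^2 \<le> 1 - 4 * ((1 - m^2) / 4)" if "x \<in> C" for x unfolding e using m(2)[OF that] .
  qed
qed

section \<open>The ratio condition and its relation to the Nevai condition\<close>

context jacobi_measure
begin

theorem ratio_uniform:
  assumes sd: "summable defect" and C: "compact C" "C \<subseteq> {-1<..<1}" and \<epsilon>: "0 < \<epsilon>"
  shows "eventually (\<lambda>n. \<forall>x\<in>C. (p n x)^2 / K n x x < \<epsilon>) sequentially"
proof -
  obtain \<kappa> where k: "0 < \<kappa>" "\<And>x. x \<in> C \<Longrightarrow> x^2 \<le> 1 - 4 * \<kappa>" using compact_inside[OF C] by blast
  obtain B where B: "1 \<le> B" "\<And>x n. x^2 \<le> 1 - 4 * \<kappa> \<Longrightarrow> \<bar>p n x\<bar> \<le> B"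
    "\<And>x n. x^2 \<le> 1 - 4 * \<kappa> \<Longrightarrow> real n + 1 \<le> B * K n x x"
    using inside_bounds[OF sd k(1)] by blast
  obtain N :: nat where N: "B^3 / \<epsilon> < real N" using reals_Archimedean2 by blast
  show ?thesis unfolding eventually_sequentially
  proof (intro exI[of _ N] allI impI ballI)
    fix n x assume n: "N \<le> n" and "x \<in> C"
    then have x: "x^2 \<le> 1 - 4 * \<kappa>" using k by blast
    have "B^3 < \<epsilon> * real N" using N \<epsilon> by (simp add: field_simps)
    also have "... \<le> \<epsilon> * (real n + 1)" using n \<epsilon> by (intro mult_left_mono) auto
    also have "... \<le> \<epsilon> * (B * K n x x)" using B(3)[OF x, of n] \<epsilon> by (intro mult_left_mono) auto
    finally have "B * B^2 < B * (\<epsilon> * K n x x)" by (simp add: power3_eq_cube power2_eq_square mult.left_commute)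
    then have "B^2 < \<epsilon> * K n x x" using B(1) by simp
    moreover have "(p n x)^2 \<le> B^2" using B(2)[OF x, of n] by (metis abs_ge_zero power2_abs power_mono)
    ultimately show "(p n x)^2 / K n x x < \<epsilon>" using K_pos[of n x] by (simp add: divide_less_eq)
  qed
qed

lemma K_measurable [measurable]: "(\<lambda>x. K n x y) \<in> borel_measurable borel"
  unfolding CD_kernel_def by measurable

text \<open>\<open>f x - f y\<close> is at most \<open>e\<close> near \<open>y\<close> and at most
  \<open>2 * M * (x - y)^2 / \<eta>^2\<close> elsewhere, and \<open>integral_K_var\<close>
  integrates the latter exactly. Only polynomial values at \<open>y\<close> remain, so uniform
  control of these yields a uniform Nevai condition.\<close>

lemma nevai_chebyshev:
  assumes f: "continuous_on UNIV f" "\<And>x. \<bar>f x\<bar> \<le> M" and \<eta>: "0 < \<eta>" "\<And>x. \<bar>x - y\<bar> < \<eta> \<Longrightarrow> \<bar>f x - f y\<bar> \<le> e"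
  shows "\<bar>(\<integral>x. f x * (K n x y)^2 \<partial>\<rho>) / K n y y - f y\<bar>
     \<le> e + 2 * M / \<eta>^2 * ((p n y)^2 + (p (Suc n) y)^2) / K n y y"
proof -
  have Kp: "0 < K n y y" by (rule K_pos)
  have fm[measurable]: "f \<in> borel_measurable borel" using f(1) by (rule borel_measurable_continuous_onI)
  have M0: "0 \<le> M" using f(2)[of 0] by linarith
  have e0: "0 \<le> e" using \<eta>(2)[of y] \<eta>(1) by simp
  have pt: "\<bar>f x - f y\<bar> \<le> e + 2 * M / \<eta>^2 * (x - y)^2" for x
  proof (cases "\<bar>x - y\<bar> < \<eta>")
    case True
    then show ?thesis using \<eta> M0 by (intro add_increasing2) auto
  next
    case False
    then have "\<eta>^2 \<le> (x - y)^2" using \<eta>(1) abs_le_square_iff[of \<eta> "x - y"] by simp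
    then have "1 \<le> (x - y)^2 / \<eta>^2" using \<eta>(1) by simp
    then have "2 * M * 1 \<le> 2 * M * ((x - y)^2 / \<eta>^2)" using M0 by (intro mult_left_mono) auto
    moreover have "\<bar>f x - f y\<bar> \<le> 2 * M" using f(2)[of x] f(2)[of y] by linarith
    ultimately show ?thesis using e0 by simp
  qed
  have i1: "integrable \<rho> (\<lambda>x. f x * (K n x y)^2)"
  proof (rule Bochner_Integration.integrable_bound)
    show "integrable \<rho> (\<lambda>x. M * (K n x y)^2)" by (intro integrable_mult_right integrable_K_sq)
    show "AE x in \<rho>. norm (f x * (K n x y)^2) \<le> norm (M * (K n x y)^2)"
      using f(2) M0 by (auto simp: abs_mult intro!: mult_right_mono)
  qed measurable
  have i2: "integrable \<rho> (\<lambda>x. (f x - f y) * (K n x y)^2)"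
    unfolding left_diff_distrib by (intro Bochner_Integration.integrable_diff i1 integrable_mult_right integrable_K_sq)
  have "(\<integral>x. (f x - f y) * (K n x y)^2 \<partial>\<rho>) = (\<integral>x. f x * (K n x y)^2 \<partial>\<rho>) - f y * K n y y"
    unfolding left_diff_distrib using i1 integrable_K_sq integral_K_sq by simp
  then have "(\<integral>x. f x * (K n x y)^2 \<partial>\<rho>) / K n y y - f y = (\<integral>x. (f x - f y) * (K n x y)^2 \<partial>\<rho>) / K n y y"
    using Kp by (simp add: field_simps)
  then have "\<bar>(\<integral>x. f x * (K n x y)^2 \<partial>\<rho>) / K n y y - f y\<bar> = \<bar>\<integral>x. (f x - f y) * (K n x y)^2 \<partial>\<rho>\<bar> / K n y y"
    using Kp by simp
  also have "... \<le> (e * K n y y + 2 * M / \<eta>^2 * ((A n)^2 * ((p n y)^2 + (p (Suc n) y)^2))) / K n y y"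
  proof (intro divide_right_mono)
    have "\<bar>\<integral>x. (f x - f y) * (K n x y)^2 \<partial>\<rho>\<bar> \<le> (\<integral>x. \<bar>(f x - f y) * (K n x y)^2\<bar> \<partial>\<rho>)"
      by (rule integral_abs_bound)
    also have "... \<le> (\<integral>x. e * (K n x y)^2 + 2 * M / \<eta>^2 * ((x - y)^2 * (K n x y)^2) \<partial>\<rho>)"
    proof (intro integral_mono)
      show "integrable \<rho> (\<lambda>x. \<bar>(f x - f y) * (K n x y)^2\<bar>)" using i2 by (rule integrable_abs)
      show "integrable \<rho> (\<lambda>x. e * (K n x y)^2 + 2 * M / \<eta>^2 * ((x - y)^2 * (K n x y)^2))"
        by (intro Bochner_Integration.integrable_add integrable_mult_right integrable_K_sq integrable_K_var)
      fix x
      have "\<bar>(f x - f y) * (K n x y)^2\<bar> = \<bar>f x - f y\<bar> * (K n x y)^2" by (simp add: abs_mult)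
      also have "... \<le> (e + 2 * M / \<eta>^2 * (x - y)^2) * (K n x y)^2" using pt by (intro mult_right_mono) auto
      finally show "\<bar>(f x - f y) * (K n x y)^2\<bar> \<le> e * (K n x y)^2 + 2 * M / \<eta>^2 * ((x - y)^2 * (K n x y)^2)"
        by (simp add: algebra_simps)
    qed
    also have "... = e * K n y y + 2 * M / \<eta>^2 * ((A n)^2 * ((p n y)^2 + (p (Suc n) y)^2))"
      using integrable_K_sq[of n y] integrable_K_var[of y n] unfolding integral_K_sq[symmetric] integral_K_var[symmetric] by simp
    finally show "\<bar>\<integral>x. (f x - f y) * (K n x y)^2 \<partial>\<rho>\<bar> \<le> e * K n y y + 2 * M / \<eta>^2 * ((A n)^2 * ((p n y)^2 + (p (Suc n) y)^2))" .
  qed (use Kp in simp)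
  also have "... \<le> (e * K n y y + 2 * M / \<eta>^2 * (1 * ((p n y)^2 + (p (Suc n) y)^2))) / K n y y"
    using Kp A_sq_bounds(2)[of n] M0 by (intro divide_right_mono add_left_mono mult_left_mono mult_right_mono) auto
  also have "... = e + 2 * M / \<eta>^2 * ((p n y)^2 + (p (Suc n) y)^2) / K n y y"
    using Kp by (simp add: add_divide_distrib)
  finally show ?thesis .
qed

theorem nevai_uniform:
  assumes sd: "summable defect" and C: "compact C" "C \<subseteq> {-1<..<1}" and \<epsilon>: "0 < \<epsilon>"
    and f: "continuous_on UNIV f" "bounded (range f)"
  shows "eventually (\<lambda>n. \<forall>y\<in>C. \<bar>(\<integral>x. f x * (K n x y)^2 \<partial>\<rho>) / K n y y - f y\<bar> < \<epsilon>) sequentially"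
proof -
  obtain \<kappa> where k: "0 < \<kappa>" "\<And>x. x \<in> C \<Longrightarrow> x^2 \<le> 1 - 4 * \<kappa>" using compact_inside[OF C] by blast
  obtain B where B: "1 \<le> B" "\<And>x n. x^2 \<le> 1 - 4 * \<kappa> \<Longrightarrow> \<bar>p n x\<bar> \<le> B"
    "\<And>x n. x^2 \<le> 1 - 4 * \<kappa> \<Longrightarrow> real n + 1 \<le> B * K n x x"
    using inside_bounds[OF sd k(1)] by blast
  obtain M where M: "\<And>x. \<bar>f x\<bar> \<le> M" using f(2) unfolding bounded_iff by auto
  have M0: "0 \<le> M" using M[of 0] by linarith
  have "uniformly_continuous_on {-2..2} f"
    by (intro compact_uniformly_continuous continuous_on_subset[OF f(1)]) auto
  then obtain \<eta>0 where \<eta>0: "0 < \<eta>0" "\<And>x y. x \<in> {-2..2} \<Longrightarrow> y \<in> {-2..2} \<Longrightarrow> dist y x < \<eta>0 \<Longrightarrow> dist (f y) (f x) < \<epsilon> / 2"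
    unfolding uniformly_continuous_on_def using \<epsilon> by (metis half_gt_zero)
  \<comment> \<open>The bound 1 keeps \<open>x\<close> in [-2, 2], where one modulus of continuity
    serves all \<open>y\<close> in \<open>C\<close>.\<close>
  define \<eta> where "\<eta> = min \<eta>0 1"
  have \<eta>: "0 < \<eta>" using \<eta>0 by (simp add: \<eta>_def)
  have mod: "\<bar>f x - f y\<bar> \<le> \<epsilon> / 2" if "y \<in> C" "\<bar>x - y\<bar> < \<eta>" for x y
  proof -
    have "y \<in> {-1<..<1}" using that C by blast
    then have "x \<in> {-2..2}" "y \<in> {-2..2}" "dist x y < \<eta>0" using that by (auto simp: \<eta>_def dist_real_def)
    then show ?thesis using \<eta>0(2)[of y x] by (simp add: dist_real_def)
  qed
  define R where "R = 2 * M / \<eta>^2 * (2 * B^3)"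
  have R0: "0 \<le> R" using M0 B(1) by (simp add: R_def)
  obtain N :: nat where N: "2 * R / \<epsilon> < real N" using reals_Archimedean2 by blast
  show ?thesis unfolding eventually_sequentially
  proof (intro exI[of _ N] allI impI ballI)
    fix n y assume n: "N \<le> n" and y: "y \<in> C"
    have x: "y^2 \<le> 1 - 4 * \<kappa>" using k y by blast
    have Kp: "0 < K n y y" by (rule K_pos)
    have sq: "(p m y)^2 \<le> B^2" for m using B(2)[OF x, of m] by (metis abs_ge_zero power2_abs power_mono)
    have "2 * M / \<eta>^2 * ((p n y)^2 + (p (Suc n) y)^2) / K n y y \<le> 2 * M / \<eta>^2 * (B^2 + B^2) / ((real n + 1) / B)"
    proof (intro frac_le mult_left_mono add_mono sq)
      show "(real n + 1) / B \<le> K n y y" using B(3)[OF x, of n] B(1) by (simp add: field_simps)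
      show "0 < (real n + 1) / B" using B(1) by simp
      show "0 \<le> 2 * M / \<eta>^2 * (B^2 + B^2)" using M0 by simp
      show "0 \<le> 2 * M / \<eta>^2" using M0 by simp
    qed
    also have "... = R / (real n + 1)" using B(1) by (simp add: R_def field_simps power2_eq_square power3_eq_cube)
    also have "... < \<epsilon> / 2"
    proof -
      have "2 * R < \<epsilon> * (real n + 1)" using N n \<epsilon> by (smt (verit) divide_less_eq mult.commute mult_left_mono of_nat_mono)
      then show ?thesis by (simp add: field_simps)
    qed
    finally have "2 * M / \<eta>^2 * ((p n y)^2 + (p (Suc n) y)^2) / K n y y < \<epsilon> / 2" .
    then show "\<bar>(\<integral>x. f x * (K n x y)^2 \<partial>\<rho>) / K n y y - f y\<bar> < \<epsilon>"
      using nevai_chebyshev[OF f(1) M \<eta> mod[OF y], of n] by linarith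
  qed
qed

corollary nevai_inside:
  assumes sd: "summable defect" and y: "y \<in> {-1<..<1}"
  shows "nevai_at a b \<rho> y"
  unfolding nevai_at_def
proof (intro allI impI LIMSEQ_I)
  fix f :: "real \<Rightarrow> real" and r :: real
  assume f: "continuous_on UNIV f \<and> bounded (range f)" and r: "0 < r"
  have "eventually (\<lambda>n. \<forall>y\<in>{y}. \<bar>(\<integral>x. f x * (K n x y)^2 \<partial>\<rho>) / K n y y - f y\<bar> < r) sequentially"
    by (rule nevai_uniform[OF sd]) (use y f r in auto)
  then show "\<exists>no. \<forall>n\<ge>no. norm ((\<integral>x. f x * (K n x y)^2 \<partial>\<rho>) / K n y y - f y) < r"
    by (auto simp: eventually_sequentially)
qed

text \<open>The truncated square is an admissible test function vanishing at \<open>y\<close>; by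
  \<open>AE_abs_less_3\<close> it equals \<open>(x - y)^2\<close> almost everywhere, so its integral
  is given by \<open>integral_K_var\<close>.\<close>

lemma nevai_imp_ratio:
  assumes "nevai_at a b \<rho> y"
  shows "(\<lambda>n. ((p n y)^2 + (p (Suc n) y)^2) / K n y y) \<longlonglongrightarrow> 0"
proof -
  define c where "c = (3 + \<bar>y\<bar>)^2"
  define f where "f = (\<lambda>x. min ((x - y)^2) c)"
  have cont: "continuous_on UNIV f" unfolding f_def by (intro continuous_intros)
  have fm[measurable]: "f \<in> borel_measurable borel" using cont by (rule borel_measurable_continuous_onI)
  have "0 \<le> f x" "f x \<le> c" for x by (auto simp: f_def c_def)
  then have "bounded (range f)" unfolding bounded_iff by (intro exI[of _ c]) auto
  then have "(\<lambda>n. (\<integral>x. f x * (K n x y)^2 \<partial>\<rho>) / K n y y) \<longlonglongrightarrow> f y"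
    using assms cont unfolding nevai_at_def by blast
  moreover have "f y = 0" by (simp add: f_def c_def)
  moreover have "(\<integral>x. f x * (K n x y)^2 \<partial>\<rho>) = (A n)^2 * ((p n y)^2 + (p (Suc n) y)^2)" for n
  proof -
    have "(\<integral>x. f x * (K n x y)^2 \<partial>\<rho>) = (\<integral>x. (x - y)^2 * (K n x y)^2 \<partial>\<rho>)"
    proof (rule integral_cong_AE)
      show "AE x in \<rho>. f x * (K n x y)^2 = (x - y)^2 * (K n x y)^2"
        using AE_abs_less_3
      proof eventually_elim
        case (elim x)
        then have "\<bar>x - y\<bar> \<le> \<bar>3 + \<bar>y\<bar>\<bar>" by linarith
        then have "(x - y)^2 \<le> c" unfolding c_def by (simp only: abs_le_square_iff)
        then show ?case by (simp add: f_def)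
      qed
    qed measurable
    then show ?thesis unfolding integral_K_var .
  qed
  ultimately have lim: "(\<lambda>n. (A n)^2 * ((p n y)^2 + (p (Suc n) y)^2) / K n y y) \<longlonglongrightarrow> 0" by simp
  show ?thesis
  proof (rule tendsto_sandwich[where f = "\<lambda>_. 0"])
    show "(\<lambda>n. 4 * ((A n)^2 * ((p n y)^2 + (p (Suc n) y)^2) / K n y y)) \<longlonglongrightarrow> 0"
      using tendsto_mult[OF tendsto_const lim, of 4] by simp
    show "\<forall>\<^sub>F n in sequentially. 0 \<le> ((p n y)^2 + (p (Suc n) y)^2) / K n y y"
      using K_pos by (simp add: less_imp_le)
    have "((p n y)^2 + (p (Suc n) y)^2) / K n y y \<le> 4 * ((A n)^2 * ((p n y)^2 + (p (Suc n) y)^2) / K n y y)" for n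
    proof -
      have "1 * (((p n y)^2 + (p (Suc n) y)^2) / K n y y) \<le> (4 * (A n)^2) * (((p n y)^2 + (p (Suc n) y)^2) / K n y y)"
        using A_sq_bounds(1)[of n] K_pos[of n y] by (intro mult_right_mono) auto
      then show ?thesis by simp
    qed
    then show "\<forall>\<^sub>F n in sequentially. ((p n y)^2 + (p (Suc n) y)^2) / K n y y \<le> 4 * ((A n)^2 * ((p n y)^2 + (p (Suc n) y)^2) / K n y y)"
      by simp
  qed simp
qed

end


section \<open>Singularity and failure of the Nevai condition at hyperbolic energies\<close>

text \<open>For weight 1/2 the recurrence is that of the Chebyshev polynomials of the second kind;
  \<open>chv n\<close> is U_(n-1).\<close>

fun chv :: "nat \<Rightarrow> real \<Rightarrow> real" where
  "chv 0 x = 0"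
| "chv (Suc 0) x = 1"
| "chv (Suc (Suc n)) x = 2 * x * chv (Suc n) x - chv n x"

lemma continuous_chv: "continuous_on S (chv n)"
proof (induction n rule: induct_nat_012)
  case 0 show ?case by (simp add: chv.simps(1)[abs_def])
next
  case 1 show ?case by (simp add: chv.simps(2)[abs_def])
next
  case (ge2 n) then show ?case unfolding chv.simps(3)[abs_def] by (intro continuous_intros)
qed

lemma chv_solves:
  fixes u :: "nat \<Rightarrow> real"
  assumes "\<And>i. Suc (Suc i) \<le> L \<Longrightarrow> u (Suc (Suc i)) = 2 * x * u (Suc i) - u i"
  shows "Suc i \<le> L \<Longrightarrow> u (Suc i) = chv (Suc i) x * u 1 - chv i x * u 0"
proof (induction i rule: induct_nat_012)
  case 0 show ?case by simp
next
  case 1 then show ?case using assms[of 0] by simp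
next
  case (ge2 n)
  have "u (Suc (Suc (Suc n))) = 2 * x * u (Suc (Suc n)) - u (Suc n)" using assms[of "Suc n"] ge2 by simp
  also have "... = 2 * x * (chv (Suc (Suc n)) x * u 1 - chv (Suc n) x * u 0) - (chv (Suc n) x * u 1 - chv n x * u 0)"
    using ge2 by simp
  finally show ?case by (simp add: algebra_simps)
qed

text \<open>\<open>l\<close> is the expanding eigenvalue of the transfer matrix for weight
  1/2.\<close>

lemma ex_lam:
  fixes x :: real
  assumes "1 < x"
  obtains l where "1 < l" "l + 1 / l = 2 * x"
proof -
  define r where "r = sqrt (x^2 - 1)"
  have x2: "1 < x^2" using assms by (simp add: one_less_power)
  have r: "0 \<le> r" "r^2 = x^2 - 1" using x2 by (auto simp: r_def)
  have l: "1 < x + r" using assms r by linarith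
  have "(x + r) * (x - r) = 1" using r(2) by (simp add: algebra_simps power2_eq_square)
  then have "1 / (x + r) = x - r" using l by (simp add: field_simps)
  then show thesis using that[of "x + r"] l by simp
qed

text \<open>A ratio of at least \<open>l\<close> reproduces itself: the next ratio is
  \<open>2 * x\<close> minus the reciprocal, at least \<open>l + 1/l - 1/l\<close>.\<close>

lemma chv_growth:
  assumes "1 < l" "l + 1 / l = 2 * x"
  shows "0 < chv (Suc n) x \<and> l * chv (Suc n) x \<le> chv (Suc (Suc n)) x"
proof (induction n)
  case 0
  have "0 < 1 / l" using assms(1) by simp
  then have "l \<le> 2 * x" using assms(2) by linarith
  then show ?case by simp
next
  case (Suc n)
  let ?v = "chv (Suc n) x" let ?w = "chv (Suc (Suc n)) x"
  have "0 < l * ?v" using Suc assms(1) by simp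
  then have w: "0 < ?w" using Suc by linarith
  have "?v \<le> ?w / l" using Suc assms(1) by (simp add: field_simps)
  moreover have "2 * x * ?w = l * ?w + ?w / l" unfolding assms(2)[symmetric] by (simp add: distrib_right)
  ultimately show ?case using w by simp
qed

lemma chv_pos: "1 < x \<Longrightarrow> 0 < chv (Suc n) x"
proof -
  assume "1 < x"
  then obtain l where "1 < l" "l + 1 / l = 2 * x" using ex_lam by blast
  then show ?thesis using chv_growth by blast
qed

lemma chv_lower:
  assumes "1 < l" "l + 1 / l = 2 * x"
  shows "l^n \<le> chv (Suc n) x"
proof (induction n)
  case (Suc n)
  have "l * l^n \<le> l * chv (Suc n) x" using Suc assms(1) by simp
  then show ?case using chv_growth[OF assms, of n] by simp
qed simp

lemma chv_mono: "1 < x \<Longrightarrow> 0 \<le> chv n x \<and> chv n x \<le> chv (Suc n) x"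
proof -
  assume x: "1 < x"
  obtain l where l: "1 < l" "l + 1 / l = 2 * x" using ex_lam[OF x] by blast
  show ?thesis
  proof (cases n)
    case (Suc m)
    have g: "0 < chv (Suc m) x" "l * chv (Suc m) x \<le> chv (Suc (Suc m)) x" using chv_growth[OF l, of m] by auto
    have "1 * chv (Suc m) x \<le> l * chv (Suc m) x" using l g by (intro mult_right_mono) auto
    then have "0 \<le> chv (Suc m) x \<and> chv (Suc m) x \<le> chv (Suc (Suc m)) x" using g by linarith
    then show ?thesis unfolding Suc .
  qed simp
qed

text \<open>The ratios obey \<open>r' = 1 / (2 * z - r)\<close>, decreasing in \<open>z\<close> by
  induction. The ratio is the slope of initial data that vanish after \<open>Suc n\<close> steps,
  and it moves against the slope of \<open>p\<close>.\<close>

lemma chv_ratio_antimono: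
  assumes "1 < x" "x \<le> y"
  shows "chv n y / chv (Suc n) y \<le> chv n x / chv (Suc n) x"
proof (induction n)
  case (Suc n)
  have r: "chv (Suc n) z / chv (Suc (Suc n)) z = 1 / (2 * z - chv n z / chv (Suc n) z)"
    "0 < 2 * z - chv n z / chv (Suc n) z" if "1 < z" for z
  proof -
    have "chv (Suc (Suc n)) z / chv (Suc n) z = 2 * z - chv n z / chv (Suc n) z"
      using chv_pos[OF that, of n] by (simp add: field_simps)
    moreover have "0 < chv (Suc (Suc n)) z / chv (Suc n) z" using chv_pos[OF that] by (simp del: chv.simps)
    moreover have "chv (Suc n) z / chv (Suc (Suc n)) z = 1 / (chv (Suc (Suc n)) z / chv (Suc n) z)" by (simp del: chv.simps)
    ultimately show "chv (Suc n) z / chv (Suc (Suc n)) z = 1 / (2 * z - chv n z / chv (Suc n) z)"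
      "0 < 2 * z - chv n z / chv (Suc n) z" by (simp_all only:)
  qed
  have y: "1 < y" using assms by simp
  show ?case unfolding r(1)[OF y] r(1)[OF assms(1)]
    using Suc assms r(2)[OF assms(1)] by (intro divide_left_mono mult_pos_pos r(2) y) auto
qed simp

section \<open>Energies at which the data entering C_j are nearly contracting\<close>

definition sC :: "nat \<Rightarrow> nat" where
  "sC j = gs j + 3^(j^2) + (j^6 - 1)"

definition LC :: "nat \<Rightarrow> nat" where
  "LC j = 2^(j^2)"

lemma LC_pos: "1 \<le> LC j"
  by (simp add: LC_def)

text \<open>\<open>sC j\<close> is the last index of B_j, so the weights \<open>sC j + 1\<close> to
  \<open>sC j + LC j\<close> are 1/2; each step uses two of them, and \<open>sC j + LC j\<close> is
  the last index reached.\<close>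

lemma p_block_C:
  assumes j: "1 \<le> j" and i: "Suc i \<le> LC j"
  shows "ex.p (sC j + Suc i) x = chv (Suc i) x * ex.p (Suc (sC j)) x - chv i x * ex.p (sC j) x"
proof -
  have "ex.p (sC j + Suc (Suc i)) x = 2 * x * ex.p (sC j + Suc i) x - ex.p (sC j + i) x"
    if "Suc (Suc i) \<le> LC j" for i
  proof -
    have "ex_a (Suc (sC j + i)) = 1/2" "ex_a (Suc (Suc (sC j + i))) = 1/2"
      using ex_a_block_C[OF j, of i] ex_a_block_C[OF j, of "Suc i"] that unfolding sC_def LC_def by auto
    then have "1/2 * ex.p (Suc (Suc (sC j + i))) x = x * ex.p (Suc (sC j + i)) x - 1/2 * ex.p (sC j + i) x"
      using ex.p_rec[of "sC j + i" x] by (simp only:)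
    then show ?thesis by simp
  qed
  then show ?thesis
    using chv_solves[of "LC j" "\<lambda>i. ex.p (sC j + i) x" x i] i by simp
qed

text \<open>The confluent formula gives the derivative \<open>K n z z / (A n * (p n z)^2)\<close>,
  where \<open>A n \<le> 1\<close> and \<open>K\<close> contains the term
  \<open>(p n z)^2\<close>.\<close>

lemma quotient_expanding:
  assumes "x < y" "\<And>z. x \<le> z \<Longrightarrow> z \<le> y \<Longrightarrow> ex.p n z \<noteq> 0"
  shows "y - x \<le> ex.p (Suc n) y / ex.p n y - ex.p (Suc n) x / ex.p n x"
proof -
  define f where "f = (\<lambda>z. ex.p (Suc n) z / ex.p n z)"
  define f' where "f' = (\<lambda>z. (deriv (ex.p (Suc n)) z * ex.p n z - ex.p (Suc n) z * deriv (ex.p n) z) / (ex.p n z * ex.p n z))"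
  have d: "(f has_real_derivative f' z) (at z)" if "x \<le> z" "z \<le> y" for z
    unfolding f_def f'_def using assms(2)[OF that] by (intro DERIV_divide ex.p_has_deriv)
  obtain z where z: "x < z" "z < y" "f y - f x = (y - x) * f' z"
    using MVT2[OF assms(1) d] by blast
  have nz: "0 < ex.p n z * ex.p n z" using assms(2)[of z] z by (auto simp: zero_less_mult_iff)
  have A: "0 < ex_a (Suc n)" "ex_a (Suc n) \<le> 1" by (rule ex.A_pos, rule ex.A_le)
  have "deriv (ex.p (Suc n)) z * ex.p n z - ex.p (Suc n) z * deriv (ex.p n) z = ex.K n z z / ex_a (Suc n)"
    using ex.christoffel_darboux_confluent[of n z] A by (simp add: field_simps)
  also have "... \<ge> ex.K n z z" using A ex.K_pos[of n z] by (simp add: le_divide_eq mult_left_le)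
  finally have "ex.p n z * ex.p n z \<le> deriv (ex.p (Suc n)) z * ex.p n z - ex.p (Suc n) z * deriv (ex.p n) z"
    using ex.p_sq_le_K[of n n z] by (simp add: power2_eq_square)
  then have "1 \<le> f' z" unfolding f'_def using nz by (simp add: le_divide_eq)
  then have "(y - x) * 1 \<le> (y - x) * f' z" using assms(1) by (intro mult_left_mono) auto
  then show ?thesis using z(3) unfolding f_def by simp
qed

text \<open>The typical size at the end of C_j is \<open>chv (LC j) x\<close> times the initial
  data; here cancellation destroys it. If \<open>p (sC j) x = 0\<close> nothing can cancel, hence
  the exclusion, which also makes the quotient of successive polynomials available.\<close>

definition Bad :: "nat \<Rightarrow> real set" where
  "Bad j = {x. 1 < x \<and> x < 2 \<and> ex.p (sC j) x \<noteq> 0 \<and>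
     \<bar>ex.p (sC j + LC j) x\<bar> \<le> 1 / 9^(j^2) * chv (LC j) x * \<bar>ex.p (sC j) x\<bar>}"

lemma Bad_measurable: "Bad j \<in> sets borel"
proof -
  have [measurable]: "ex.p n \<in> borel_measurable borel" "chv n \<in> borel_measurable borel" for n
    by (auto intro!: borel_measurable_continuous_onI ex.continuous_p continuous_chv)
  show ?thesis unfolding Bad_def by measurable
qed

text \<open>Equal counts mean that no zero of \<open>p (sC j)\<close> separates the points. There
  \<open>\<phi>\<close> expands distances, since its two parts move in opposite directions, while
  \<open>|\<phi>| \<le> 9^(-j^2)\<close> on \<open>Bad j\<close>.\<close>

lemma Bad_diam:
  assumes j: "1 \<le> j" and x: "x \<in> Bad j" and y: "y \<in> Bad j" and xy: "x < y"
    and c: "card {z. ex.p (sC j) z = 0 \<and> z < x} = card {z. ex.p (sC j) z = 0 \<and> z < y}"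
  shows "y - x \<le> 2 / 9^(j^2)"
proof -
  let ?s = "sC j"
  obtain L where L: "LC j = Suc L" using LC_pos[of j] by (cases "LC j") auto
  define \<phi> where "\<phi> = (\<lambda>z. ex.p (Suc ?s) z / ex.p ?s z - chv L z / chv (Suc L) z)"
  have fin: "finite {z. ex.p ?s z = 0 \<and> z < y}" using ex.p_zeros(1)[of ?s] by (rule rev_finite_subset) auto
  have "{z. ex.p ?s z = 0 \<and> z < x} = {z. ex.p ?s z = 0 \<and> z < y}"
    using xy by (intro card_subset_eq[OF fin _ c]) auto
  then have nz: "ex.p ?s z \<noteq> 0" if "x \<le> z" "z \<le> y" for z
  proof (cases "z = y")
    case True then show ?thesis using y unfolding Bad_def by simp
  next
    case False
    have "z \<notin> {z. ex.p ?s z = 0 \<and> z < x}" using that by simp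
    then have "z \<notin> {z. ex.p ?s z = 0 \<and> z < y}" using \<open>{z. ex.p ?s z = 0 \<and> z < x} = {z. ex.p ?s z = 0 \<and> z < y}\<close> by simp
    then show ?thesis using that False by simp
  qed
  have small: "\<bar>\<phi> z\<bar> \<le> 1 / 9^(j^2)" if z: "z \<in> Bad j" for z
  proof -
    have z': "1 < z" "ex.p ?s z \<noteq> 0" "\<bar>ex.p (?s + Suc L) z\<bar> \<le> 1 / 9^(j^2) * chv (Suc L) z * \<bar>ex.p ?s z\<bar>"
      using z unfolding Bad_def L by auto
    have v: "0 < chv (Suc L) z" by (rule chv_pos[OF z'(1)])
    have "\<phi> z * (chv (Suc L) z * ex.p ?s z) = chv (Suc L) z * ex.p (Suc ?s) z - chv L z * ex.p ?s z"
      unfolding \<phi>_def using v z'(2) by (simp add: field_simps)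
    also have "... = ex.p (?s + Suc L) z" using p_block_C[OF j, of L z] L by simp
    finally have "\<bar>\<phi> z * (chv (Suc L) z * ex.p ?s z)\<bar> = \<bar>ex.p (?s + Suc L) z\<bar>" by (rule arg_cong)
    then have "\<bar>\<phi> z\<bar> * (chv (Suc L) z * \<bar>ex.p ?s z\<bar>) = \<bar>ex.p (?s + Suc L) z\<bar>"
      using v by (simp only: abs_mult abs_of_pos)
    then have "\<bar>\<phi> z\<bar> * (chv (Suc L) z * \<bar>ex.p ?s z\<bar>) \<le> 1 / 9^(j^2) * (chv (Suc L) z * \<bar>ex.p ?s z\<bar>)"
      using z'(3) by (simp only: mult.assoc)
    moreover have "0 < chv (Suc L) z * \<bar>ex.p ?s z\<bar>" using v z'(2) by (intro mult_pos_pos) auto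
    ultimately show ?thesis by (rule mult_right_le_imp_le)
  qed
  have "y - x \<le> ex.p (Suc ?s) y / ex.p ?s y - ex.p (Suc ?s) x / ex.p ?s x"
    by (rule quotient_expanding[OF xy nz])
  also have "... \<le> \<phi> y - \<phi> x"
    unfolding \<phi>_def using chv_ratio_antimono[of x y L] x xy unfolding Bad_def by simp
  also have "... \<le> 2 / 9^(j^2)" using small[OF x] small[OF y] by (simp add: abs_le_iff)
  finally show ?thesis .
qed

lemma sC_le: "1 \<le> j \<Longrightarrow> sC j + 1 \<le> 7 * 3^(j^2)"
  using gs_le[of j] pow6_le[of j] one_le_power[of "3::nat" "j^2"] unfolding sC_def by linarith

text \<open>The number of zeros to the left splits \<open>Bad j\<close> into at most
  \<open>sC j + 1\<close> pieces, each small by \<open>Bad_diam\<close>; 28 = 7 * 4.\<close>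

lemma Bad_measure:
  assumes j: "1 \<le> j"
  shows "measure lborel (Bad j) \<le> 28 / 3^j" "emeasure lborel (Bad j) < \<infinity>"
proof -
  let ?s = "sC j" let ?\<tau> = "1 / 9^(j^2) :: real"
  define C where "C = (\<lambda>x. card {z. ex.p ?s z = 0 \<and> z < x})"
  \<comment> \<open>An interval around an arbitrary point of each nonempty piece: it covers the
    piece and is measurable whatever the piece looks like.\<close>
  define I where "I = (\<lambda>c. if \<exists>x\<in>Bad j. C x = c then (let x = SOME x. x \<in> Bad j \<and> C x = c in {x - 2 * ?\<tau> .. x + 2 * ?\<tau>}) else {})"
  have cov: "Bad j \<subseteq> (\<Union>c\<le>?s. I c)"
  proof
    fix y assume y: "y \<in> Bad j"
    have "C y \<le> card {z. ex.p ?s z = 0}" unfolding C_def using ex.p_zeros(1)[of ?s] by (intro card_mono) auto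
    then have cy: "C y \<le> ?s" using ex.p_zeros(2)[of ?s] by linarith
    define x where "x = (SOME x. x \<in> Bad j \<and> C x = C y)"
    have x: "x \<in> Bad j" "C x = C y" using someI[of "\<lambda>x. x \<in> Bad j \<and> C x = C y" y] y unfolding x_def by auto
    have "\<bar>y - x\<bar> \<le> 2 * ?\<tau>"
      using Bad_diam[OF j x(1) y] Bad_diam[OF j y x(1)] x(2) unfolding C_def
      by (cases x y rule: linorder_cases) auto
    moreover have "I (C y) = {x - 2 * ?\<tau> .. x + 2 * ?\<tau>}" unfolding I_def x_def using y by (auto simp: Let_def)
    ultimately have "y \<in> I (C y)" by auto
    then show "y \<in> (\<Union>c\<le>?s. I c)" using cy by blast
  qed
  have I: "I c \<in> sets lborel" "emeasure lborel (I c) \<le> ennreal (4 * ?\<tau>)" for c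
    unfolding I_def by (auto simp: Let_def)
  have "emeasure lborel (Bad j) \<le> emeasure lborel (\<Union>c\<le>?s. I c)"
    using cov I by (intro emeasure_mono sets.finite_UN) auto
  also have "... \<le> (\<Sum>c\<le>?s. emeasure lborel (I c))"
    using I by (intro emeasure_subadditive_finite) auto
  also have "... \<le> (\<Sum>c\<le>?s. ennreal (4 * ?\<tau>))" by (intro sum_mono I)
  also have "... = ennreal (\<Sum>c\<le>?s. 4 * ?\<tau>)" by (intro sum_ennreal) auto
  also have "(\<Sum>c\<le>?s. 4 * ?\<tau>) = real (sC j + 1) * (4 * ?\<tau>)" by simp
  finally have e: "emeasure lborel (Bad j) \<le> ennreal (real (sC j + 1) * (4 * ?\<tau>))" .
  then show "emeasure lborel (Bad j) < \<infinity>" by (rule le_less_trans) simp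
  have "measure lborel (Bad j) \<le> real (sC j + 1) * (4 * ?\<tau>)"
    unfolding measure_def by (rule enn2real_leI[OF _ e]) simp
  also have "... \<le> real (7 * 3^(j^2)) * (4 * ?\<tau>)"
    using sC_le[OF j] by (intro mult_right_mono) (auto simp only: of_nat_le_iff zero_le_mult_iff, auto)
  also have "... = 28 / 3^(j^2)"
  proof -
    have "(9::real)^(j^2) = 3^(j^2) * 3^(j^2)" unfolding power_mult_distrib[symmetric] by simp
    then show ?thesis by (simp add: field_simps)
  qed
  also have "... \<le> 28 / 3^j" by (intro divide_left_mono power_increasing) (auto simp: power2_eq_square)
  finally show "measure lborel (Bad j) \<le> 28 / 3^j" .
qed

lemma AE_eventually_not_Bad: "AE x in lborel. eventually (\<lambda>j. x \<notin> Bad j) sequentially"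
proof -
  have m: "Bad (Suc j) \<in> sets lborel" for j using Bad_measurable by simp
  have "summable (\<lambda>j. 28 * (1/3::real)^j)" by (intro summable_mult summable_geometric) simp
  then have "summable (\<lambda>j. measure lborel (Bad (Suc j)))"
  proof (rule summable_comparison_test'[where N=0])
    fix j :: nat
    have "measure lborel (Bad (Suc j)) \<le> 28 / 3^(Suc j)" by (rule Bad_measure(1)) simp
    also have "... \<le> 28 * (1/3)^j" by (simp add: power_divide divide_simps)
    finally show "norm (measure lborel (Bad (Suc j))) \<le> 28 * (1/3)^j" by simp
  qed
  then have "AE x in lborel. eventually (\<lambda>j. x \<in> space lborel - Bad (Suc j)) sequentially"
    using m Bad_measure(2) by (intro borel_cantelli_AE1) auto
  then show ?thesis
  proof eventually_elim
    case (elim x)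
    then have "eventually (\<lambda>j. x \<notin> Bad (Suc j)) sequentially" by (rule eventually_mono) simp
    then show ?case by (simp only: eventually_sequentially_Suc[of "\<lambda>j. x \<notin> Bad j"])
  qed
qed

text \<open>If \<open>P1\<close> dominates \<open>P0\<close>, the term with \<open>w \<le> v\<close>
  cannot cancel the other one. Otherwise \<open>P0\<close> carries at least a fifth of the
  amplitude, and not lying in \<open>Bad j\<close> bounds the final value below;
  \<open>81^(j^2)\<close> is the inverse square of the tolerance.\<close>

lemma block_C_growth:
  assumes j: "1 \<le> j" and x: "1 < x" "x < 2" and good: "x \<notin> Bad j"
    and l: "1 < l" "l + 1 / l = 2 * x"
  shows "(l^LC j)^2 * ex.amp (\<lambda>n. ex.p n x) (sC j) \<le> 5 * 81^(j^2) * l^2 * (ex.p (sC j + LC j) x)^2"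
proof -
  let ?s = "sC j"
  obtain L where L: "LC j = Suc L" using LC_pos[of j] by (cases "LC j") auto
  define P0 P1 PL v w where "P0 = ex.p ?s x" and "P1 = ex.p (Suc ?s) x" and "PL = ex.p (?s + LC j) x"
    and "v = chv (Suc L) x" and "w = chv L x"
  have PL: "PL = v * P1 - w * P0" unfolding PL_def L v_def w_def P0_def P1_def using p_block_C[OF j, of L x] L by simp
  have v: "0 < v" "0 \<le> w" "w \<le> v" "l^L \<le> v"
    using chv_pos[OF x(1), of L] chv_mono[OF x(1), of L] chv_lower[OF l, of L] by (auto simp: v_def w_def)
  define \<tau> :: real where "\<tau> = 1 / 9^(j^2)"
  have \<tau>: "0 < \<tau>" "\<tau> \<le> 1" by (auto simp: \<tau>_def)
  have main: "\<tau>^2 * v^2 * (P1^2 + P0^2) \<le> 5 * PL^2"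
  proof (cases "2 * \<bar>P0\<bar> \<le> \<bar>P1\<bar>")
    case True
    have "v * (\<bar>P1\<bar> / 2) \<le> v * (\<bar>P1\<bar> - \<bar>P0\<bar>)" using True v by (intro mult_left_mono) auto
    also have "... \<le> \<bar>v * P1\<bar> - \<bar>w * P0\<bar>"
      using v mult_right_mono[OF v(3), of "\<bar>P0\<bar>"] by (simp add: abs_mult algebra_simps)
    also have "... \<le> \<bar>PL\<bar>" unfolding PL by linarith
    finally have "(v * (\<bar>P1\<bar> / 2))^2 \<le> \<bar>PL\<bar>^2" using v by (intro power_mono) auto
    then have 1: "v^2 * P1^2 \<le> 4 * PL^2" by (simp add: power_mult_distrib power_divide)
    have "(2 * \<bar>P0\<bar>)^2 \<le> \<bar>P1\<bar>^2" using True by (intro power_mono) auto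
    then have "P1^2 + P0^2 \<le> 5/4 * P1^2" by (simp add: power_mult_distrib)
    then have "v^2 * (P1^2 + P0^2) \<le> v^2 * (5/4 * P1^2)" by (intro mult_left_mono) auto
    also have "... \<le> 5 * PL^2" using 1 by (simp add: mult.commute)
    finally have 2: "v^2 * (P1^2 + P0^2) \<le> 5 * PL^2" .
    have "\<tau>^2 * (v^2 * (P1^2 + P0^2)) \<le> 1 * (v^2 * (P1^2 + P0^2))"
      using \<tau> by (intro mult_right_mono power_le_one) auto
    then show ?thesis using 2 by (simp add: mult.assoc)
  next
    case False
    then have "P0 \<noteq> 0" by auto
    then have "\<tau> * v * \<bar>P0\<bar> < \<bar>PL\<bar>"
      using good x unfolding Bad_def P0_def PL_def \<tau>_def v_def L by auto
    then have "(\<tau> * v * \<bar>P0\<bar>)^2 \<le> \<bar>PL\<bar>^2" using \<tau> v by (intro power_mono) auto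
    then have 1: "\<tau>^2 * v^2 * P0^2 \<le> PL^2" by (simp add: power_mult_distrib)
    have "\<bar>P1\<bar>^2 \<le> (2 * \<bar>P0\<bar>)^2" using False by (intro power_mono) auto
    then have "P1^2 + P0^2 \<le> 5 * P0^2" by (simp add: power_mult_distrib)
    then have "\<tau>^2 * v^2 * (P1^2 + P0^2) \<le> \<tau>^2 * v^2 * (5 * P0^2)" by (intro mult_left_mono) auto
    then show ?thesis using 1 by simp
  qed
  have t81: "\<tau>^2 = 1 / 81^(j^2)"
  proof -
    have "((9::real)^(j^2))^2 = (9^2)^(j^2)" by (simp only: power_mult[symmetric] mult.commute)
    then show ?thesis by (simp add: \<tau>_def power_divide)
  qed
  have "(l^LC j)^2 = l^2 * (l^L)^2" unfolding L by (simp add: power_mult_distrib power2_eq_square)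
  also have "... \<le> l^2 * v^2" using v l by (intro mult_left_mono power_mono) auto
  finally have "(l^LC j)^2 * (P1^2 + P0^2) \<le> l^2 * v^2 * (P1^2 + P0^2)" by (intro mult_right_mono) auto
  also have "... = 81^(j^2) * l^2 * (\<tau>^2 * v^2 * (P1^2 + P0^2))" unfolding t81 by simp
  also have "... \<le> 81^(j^2) * l^2 * (5 * PL^2)" using main by (intro mult_left_mono) auto
  finally show ?thesis unfolding ex.amp_def P0_def P1_def PL_def by (simp add: algebra_simps)
qed

section \<open>Loss of amplitude before C_j against growth on C_j\<close>

definition cnt :: "nat \<Rightarrow> nat" where
  "cnt n = (\<Sum>i<n. if ex_a (Suc i) = 1 \<and> ex_a (Suc (Suc i)) = 1 then 0 else 1)"

text \<open>A step of the recurrence involves two neighbouring weights, so an entry different from 1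
  spoils at most two steps.\<close>

lemma cnt_le: "cnt n \<le> 2 * badcount (Suc n)"
proof -
  let ?b = "\<lambda>i. if ex_a (Suc i) = 1 then 0 else 1::nat"
  have "cnt n \<le> (\<Sum>i<n. ?b i + ?b (Suc i))" unfolding cnt_def by (intro sum_mono) auto
  also have "... = (\<Sum>i<n. ?b i) + (\<Sum>i<n. ?b (Suc i))" by (rule sum.distrib)
  also have "(\<Sum>i<n. ?b i) \<le> badcount (Suc n)" unfolding badcount_def by simp
  also have "(\<Sum>i<n. ?b (Suc i)) \<le> badcount (Suc n)" unfolding badcount_def sum.lessThan_Suc_shift by simp
  finally show ?thesis by simp
qed

text \<open>With all entries equal to 1 the form \<^term>\<open>v^2 + w^2 - x * v * w\<close> is conserved, and it is
  definite for \<^term>\<open>\<bar>x\<bar> < 2\<close>; hence only the transitions off the \<open>A\<close>-blocks can change amplitudes.\<close>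

lemma amp_le_cnt:
  assumes x: "\<bar>x\<bar> < 2"
  shows "\<exists>R\<ge>1. \<forall>u m n. ex.sol x u \<longrightarrow> m \<le> n \<longrightarrow> ex.amp u m \<le> R^(cnt n + 1) * ex.amp u n"
proof -
  define q where "q = 1 - \<bar>x\<bar> / 2"
  have q: "0 < q" "q \<le> 1" using x by (auto simp: q_def)
  \<comment> \<open>21 from the one-step bound, 2 and \<open>1 / q\<close> from comparing the form
    with the amplitude.\<close>
  define R where "R = 42 / q"
  have R: "1 \<le> R" using q by (simp add: R_def)
  have "ex.amp u m \<le> R^(cnt n + 1) * ex.amp u n" if s: "ex.sol x u" and mn: "m \<le> n" for u m n
  proof -
    define e where "e = (\<lambda>n. (u (Suc n))^2 + (u n)^2 - x * u (Suc n) * u n)"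
    have e: "q * ex.amp u n \<le> e n" "e n \<le> 2 * ex.amp u n" for n
    proof -
      have a: "2 * \<bar>u (Suc n) * u n\<bar> \<le> ex.amp u n"
        using sum_squares_bound[of "\<bar>u (Suc n)\<bar>" "\<bar>u n\<bar>"] by (simp add: abs_mult ex.amp_def)
      have "\<bar>x * u (Suc n) * u n\<bar> = \<bar>x\<bar> * \<bar>u (Suc n) * u n\<bar>" by (simp add: abs_mult)
      also have "... \<le> \<bar>x\<bar> * (ex.amp u n / 2)" using a by (intro mult_left_mono) auto
      finally have b: "\<bar>x * u (Suc n) * u n\<bar> \<le> \<bar>x\<bar> / 2 * ex.amp u n" by simp
      have "\<bar>x\<bar> / 2 * ex.amp u n \<le> 1 * ex.amp u n" using x ex.amp_nonneg by (intro mult_right_mono) auto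
      moreover have "e n = ex.amp u n - x * u (Suc n) * u n" by (simp add: e_def ex.amp_def)
      ultimately show "e n \<le> 2 * ex.amp u n" using b by linarith
      have "q * ex.amp u n = ex.amp u n - \<bar>x\<bar> / 2 * ex.amp u n" by (simp add: q_def algebra_simps)
      then show "q * ex.amp u n \<le> e n" using b \<open>e n = ex.amp u n - x * u (Suc n) * u n\<close> by linarith
    qed
    have e0: "0 \<le> e n" for n using e(1)[of n] q ex.amp_nonneg[of u n] by (smt (verit) mult_nonneg_nonneg)
    have "e m \<le> R^cnt n * e n" using mn
    proof (induction n rule: dec_induct)
      case base
      have "1 * e m \<le> R^cnt m * e m" using R e0 by (intro mult_right_mono one_le_power) auto
      then show ?case by simp
    next
      case (step n)
      show ?case
      proof (cases "ex_a (Suc n) = 1 \<and> ex_a (Suc (Suc n)) = 1")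
        case True
        then have "e (Suc n) = e n"
          using ex.EE_Suc[OF s, of n] unfolding ex.EE_def ex.delta_def e_def by simp
        then show ?thesis using step True by (simp add: cnt_def)
      next
        case False
        then have c: "cnt (Suc n) = cnt n + 1" by (simp add: cnt_def)
        have x2: "\<bar>x\<bar> \<le> 2" using x by simp
        have "e n \<le> 2 * ex.amp u n" by (rule e)
        also have "... \<le> 2 * (21 * ex.amp u (Suc n))" using ex.amp_le_Suc[OF s x2, of n] by simp
        also have "... = R * (q * ex.amp u (Suc n))" using q by (simp add: R_def)
        also have "... \<le> R * e (Suc n)" using e(1) R by (intro mult_left_mono) auto
        finally have "R^cnt n * e n \<le> R^cnt n * (R * e (Suc n))" using R by (intro mult_left_mono) auto
        also have "... = R^cnt (Suc n) * e (Suc n)" unfolding c by simp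
        finally show ?thesis using step(3) by linarith
      qed
    qed
    then have "q * ex.amp u m \<le> R^cnt n * (2 * ex.amp u n)"
      using e(1)[of m] mult_left_mono[OF e(2)[of n], of "R^cnt n"] R by (smt (verit) zero_le_power)
    then have "ex.amp u m \<le> (2 / q) * (R^cnt n * ex.amp u n)" using q by (simp add: field_simps)
    also have "... \<le> R * (R^cnt n * ex.amp u n)"
      using q R ex.amp_nonneg[of u n] by (intro mult_right_mono) (auto simp: R_def divide_right_mono)
    finally show ?thesis by (simp add: mult.assoc)
  qed
  then show ?thesis using R by blast
qed

text \<open>One more than twice a bound for the entries different from 1 up to C_j, which lie in the
  earlier groups and in B_j. Decisive is that \<open>2^((j-1)^2)\<close> is
  \<open>2 * 4^(-j)\<close> times \<open>2^(j^2)\<close>.\<close>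

definition expo :: "nat \<Rightarrow> nat" where
  "expo j = 4 * j^7 + 2 * j^6 + 1 + 2 * j * 2^((j - 1)^2)"

lemma cnt_sC_le: "1 \<le> j \<Longrightarrow> cnt (sC j) + 1 \<le> expo j"
proof -
  assume j: "1 \<le> j"
  then obtain i where i: "j = Suc i" by (cases j) auto
  have "1 \<le> j^6" using j by simp
  then have "Suc (sC j) = (gs j + 3^(j^2)) + j^6" unfolding sC_def by linarith
  then have b: "badcount (Suc (sC j)) \<le> badcount (gs j) + j^6"
    using badcount_add_le[of "gs j + 3^(j^2)" "j^6"] badcount_block_A[OF j] by simp
  have "badcount (gs j) \<le> i * (2 * i^6 + 2^(i^2))" unfolding i by (rule badcount_gs)
  also have "... \<le> j * (2 * j^6 + 2^(i^2))" unfolding i by (intro mult_mono add_mono power_mono) auto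
  finally have "badcount (Suc (sC j)) \<le> j * (2 * j^6 + 2^(i^2)) + j^6" using b by linarith
  then have "2 * badcount (Suc (sC j)) \<le> 2 * (j * (2 * j^6 + 2^(i^2)) + j^6)" by (rule mult_le_mono2)
  then have "cnt (sC j) + 1 \<le> 2 * (j * (2 * j^6 + 2^(i^2)) + j^6) + 1"
    using order_trans[OF cnt_le[of "sC j"]] by (intro add_right_mono)
  also have "... = expo j" unfolding expo_def i by (simp add: algebra_simps power_numeral_reduce)
  finally show ?thesis .
qed

lemma expo_tendsto: "(\<lambda>j. real (1 + j^2 + expo j) / 2^(j^2)) \<longlonglongrightarrow> 0"
proof (rule tendsto_sandwich[where f = "\<lambda>_. 0"])
  have 1: "(\<lambda>j. real j * (1/4)^j) \<longlonglongrightarrow> 0" by (intro powser_times_n_limit_0) simp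
  have 2: "(\<lambda>j. (real j)^7 / 3^j) \<longlonglongrightarrow> 0"
    by (rule power7_times_power_tendsto[of "7/8"]) (simp_all add: power_divide)
  have "(\<lambda>j. 9 * ((real j)^7 / 3^j) + 4 * (real j * (1/4)^j)) \<longlonglongrightarrow> 9 * 0 + 4 * 0"
    by (intro tendsto_intros 1 2)
  then show "(\<lambda>j. 9 * ((real j)^7 / 3^j) + 4 * (real j * (1/4)^j)) \<longlonglongrightarrow> 0" by simp
  show "\<forall>\<^sub>F j in sequentially. 0 \<le> real (1 + j^2 + expo j) / 2^(j^2)" by simp
  have "real (1 + j^2 + expo j) / 2^(j^2) \<le> 9 * ((real j)^7 / 3^j) + 4 * (real j * (1/4)^j)" if j: "2 \<le> j" for j
  proof -
    obtain i where i: "j = Suc i" using j by (cases j) auto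
    have "j^2 \<le> j^7" "j^6 \<le> j^7" "1 \<le> j^7" using j by (auto intro!: power_increasing)
    then have "1 + j^2 + expo j \<le> 9 * j^7 + 2 * j * 2^(i^2)" unfolding expo_def i diff_Suc_1 by linarith
    then have "real (1 + j^2 + expo j) \<le> real (9 * j^7 + 2 * j * 2^(i^2))" unfolding of_nat_le_iff .
    then have "real (1 + j^2 + expo j) / 2^(j^2) \<le> real (9 * j^7 + 2 * j * 2^(i^2)) / 2^(j^2)"
      by (intro divide_right_mono) auto
    also have "... = 9 * ((real j)^7 / 2^(j^2)) + 2 * real j * (2^(i^2) / 2^(j^2))"
      by (simp add: add_divide_distrib)
    also have "(2::real)^(i^2) / 2^(j^2) = 2 * (1/4)^j"
    proof -
      have "(2::real)^(j^2) * 2 = 2^(i^2) * 4^j"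
      proof -
        have "(4::real)^j = 2^(2*j)" by (simp add: power_mult)
        moreover have "j^2 + 1 = i^2 + 2 * j" unfolding i by (simp add: power2_eq_square)
        ultimately have "(2::real)^(j^2 + 1) = 2^(i^2) * 4^j" by (simp only: power_add)
        then show ?thesis by simp
      qed
      then show ?thesis by (simp add: power_divide field_simps)
    qed
    also have "9 * ((real j)^7 / 2^(j^2)) \<le> 9 * ((real j)^7 / 3^j)"
    proof (intro mult_left_mono divide_left_mono)
      have "(3::real)^j \<le> 4^j" by (intro power_mono) auto
      also have "... = 2^(2*j)" by (simp add: power_mult)
      also have "... \<le> 2^(j^2)" using j by (intro power_increasing) (auto simp: power2_eq_square)
      finally show "(3::real)^j \<le> 2^(j^2)" .
    qed auto
    finally show ?thesis by simp
  qed
  then show "\<forall>\<^sub>F j in sequentially. real (1 + j^2 + expo j) / 2^(j^2) \<le> 9 * ((real j)^7 / 3^j) + 4 * (real j * (1/4)^j)"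
    by (auto simp: eventually_sequentially)
qed simp

text \<open>After taking logarithms, all exponents on the left are o(2^(j^2)) by
  \<open>expo_tendsto\<close>, while \<open>LC j\<close> is \<open>2^(j^2)\<close>.\<close>

lemma exponential_dominates:
  fixes c R l :: real
  assumes "1 \<le> c" "1 \<le> R" "1 < l"
  shows "eventually (\<lambda>j. c * 729^(j^2) * R^expo j < l^LC j) sequentially"
proof -
  define M where "M = ln c + ln 729 + ln R"
  have nn: "0 \<le> ln c" "0 \<le> ln (729::real)" "0 \<le> ln R" using assms by auto
  have M: "0 \<le> M" using nn by (simp add: M_def)
  have "(\<lambda>j. M * (real (1 + j^2 + expo j) / 2^(j^2))) \<longlonglongrightarrow> M * 0" by (intro tendsto_intros expo_tendsto)
  moreover have "M * 0 < ln l" using assms(3) by simp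
  ultimately have "eventually (\<lambda>j. M * (real (1 + j^2 + expo j) / 2^(j^2)) < ln l) sequentially"
    by (rule order_tendstoD)
  then show ?thesis
  proof eventually_elim
    case (elim j)
    have "ln (c * 729^(j^2) * R^expo j) = ln c + real (j^2) * ln 729 + real (expo j) * ln R"
      using assms by (simp add: ln_mult ln_realpow)
    also have "... \<le> M * real (1 + j^2 + expo j)"
    proof -
      have "ln c \<le> M" "real (j^2) * ln 729 \<le> real (j^2) * M" "real (expo j) * ln R \<le> real (expo j) * M"
        using nn by (auto simp: M_def intro!: mult_left_mono)
      then show ?thesis by (simp add: algebra_simps)
    qed
    also have "... < 2^(j^2) * ln l" using elim by (simp add: field_simps)
    also have "... = ln (l^LC j)" using assms by (simp add: ln_realpow LC_def)
    finally show ?case using assms by (subst (asm) ln_less_cancel_iff) auto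
  qed
qed

text \<open>The first clause will give singularity, the second the failure of the Nevai condition.
  Neither mentions \<open>\<rho>\<close>, so the reflection x -> -x transfers both to negative
  energies.\<close>

definition escapes :: "real \<Rightarrow> bool" where
  "escapes x \<longleftrightarrow> \<not> eventually (\<lambda>n. (ex.p n x)^2 < (real n + 1)^2) sequentially \<and>
     \<not> (\<lambda>n. ((ex.p n x)^2 + (ex.p (Suc n) x)^2) / ex.K n x x) \<longlonglongrightarrow> 0"

lemma escapes_minus: "escapes (- x) \<longleftrightarrow> escapes x"
proof -
  have 1: "(ex.p n (- x))^2 = (ex.p n x)^2" for n
    by (cases "even n") (simp_all add: ex.p_minus)
  have 2: "ex.K n (- x) (- x) = ex.K n x x" for n
    using 1 by (simp add: CD_kernel_def power2_eq_square)
  show ?thesis unfolding escapes_def 1 2 ..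
qed

text \<open>Along C_j the squared values gain a factor of about \<open>l^(2 * LC j)\<close>, which
  rules out polynomial bounds. A ratio tending to 0 would let \<open>K\<close> grow by at most
  \<open>l\<close> per step, hence by \<open>l^(LC j)\<close>, only half of the exponent.\<close>

lemma good_escapes:
  assumes x: "1 < x" "x < 2" and good: "eventually (\<lambda>j. x \<notin> Bad j) sequentially"
  shows "escapes x"
proof -
  obtain l where l: "1 < l" "l + 1 / l = 2 * x" using ex_lam[OF x(1)] by blast
  let ?u = "\<lambda>n. ex.p n x"
  have ax: "\<bar>x\<bar> < 2" using x by simp
  obtain R where R: "1 \<le> R" "\<And>u m n. ex.sol x u \<Longrightarrow> m \<le> n \<Longrightarrow> ex.amp u m \<le> R^(cnt n + 1) * ex.amp u n"
    using amp_le_cnt[OF ax] by blast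
  have amp0: "1 \<le> ex.amp ?u 0" by (simp add: ex.amp_def)
  have am: "ex.amp ?u m \<le> R^expo j * ex.amp ?u (sC j)" if "1 \<le> j" "m \<le> sC j" for j m
  proof -
    have "ex.amp ?u m \<le> R^(cnt (sC j) + 1) * ex.amp ?u (sC j)" by (rule R(2)[OF ex.sol_p that(2)])
    also have "... \<le> R^expo j * ex.amp ?u (sC j)"
      using R(1) cnt_sC_le[OF that(1)] ex.amp_nonneg by (intro mult_right_mono power_increasing) auto
    finally show ?thesis .
  qed
  \<comment> \<open>One estimate for both contradictions: the first needs \<open>320 * l^2\<close>
    and 729 = 81 * 9, the second \<open>35 * l^2\<close> and 243 = 81 * 3.\<close>
  have dom: "eventually (\<lambda>j. (405 * l^2) * 729^(j^2) * R^expo j < l^LC j) sequentially"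
    using l R by (intro exponential_dominates mult_ge1_I) (auto simp: one_le_power intro: order_trans[OF _ mult_left_mono[of 1]])
  have ev: "eventually (\<lambda>j. 1 \<le> j \<and> x \<notin> Bad j \<and> (405 * l^2) * 729^(j^2) * R^expo j < l^LC j) sequentially"
    using eventually_ge_at_top[of 1] good dom by eventually_elim simp
  have sC_ge: "j \<le> sC j" for j using le_3_pow_sq[of j] unfolding sC_def by linarith
  have lL: "1 \<le> l^LC j" for j using l by (simp add: one_le_power)
  have "\<not> eventually (\<lambda>n. (ex.p n x)^2 < (real n + 1)^2) sequentially"
  proof
    assume "eventually (\<lambda>n. (ex.p n x)^2 < (real n + 1)^2) sequentially"
    then obtain n0 where n0: "\<And>n. n0 \<le> n \<Longrightarrow> (ex.p n x)^2 < (real n + 1)^2" by (auto simp: eventually_sequentially)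
    obtain j where j: "1 \<le> j" "x \<notin> Bad j" "(405 * l^2) * 729^(j^2) * R^expo j < l^LC j" "n0 \<le> j"
      using eventually_happens'[OF _ eventually_conj[OF ev eventually_ge_at_top[of n0]]] by auto
    define N where "N = sC j + LC j"
    have "n0 \<le> N" using sC_ge[of j] j(4) by (simp add: N_def)
    then have pN: "(ex.p N x)^2 \<le> (real N + 1)^2" using n0 by (simp add: less_imp_le)
    have "LC j \<le> 3^(j^2)" unfolding LC_def by (rule power_mono) auto
    then have "N + 1 \<le> 8 * 3^(j^2)" using sC_le[OF j(1)] unfolding N_def by linarith
    then have "real (N + 1) \<le> real (8 * 3^(j^2))" unfolding of_nat_le_iff .
    then have "(real N + 1)^2 \<le> (8 * 3^(j^2))^2" by (intro power_mono) auto
    also have "... = 64 * 9^(j^2)"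
    proof -
      have "((3::real)^(j^2))^2 = (3^2)^(j^2)" by (simp only: power_mult[symmetric] mult.commute)
      then show ?thesis by (simp add: power_mult_distrib)
    qed
    finally have p1: "(ex.p N x)^2 \<le> 64 * 9^(j^2)" using pN by linarith
    have "1 \<le> R^expo j * ex.amp ?u (sC j)" using am[OF j(1), of 0] amp0 by simp
    then have "(l^LC j)^2 * 1 \<le> (l^LC j)^2 * (R^expo j * ex.amp ?u (sC j))" by (intro mult_left_mono) auto
    also have "... = R^expo j * ((l^LC j)^2 * ex.amp ?u (sC j))" by simp
    also have "... \<le> R^expo j * (5 * 81^(j^2) * l^2 * (ex.p N x)^2)"
      unfolding N_def using block_C_growth[OF j(1) x j(2) l] R(1) by (intro mult_left_mono) auto
    also have "... \<le> R^expo j * (5 * 81^(j^2) * l^2 * (64 * 9^(j^2)))"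
      using p1 R(1) by (intro mult_left_mono) auto
    also have "... = (320 * l^2) * 729^(j^2) * R^expo j"
    proof -
      have "(729::real)^(j^2) = 81^(j^2) * 9^(j^2)" unfolding power_mult_distrib[symmetric] by simp
      then show ?thesis by simp
    qed
    also have "... \<le> (405 * l^2) * 729^(j^2) * R^expo j" using R(1) by (intro mult_right_mono) auto
    also have "... < l^LC j" by (rule j(3))
    also have "... \<le> (l^LC j)^2" using lL[of j] by (simp add: power2_eq_square)
    finally show False by simp
  qed
  moreover have "\<not> (\<lambda>n. ((ex.p n x)^2 + (ex.p (Suc n) x)^2) / ex.K n x x) \<longlonglongrightarrow> 0"
  proof
    assume "(\<lambda>n. ((ex.p n x)^2 + (ex.p (Suc n) x)^2) / ex.K n x x) \<longlonglongrightarrow> 0"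
    \<comment> \<open>With \<open>l - 1\<close> as threshold, each step multiplies \<open>K\<close>
      by at most \<open>l\<close>.\<close>
    then have "eventually (\<lambda>n. ((ex.p n x)^2 + (ex.p (Suc n) x)^2) / ex.K n x x < l - 1) sequentially"
      using l(1) by (intro order_tendstoD) auto
    then obtain n0 where n0: "\<And>n. n0 \<le> n \<Longrightarrow> ((ex.p n x)^2 + (ex.p (Suc n) x)^2) / ex.K n x x < l - 1"
      by (auto simp: eventually_sequentially)
    have step: "ex.K (Suc n) x x \<le> l * ex.K n x x" if "n0 \<le> n" for n
    proof -
      have "(ex.p n x)^2 + (ex.p (Suc n) x)^2 < (l - 1) * ex.K n x x"
        using n0[OF that] ex.K_pos[of n x] by (simp add: divide_less_eq)
      then show ?thesis using zero_le_power2[of "ex.p n x"] unfolding ex.K_Suc left_diff_distrib power2_eq_square by linarith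
    qed
    have grow: "ex.K (n + k) x x \<le> l^k * ex.K n x x" if "n0 \<le> n" for n k
    proof (induction k)
      case (Suc k)
      have "ex.K (n + Suc k) x x \<le> l * ex.K (n + k) x x" using step[of "n + k"] that by simp
      also have "... \<le> l * (l^k * ex.K n x x)" using Suc l(1) by (intro mult_left_mono) auto
      finally show ?case by simp
    qed simp
    obtain j where j: "1 \<le> j" "x \<notin> Bad j" "(405 * l^2) * 729^(j^2) * R^expo j < l^LC j" "n0 \<le> j"
      using eventually_happens'[OF _ eventually_conj[OF ev eventually_ge_at_top[of n0]]] by auto
    define N where "N = ex.amp ?u (sC j)"
    have "1 \<le> R^expo j * N" using am[OF j(1), of 0] amp0 unfolding N_def by simp
    then have N: "0 < N" using R(1) by (smt (verit) mult_nonneg_nonpos zero_le_power)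
    have "ex.K (sC j) x x \<le> (\<Sum>k\<le>sC j. R^expo j * N)"
      unfolding CD_kernel_def
    proof (rule sum_mono)
      fix k assume "k \<in> {..sC j}"
      then show "ex.p k x * ex.p k x \<le> R^expo j * N"
        using am[OF j(1), of k] zero_le_power2[of "ex.p (Suc k) x"] unfolding N_def ex.amp_def power2_eq_square atMost_iff
        by linarith
    qed
    also have "... = real (sC j + 1) * (R^expo j * N)" by simp
    also have "... \<le> real (7 * 3^(j^2)) * (R^expo j * N)"
      using sC_le[OF j(1)] N R(1) by (intro mult_right_mono) (simp_all only: of_nat_le_iff, auto)
    finally have K: "ex.K (sC j) x x \<le> 7 * 3^(j^2) * (R^expo j * N)" by simp
    have "(l^LC j)^2 * N \<le> 5 * 81^(j^2) * l^2 * (ex.p (sC j + LC j) x)^2"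
      unfolding N_def by (rule block_C_growth[OF j(1) x j(2) l])
    also have "... \<le> 5 * 81^(j^2) * l^2 * ex.K (sC j + LC j) x x"
      using ex.p_sq_le_K[of "sC j + LC j" "sC j + LC j" x] by (intro mult_left_mono) auto
    also have "... \<le> 5 * 81^(j^2) * l^2 * (l^LC j * (7 * 3^(j^2) * (R^expo j * N)))"
    proof (intro mult_left_mono)
      have "ex.K (sC j + LC j) x x \<le> l^LC j * ex.K (sC j) x x" using sC_ge[of j] j(4) by (intro grow) simp
      also have "... \<le> l^LC j * (7 * 3^(j^2) * (R^expo j * N))" using K l(1) by (intro mult_left_mono) auto
      finally show "ex.K (sC j + LC j) x x \<le> l^LC j * (7 * 3^(j^2) * (R^expo j * N))" .
    qed auto
    also have "... = l^LC j * N * ((35 * l^2) * 243^(j^2) * R^expo j)"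
    proof -
      have "(243::real)^(j^2) = 81^(j^2) * 3^(j^2)" unfolding power_mult_distrib[symmetric] by simp
      then show ?thesis by simp
    qed
    finally have "l^LC j * N * l^LC j \<le> l^LC j * N * ((35 * l^2) * 243^(j^2) * R^expo j)"
      by (simp add: power2_eq_square algebra_simps)
    then have "l^LC j \<le> (35 * l^2) * 243^(j^2) * R^expo j" using N lL[of j] by (simp add: mult_le_cancel_left)
    also have "... \<le> (405 * l^2) * 729^(j^2) * R^expo j"
      using R(1) by (intro mult_right_mono mult_mono power_mono) auto
    finally show False using j(3) by simp
  qed
  ultimately show ?thesis by (simp add: escapes_def)
qed

lemma AE_lborel_uminus:
  assumes "AE x in lborel. P (x::real)"
  shows "AE x in lborel. P (- x)"
proof -
  obtain N where N: "{x \<in> space lborel. \<not> P x} \<subseteq> N" "emeasure lborel N = 0" "N \<in> sets lborel"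
    using AE_E[OF assms] by blast
  have "emeasure (distr lborel borel uminus) N = emeasure lborel (uminus -` N \<inter> space lborel)"
    using N(3) by (intro emeasure_distr) auto
  then have "emeasure lborel (uminus -` N) = 0" using N(2) by (simp add: lborel_distr_uminus)
  moreover have "uminus -` N \<in> sets lborel"
    using measurable_sets[of uminus borel borel N] N(3) by simp
  ultimately show ?thesis
    by (intro AE_I'[of "uminus -` N"]) (use N(1) in \<open>auto simp: null_sets_def\<close>)
qed

theorem AE_escapes: "AE x in lborel. x \<in> {-2..2} - {-1..1} \<longrightarrow> escapes x"
proof -
  have 1: "AE x in lborel. 1 < x \<and> x < 2 \<longrightarrow> escapes x"
    using AE_eventually_not_Bad by eventually_elim (use good_escapes in blast)
  then have 2: "AE x in lborel. 1 < - x \<and> - x < 2 \<longrightarrow> escapes (- x)" by (rule AE_lborel_uminus)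
  show ?thesis
    \<comment> \<open>The endpoints 2 and -2, outside the range of \<open>good_escapes\<close>, are
      discarded as null sets.\<close>
    using 1 2 AE_lborel_singleton[of "2::real"] AE_lborel_singleton[of "-2::real"]
    by eventually_elim (auto simp: escapes_minus)
qed

theorem theorem5p2:
  fixes \<rho> :: "real measure"
  assumes spec: "is_spectral_measure ex_a ex_b \<rho>"
  shows "(jacobi_spectrum ex_a ex_b = complex_of_real ` {-2..2}) \<and>
       ((\<lambda>n. (\<Prod>i=1..n. ex_a i) powr (1 / real n)) \<longlonglongrightarrow> 1) \<and>
       (\<exists>N\<in>sets lborel. emeasure lborel N = 0 \<and>
           emeasure \<rho> (({-2..2} - {-1..1}) - N) = 0) \<and>
       (AE x0 in lborel. x0 \<in> {-2..2} - {-1..1} \<longrightarrow> \<not> nevai_at ex_a ex_b \<rho> x0) \<and>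
       (\<forall>A\<in>sets borel. A \<subseteq> {-1<..<1} \<longrightarrow> emeasure lborel A = 0 \<longrightarrow> emeasure \<rho> A = 0) \<and>
       (\<forall>K. compact K \<and> K \<subseteq> {-1<..<1} \<longrightarrow>
           (\<forall>\<epsilon>>0. \<forall>\<^sub>F n in sequentially. \<forall>x0\<in>K.
              (opoly ex_a ex_b n x0)^2 / CD_kernel ex_a ex_b n x0 x0 < \<epsilon>)) \<and>
       (\<forall>x0\<in>{-1<..<1}. nevai_at ex_a ex_b \<rho> x0) \<and>
       (\<forall>K. compact K \<and> K \<subseteq> {-1<..<1} \<longrightarrow>
           (\<forall>f::real \<Rightarrow> real. continuous_on UNIV f \<and> bounded (range f) \<longrightarrow>
              (\<forall>\<epsilon>>0. \<forall>\<^sub>F n in sequentially. \<forall>x0\<in>K.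
                 \<bar>(\<integral>x. f x * (CD_kernel ex_a ex_b n x x0)^2 \<partial>\<rho>) / CD_kernel ex_a ex_b n x0 x0
                   - f x0\<bar> < \<epsilon>)))"
proof -
  interpret jm: jacobi_measure ex_a ex_b \<rho> by unfold_locales (rule spec)
  let ?O = "{-2..2} - {-1..1::real}"
  \<comment> \<open>\<open>S\<close> carries all of \<open>\<rho>\<close> by
    \<open>AE_p_bound\<close>, yet by \<open>AE_escapes\<close> it meets the hyperbolic region in a
    Lebesgue null set only.\<close>
  define S where "S = {x. eventually (\<lambda>n. (ex.p n x)^2 < (real n + 1)^2) sequentially}"
  have S[measurable]: "S \<in> sets borel" unfolding S_def by measurable
  define N where "N = S \<inter> ?O"
  have N: "N \<in> sets lborel" unfolding N_def using S by simp
  have "AE x in lborel. x \<notin> N"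
    using AE_escapes by eventually_elim (auto simp: N_def S_def escapes_def)
  then have N0: "emeasure lborel N = 0" using N by (simp add: AE_iff_measurable[of N])
  have "AE x in \<rho>. x \<in> S" using jm.AE_p_bound by eventually_elim (simp add: S_def)
  then have "emeasure \<rho> (- S) = 0" using S by (subst (asm) AE_iff_measurable[of "- S"]) auto
  then have rN: "emeasure \<rho> (?O - N) = 0"
    using emeasure_mono[of "?O - N" "- S" \<rho>] S unfolding N_def by auto
  have fail: "AE x0 in lborel. x0 \<in> ?O \<longrightarrow> \<not> nevai_at ex_a ex_b \<rho> x0"
    using AE_escapes by eventually_elim (use jm.nevai_imp_ratio in \<open>auto simp: escapes_def\<close>)
  show ?thesis
    by (intro conjI spectrum_eq root_prod_tendsto bexI[of _ N] N N0 rN fail allI ballI impI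
        jm.absolutely_continuous_inside[OF summable_defect] jm.ratio_uniform[OF summable_defect]
        jm.nevai_inside[OF summable_defect] jm.nevai_uniform[OF summable_defect]) simp_all
qed


end
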